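(* Fix $d \geq 4$, and let $a_1,b_1,\ldots,a_n,b_n$ be integers with $0 \leq a_i \leq b_i < d$ for $i = 1,\ldots,n$. The following are equivalent: (i) For all $d$-polytopes $P$ and $Q$, if $\mathscr{F}_{a_i}^{b_i}(P) \cong \mathscr{F}_{a_i}^{b_i}(Q)$ for every $i=1, \ldots, n$, then $\mathscr{F}(P) \cong \mathscr{F}(Q)$. (ii) $\{1, \ldots, d-2\} \subseteq \{a_i, a_i+1, \ldots, b_i\}$ for some $1 \leq i \leq n$.
   Context: A $d$-polytope is the convex hull of a finite point set in $\mathbb{R}^d$ whose affine hull is $\mathbb{R}^d$. A face of a $d$-polytope $P$ is either $P$ itself or a set $P \cap H$, where $H \subset \mathbb{R}^d$ is a hyperplane (codimension one affine subspace) that does not intersect the interior of $P$ (so the empty set is a face). For $0 \le k < d$, a $k$-face is a face whose affine hull has dimension $k$. The face poset $\mathscr{F}(P)$ is the set of all faces of $P$, partially ordered by containment, and $\mathscr{F}^k(P)$ denotes the set of $k$-faces. For $0 \le a \le b < d$, the $(a,b)$-skeleton is $\mathscr{F}_a^b(P) := \bigcup_{k=a}^b \mathscr{F}^k(P)$ with the partial order induced from $\mathscr{F}(P)$. The symbol $\cong$ denotes isomorphism of posets (the isomorphisms for different $i$ in (i) need not be compatible with each other). *)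

theory Defs
  imports "HOL-Analysis.Analysis"
begin

text \<open>The ambient space \<open>'a :: euclidean_space\<close> plays the role of $R^d$ with $d$ = \<open>DIM('a)\<close>.\<close>

definition full_dim_polytope :: "'a::euclidean_space set \<Rightarrow> bool" where
  "full_dim_polytope P \<longleftrightarrow> polytope P \<and> affine hull P = UNIV"

definition hyperplane :: "'a::euclidean_space set \<Rightarrow> bool" where
  "hyperplane H \<longleftrightarrow> affine H \<and> aff_dim H = int DIM('a) - 1"

definition faces :: "'a::euclidean_space set \<Rightarrow> 'a set set" where
  "faces P = {F. F = P \<or> (\<exists>H. hyperplane H \<and> H \<inter> interior P = {} \<and> F = P \<inter> H)}"

text \<open>Dimensions are integers because \<^const>\<open>aff_dim\<close> is; the empty face has dimension \<open>-1\<close>.\<close>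

definition k_faces :: "int \<Rightarrow> 'a::euclidean_space set \<Rightarrow> 'a set set" where
  "k_faces k P = {F \<in> faces P. aff_dim F = k}"

definition skeleton :: "int \<Rightarrow> int \<Rightarrow> 'a::euclidean_space set \<Rightarrow> 'a set set" where
  "skeleton a b P = (\<Union>k\<in>{a..b}. k_faces k P)"

text \<open>Isomorphism of subsets of ordered types, each with the induced order. On sets of sets,
  as for \<^const>\<open>faces\<close> and \<^const>\<open>skeleton\<close>, the order \<open>\<le>\<close> is containment.\<close>

definition poset_isomorphic :: "'a::order set \<Rightarrow> 'b::order set \<Rightarrow> bool"  (infix "\<cong>\<^sub>p" 50) where
  "A \<cong>\<^sub>p B \<longleftrightarrow> (\<exists>f. bij_betw f A B \<and> (\<forall>x\<in>A. \<forall>y\<in>A. x \<le> y \<longleftrightarrow> f x \<le> f y))"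

end

theory Submission
  imports Defs
begin

text \<open>
  Faces in the sense of hyperplanes missing the interior are, for full-dimensional polytopes, the
  faces \<open>F face_of P\<close>, so everything below is about these, graded by
  \<open>aff_dim\<close>. Write \<open>d\<close> for the dimension of the space.

  \<^bold>\<open>Covering \<open>{1..d - 2}\<close> suffices.\<close> An isomorphism of skeleta
  preserves dimensions (\<open>skeleton_iso_preserves_dim\<close>), so the two polytopes share their faces of
  dimensions \<open>1,\<dots>,d - 2\<close>, in particular the incidences between edges and
  2-faces. These determine the vertices. Regard a vertex as the set \<open>S\<close> of edges
  containing it, its star. A star meets each 2-face in no or in two edges, it is connected through
  2-faces, and the remaining edges are connected through 2-faces that avoid \<open>S\<close>.
  Conversely, a set \<open>S\<close> of edges meeting every 2-face in an even number of edges
  consists of the two-coloured edges of some 2-colouring of the vertices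
  (\<open>cocycle_is_coboundary\<close>: the first cohomology of the 2-skeleton vanishes). If in
  addition the other edges are connected away from \<open>S\<close>, they all have the same colour,
  so no two vertices of the opposite colour are adjacent; and if \<open>S\<close> is connected,
  there is just one vertex of that colour (\<open>star_image\<close>). The connectivity statements
  are forms of Balinski's theorem and are proved by walking down a linear functional, in the
  polytope or in a vertex figure. Applied to the polar duals, the same argument recovers the facets
  from the faces of dimensions \<open>d - 3\<close> and \<open>d - 2\<close>
  (\<open>facet_bijection\<close>), and an isomorphism is determined by its effect on covering pairs
  of faces (\<open>iso_from_covers\<close>).

  \<^bold>\<open>Covering \<open>{1..d - 2}\<close> is necessary.\<close> Otherwise every interval
  lies in \<open>{0..d - 3}\<close> or in \<open>{2..d - 1}\<close>, so it is enough to find two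
  polytopes that agree in dimensions up to \<open>d - 3\<close> and, through a possibly different
  bijection, in dimensions from \<open>2\<close> on, but are not isomorphic. Cut a vertex
  \<open>z\<close> off a polytope by a hyperplane that may pass through one further vertex
  \<open>r\<close>: the faces of dimension at least 2 do not see which \<open>r\<close> was chosen
  (\<open>truncations_high_iso\<close>). Dually, stack a point beyond a single facet, possibly in
  the hyperplane of one other facet \<open>q\<close>: the faces of dimension at most
  \<open>d - 3\<close> do not see \<open>q\<close> (\<open>stackings_low_iso\<close>). Do both to
  a simplex, at a vertex and at its opposite facet, with \<open>q\<close> and \<open>r\<close>
  ranging over the other facets and vertices, each facet labelled by the vertex opposite to it. By
  the first remark the high-dimensional faces are independent of \<open>r\<close>, by the second one
  the low-dimensional faces are independent of \<open>q\<close> and, by symmetry, of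
  \<open>r\<close>. But \<open>q = r\<close> gives a pyramid and \<open>q \<noteq> r\<close>
  does not (\<open>stacked_cut_not_iso\<close>).
\<close>

section \<open>Faces and their dimensions\<close>

lemma hyperplane_iff:
  fixes H :: "'a::euclidean_space set"
  shows "hyperplane H \<longleftrightarrow> (\<exists>a b. a \<noteq> 0 \<and> H = {x. a \<bullet> x = b})"
proof
  assume "hyperplane H"
  then have H: "affine hull H = H" "aff_dim H = int DIM('a) - 1"
    by (auto simp: hyperplane_def affine_hull_eq)
  obtain a b where "a \<noteq> 0" "affine hull H = {x. a \<bullet> x = b}"
    using H(2) aff_dim_eq_hyperplane[of H] by auto
  then show "\<exists>a b. a \<noteq> 0 \<and> H = {x. a \<bullet> x = b}" unfolding H(1) by blast
next
  assume "\<exists>a b. a \<noteq> 0 \<and> H = {x. a \<bullet> x = b}"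
  then show "hyperplane H" by (auto simp: hyperplane_def affine_hyperplane)
qed

text \<open>The interior is connected and dense in the polytope, so a hyperplane missing it has
  the whole polytope on one side. Conversely, faces of polyhedra are exposed, and boundedness
  provides a hyperplane cutting out the empty face.\<close>

lemma faces_eq_face_of:
  fixes P :: "'a::euclidean_space set"
  assumes "full_dim_polytope P"
  shows "faces P = {F. F face_of P}"
proof -
  have P: "polytope P" and aff: "affine hull P = UNIV"
    using assms by (auto simp: full_dim_polytope_def)
  have conv: "convex P" and cl: "closed P" and bd: "bounded P" and poly: "polyhedron P"
    using P polytope_imp_convex polytope_imp_closed polytope_imp_bounded polytope_imp_polyhedron by auto
  have int: "interior P \<noteq> {}"
  proof -
    have "P \<noteq> {}" using aff affine_hull_eq_empty[of P] by auto
    then have "rel_interior P \<noteq> {}" using conv rel_interior_eq_empty by blast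
    then show ?thesis using rel_interior_interior[of P] aff by simp
  qed
  have clos: "closure (interior P) = P"
    using conv cl int by (simp add: convex_closure_interior)
  show ?thesis
  proof (intro equalityI subsetI)
    fix F assume "F \<in> faces P"
    then have "F = P \<or> (\<exists>H. hyperplane H \<and> H \<inter> interior P = {} \<and> F = P \<inter> H)"
      unfolding faces_def by (rule CollectD)
    then consider "F = P" | H where "hyperplane H" "H \<inter> interior P = {}" "F = P \<inter> H"
      by (elim disjE exE conjE)
    then consider "F = P" | a b where "a \<noteq> 0" "{x. a \<bullet> x = b} \<inter> interior P = {}" "F = P \<inter> {x. a \<bullet> x = b}"
      by cases (auto simp: hyperplane_iff)
    then show "F \<in> {F. F face_of P}"
    proof cases
      case 1 then show ?thesis using conv face_of_refl by auto
    next
      case 2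
      have sides: "interior P \<subseteq> {x. a \<bullet> x \<le> b} \<or> interior P \<subseteq> {x. a \<bullet> x \<ge> b}"
      proof (rule ccontr)
        assume "\<not> ?thesis"
        then have "\<exists>x\<in>interior P. a \<bullet> x > b" "\<exists>y\<in>interior P. a \<bullet> y < b"
          by (auto simp: subset_iff not_le)
        then obtain x y where xy: "x \<in> interior P" "y \<in> interior P" "a \<bullet> x > b" "a \<bullet> y < b"
          by blast
        have "connected (interior P)" using conv convex_connected convex_interior by blast
        then obtain z where "z \<in> interior P" "a \<bullet> z = b"
          using connected_ivt_hyperplane[of "interior P" y x a b] xy by force
        then show False using 2 by auto
      qed
      have "P \<subseteq> {x. a \<bullet> x \<le> b} \<or> P \<subseteq> {x. a \<bullet> x \<ge> b}"
        using sides closure_minimal[of "interior P"] closed_halfspace_le closed_halfspace_ge clos by metis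
      then show ?thesis
        using face_of_Int_supporting_hyperplane_le[OF conv, of a b]
          face_of_Int_supporting_hyperplane_ge[OF conv, of b a] 2(3) by blast
    qed
  next
    fix F assume "F \<in> {F. F face_of P}"
    then have F: "F exposed_face_of P" "F face_of P" using exposed_face_of_polyhedron[OF poly] by auto
    then consider "F = P" | "F = {}" | a b where "F \<noteq> P" "a \<noteq> 0" "F = P \<inter> {x. a \<bullet> x = b}"
      by (auto simp: exposed_face_of)
    then show "F \<in> faces P"
    proof cases
      case 1 then show ?thesis by (simp add: faces_def)
    next
      case 2
      obtain a :: 'a where a: "a \<in> Basis" by (meson nonempty_Basis ex_in_conv)
      obtain B where B: "\<And>x. x \<in> P \<Longrightarrow> norm x \<le> B" using bd bounded_iff by metis
      have "\<And>x. x \<in> P \<Longrightarrow> a \<bullet> x \<noteq> B + 1"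
        using B Basis_le_norm[OF a] by (smt (verit) inner_commute)
      then have "P \<inter> {x. a \<bullet> x = B + 1} = {}" by auto
      moreover have "a \<noteq> 0" using a nonzero_Basis by auto
      ultimately have "hyperplane {x. a \<bullet> x = B + 1}" "{x. a \<bullet> x = B + 1} \<inter> interior P = {}"
        "F = P \<inter> {x. a \<bullet> x = B + 1}"
        using 2 interior_subset[of P] by (auto simp: hyperplane_iff)
      then show ?thesis unfolding faces_def by blast
    next
      case 3
      have "{x. a \<bullet> x = b} \<inter> interior P = {}"
        using face_of_disjoint_interior[OF F(2) 3(1)] 3(3) interior_subset[of P] by auto
      moreover have "hyperplane {x. a \<bullet> x = b}" using 3 by (auto simp: hyperplane_iff)
      ultimately show ?thesis using 3 unfolding faces_def by blast
    qed
  qed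
qed

lemma skeleton_eq_face_of:
  fixes P :: "'a::euclidean_space set"
  assumes "full_dim_polytope P"
  shows "skeleton a b P = {F. F face_of P \<and> a \<le> aff_dim F \<and> aff_dim F \<le> b}"
  unfolding skeleton_def k_faces_def faces_eq_face_of[OF assms] by auto

lemma exists_facet_above:
  fixes G :: "'a::euclidean_space set"
  assumes "polytope G" "F face_of G" "F \<noteq> G"
  shows "\<exists>H. H face_of G \<and> F \<subseteq> H \<and> aff_dim H = aff_dim G - 1"
proof (cases "F = {}")
  case False
  then show ?thesis
    using face_of_polyhedron_subset_facet[OF polytope_imp_polyhedron[OF assms(1)] assms(2)] assms(3)
    by (metis facet_of_def)
next
  case True
  then have "G \<noteq> {}" using assms by auto
  then have "aff_dim G \<ge> 0" using aff_dim_negative_iff[of G] by linarith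
  then consider "aff_dim G = 0" | "aff_dim G > 0" by linarith
  then show ?thesis
  proof cases
    case 1 then show ?thesis using True by (intro exI[of _ "{}"]) auto
  next
    case 2 then show ?thesis using polytope_facet_exists[OF assms(1)] True by (metis empty_subsetI facet_of_def)
  qed
qed

text \<open>Starting from \<open>G\<close>, pass repeatedly to a facet that still contains
  \<open>F\<close>.\<close>

lemma face_interpolation:
  fixes P :: "'a::euclidean_space set"
  assumes P: "polytope P" and "F face_of P" "G face_of P" "F \<subseteq> G" "aff_dim F \<le> k" "k \<le> aff_dim G"
  shows "\<exists>H. H face_of P \<and> F \<subseteq> H \<and> H \<subseteq> G \<and> aff_dim H = k"
  using assms(3-6)
proof (induction "nat (aff_dim G - k)" arbitrary: G)
  case 0
  then show ?case by (intro exI[of _ G]) auto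
next
  case (Suc n)
  note GP = \<open>G face_of P\<close>
  have G: "polytope G" using GP P face_of_polytope_polytope by blast
  have FG: "F face_of G" using face_of_subset[OF assms(2) \<open>F \<subseteq> G\<close>] GP face_of_imp_subset by blast
  have "F \<noteq> G" using Suc.hyps(2) Suc.prems(3) by auto
  then obtain H where H: "H face_of G" "F \<subseteq> H" "aff_dim H = aff_dim G - 1"
    using exists_facet_above[OF G FG] by auto
  have HP: "H face_of P" using H(1) GP face_of_trans by blast
  have "n = nat (aff_dim H - k)" "k \<le> aff_dim H" using Suc.hyps(2) H(3) by auto
  then obtain H' where "H' face_of P" "F \<subseteq> H'" "H' \<subseteq> H" "aff_dim H' = k"
    using Suc.hyps(1)[of H] HP H(2) Suc.prems(3) by blast
  then show ?case using H(1) face_of_imp_subset by blast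
qed

lemma face_dim_strict_mono:
  fixes P :: "'a::euclidean_space set"
  assumes "polytope P" "F face_of P" "G face_of P" "F \<subset> G"
  shows "aff_dim F < aff_dim G"
  using assms face_of_aff_dim_lt[of G F] face_of_subset[of F P G] face_of_imp_convex face_of_imp_subset by blast

text \<open>Below \<open>F\<close> there is a chain of faces with consecutive dimensions down to
  \<open>a\<close>; its image is still strictly increasing, which leaves no room for a smaller
  dimension at the top.\<close>

lemma strict_mono_dim_le:
  fixes P :: "'a::euclidean_space set" and Q :: "'b::euclidean_space set"
  assumes P: "polytope P" and Q: "polytope Q"
    and f: "\<And>F. F face_of P \<Longrightarrow> a \<le> aff_dim F \<Longrightarrow> aff_dim F \<le> b \<Longrightarrow> f F face_of Q \<and> a \<le> aff_dim (f F)"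
    and mono: "\<And>F G. F face_of P \<Longrightarrow> a \<le> aff_dim F \<Longrightarrow> G face_of P \<Longrightarrow> aff_dim G \<le> b \<Longrightarrow> F \<subset> G \<Longrightarrow> f F \<subset> f G"
    and F: "F face_of P" "a \<le> aff_dim F" "aff_dim F \<le> b"
  shows "aff_dim F \<le> aff_dim (f F)"
  using F
proof (induction "nat (aff_dim F - a)" arbitrary: F)
  case 0
  then show ?case using f[of F] by auto
next
  case (Suc n)
  note FP = \<open>F face_of P\<close>
  show ?case
  proof (cases "F = {}")
    case True then show ?thesis using aff_dim_geq[of "f F"] by auto
  next
    case False
    have "polytope F" using P FP face_of_polytope_polytope by blast
    then obtain H where H: "H face_of F" "aff_dim H = aff_dim F - 1"
      using exists_facet_above[of F "{}"] False by auto
    have HP: "H face_of P" using H(1) FP face_of_trans by blast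
    have a: "a \<le> aff_dim H" "aff_dim H \<le> b" using H(2) Suc.hyps(2) Suc.prems by auto
    have "H \<subset> F" using H face_of_imp_subset by force
    then have "f H \<subset> f F" using mono[OF HP a(1) FP] Suc.prems(3) by blast
    then have "aff_dim (f H) < aff_dim (f F)"
      using face_dim_strict_mono[OF Q] f[OF HP a] f[OF FP] Suc.prems by auto
    moreover have "aff_dim H \<le> aff_dim (f H)"
      using Suc.hyps(1)[of H] Suc.hyps(2) a HP H(2) by auto
    ultimately show ?thesis using H(2) by linarith
  qed
qed

lemma edge_segment:
  fixes P :: "'a::euclidean_space set"
  assumes "polytope P" "e face_of P" "aff_dim e = 1"
  obtains x y where "x \<noteq> y" "e = closed_segment x y" "x extreme_point_of P" "y extreme_point_of P"
proof -
  have e: "polytope e" using assms face_of_polytope_polytope by blast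
  have "collinear e" using assms collinear_aff_dim[of e] by simp
  then obtain x y where xy: "e = closed_segment x y"
    using e compact_convex_collinear_segment[of e] polytope_imp_compact polytope_imp_convex assms(3) by fastforce
  then have "x \<noteq> y" using assms(3) by auto
  then show ?thesis using that xy segment_face_of assms(2) by metis
qed

lemma aff_dim_segment: "x \<noteq> y \<Longrightarrow> aff_dim (closed_segment x (y::'a::euclidean_space)) = 1"
  using segment_convex_hull[of x y] aff_dim_convex_hull[of "{x,y}"] by simp

lemma finite_extreme_points:
  fixes P :: "'a::euclidean_space set"
  assumes "polytope P"
  shows "finite {v. v extreme_point_of P}"
  using assms finite_polyhedron_extreme_points polytope_imp_polyhedron by blast

lemma polytope_hull_extreme:
  fixes P :: "'a::euclidean_space set"
  assumes "polytope P"
  shows "P = convex hull {v. v extreme_point_of P}"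
  using assms Krein_Milman_Minkowski polytope_imp_compact polytope_imp_convex by blast

lemma extreme_lower:
  fixes P :: "'a::euclidean_space set"
  assumes "polytope P" "x \<in> P" "g \<bullet> x < c"
  obtains y where "y extreme_point_of P" "g \<bullet> y < c"
proof -
  have "\<not> P \<subseteq> {x. g \<bullet> x \<ge> c}" using assms by auto
  then have "\<not> {v. v extreme_point_of P} \<subseteq> {x. g \<bullet> x \<ge> c}"
    using polytope_hull_extreme[OF assms(1)] hull_minimal[of _ _ convex] convex_halfspace_ge by metis
  then obtain y where "y extreme_point_of P" "\<not> g \<bullet> y \<ge> c" by blast
  then show ?thesis using that[of y] by auto
qed

text \<open>The intersection of all faces through the point: a relative boundary point would lie
  in a smaller face.\<close>

lemma face_through_point:
  fixes P :: "'a::euclidean_space set"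
  assumes P: "polytope P" and y: "y \<in> P"
  obtains F where "F face_of P" "y \<in> rel_interior F"
proof -
  define F where "F = \<Inter>{F. F face_of P \<and> y \<in> F}"
  have F: "F face_of P" unfolding F_def
    using face_of_refl[OF polytope_imp_convex[OF P]] y by (intro face_of_Inter) auto
  have yF: "y \<in> F" by (auto simp: F_def)
  have polyF: "polytope F" using F P face_of_polytope_polytope by blast
  have "y \<in> rel_interior F"
  proof (rule ccontr)
    assume "y \<notin> rel_interior F"
    then obtain A where A: "A facet_of F" "y \<in> A"
      using rel_boundary_of_polyhedron[OF polytope_imp_polyhedron[OF polyF]] yF by blast
    then have "A face_of P" using F face_of_trans facet_of_imp_face_of by blast
    then have "F \<subseteq> A" using A by (auto simp: F_def)
    then show False using A facet_of_imp_subset facet_of_irrefl by (metis subset_antisym)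
  qed
  then show ?thesis using that F by blast
qed

text \<open>The slice of the relative interior is relatively open in the slice of the affine hull,
  hence has the same affine hull.\<close>

lemma aff_dim_slice:
  fixes F :: "'a::euclidean_space set"
  assumes "rel_interior F \<inter> {x. h \<bullet> x = c} \<noteq> {}" "\<not> F \<subseteq> {x. h \<bullet> x = c}"
  shows "aff_dim (F \<inter> {x. h \<bullet> x = c}) = aff_dim F - 1"
proof -
  let ?H = "{x. h \<bullet> x = c}"
  let ?A = "affine hull F \<inter> ?H"
  have ope: "openin (top_of_set ?A) (rel_interior F \<inter> ?H)"
  proof -
    obtain T where "open T" "rel_interior F = affine hull F \<inter> T"
      using openin_rel_interior[of F] by (auto simp: openin_open)
    then show ?thesis by (auto simp: openin_open)
  qed
  have affA: "affine ?A" using affine_hyperplane affine_Int affine_affine_hull by blast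
  have eqA: "affine hull ?A = ?A" by (rule hull_same) (rule affA)
  have "affine hull (rel_interior F \<inter> ?H) = affine hull ?A"
    by (rule affine_hull_openin) (use ope assms(1) eqA in metis)+
  moreover have "rel_interior F \<inter> ?H \<subseteq> F \<inter> ?H" "F \<inter> ?H \<subseteq> ?A"
    using rel_interior_subset hull_subset[of F affine] by auto
  ultimately have "aff_dim (F \<inter> ?H) = aff_dim ?A"
    using aff_dim_subset[of "rel_interior F \<inter> ?H" "F \<inter> ?H"] aff_dim_subset[of "F \<inter> ?H" ?A]
      aff_dim_affine_hull2[of "rel_interior F \<inter> ?H" ?A] by simp
  also have "\<dots> = aff_dim F - 1"
  proof -
    have "\<not> affine hull F \<subseteq> ?H" using assms(2) hull_subset[of F affine] by blast
    moreover have "affine hull F \<inter> ?H \<noteq> {}"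
      using assms(1) rel_interior_subset hull_subset[of F affine] by blast
    ultimately show ?thesis
      using aff_dim_affine_Int_hyperplane[of "affine hull F" h c] by simp
  qed
  finally show ?thesis .
qed

section \<open>Isomorphisms that preserve dimensions\<close>

text \<open>Dimensions are part of the notion because, once they are matched, isomorphisms
  restrict to every range of dimensions.\<close>

definition dim_iso :: "'a::euclidean_space set set \<Rightarrow> 'b::euclidean_space set set \<Rightarrow> bool" where
  "dim_iso A B \<longleftrightarrow> (\<exists>f. bij_betw f A B \<and> (\<forall>F\<in>A. \<forall>G\<in>A. F \<subseteq> G \<longleftrightarrow> f F \<subseteq> f G) \<and>
     (\<forall>F\<in>A. aff_dim (f F) = aff_dim F))"

text \<open>Both families are described by the same index set, and neither the order nor the
  dimensions depend on which description is used.\<close>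

lemma dim_isoI:
  assumes e1: "bij_betw e1 I A" and e2: "bij_betw e2 I B"
    and ord: "\<And>i j. i \<in> I \<Longrightarrow> j \<in> I \<Longrightarrow> e1 i \<subseteq> e1 j \<longleftrightarrow> e2 i \<subseteq> e2 j"
    and dim: "\<And>i. i \<in> I \<Longrightarrow> aff_dim (e1 i) = aff_dim (e2 i)"
  shows "dim_iso A B"
proof -
  let ?g = "the_inv_into I e1"
  have g: "?g F \<in> I" "e1 (?g F) = F" if "F \<in> A" for F
    using bij_betwE[OF bij_betw_the_inv_into[OF e1]] f_the_inv_into_f_bij_betw[OF e1] that by auto
  show ?thesis unfolding dim_iso_def
  proof (intro exI conjI ballI)
    show "bij_betw (e2 \<circ> ?g) A B" using bij_betw_trans[OF bij_betw_the_inv_into[OF e1] e2] .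
    fix F assume F: "F \<in> A"
    then show "aff_dim ((e2 \<circ> ?g) F) = aff_dim F" using dim[OF g(1)[OF F]] g(2)[OF F] by simp
    fix G assume G: "G \<in> A"
    show "F \<subseteq> G \<longleftrightarrow> (e2 \<circ> ?g) F \<subseteq> (e2 \<circ> ?g) G"
      using ord[OF g(1)[OF F] g(1)[OF G]] g(2)[OF F] g(2)[OF G] by simp
  qed
qed

lemma dim_isoE:
  assumes "dim_iso A B"
  obtains f where "bij_betw f A B" "\<forall>F\<in>A. \<forall>G\<in>A. F \<subseteq> G \<longleftrightarrow> f F \<subseteq> f G"
    "\<forall>F\<in>A. aff_dim (f F) = aff_dim F"
  using assms unfolding dim_iso_def by (elim exE conjE)

lemma dim_iso_sym:
  assumes "dim_iso A B" shows "dim_iso B A"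
proof -
  obtain f where f: "bij_betw f A B" "\<forall>F\<in>A. \<forall>G\<in>A. F \<subseteq> G \<longleftrightarrow> f F \<subseteq> f G"
    "\<forall>F\<in>A. aff_dim (f F) = aff_dim F" using dim_isoE[OF assms] .
  show ?thesis
    by (rule dim_isoI[OF f(1) bij_betw_id]) (simp_all add: f(2) f(3))
qed

lemma dim_iso_trans:
  assumes "dim_iso A B" "dim_iso B C" shows "dim_iso A C"
proof -
  obtain f where f: "bij_betw f A B" "\<And>F G. F \<in> A \<Longrightarrow> G \<in> A \<Longrightarrow> F \<subseteq> G \<longleftrightarrow> f F \<subseteq> f G"
    "\<And>F. F \<in> A \<Longrightarrow> aff_dim (f F) = aff_dim F" using assms(1) by (auto simp: dim_iso_def)
  obtain g where g: "bij_betw g B C" "\<And>F G. F \<in> B \<Longrightarrow> G \<in> B \<Longrightarrow> F \<subseteq> G \<longleftrightarrow> g F \<subseteq> g G"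
    "\<And>F. F \<in> B \<Longrightarrow> aff_dim (g F) = aff_dim F" using assms(2) by (auto simp: dim_iso_def)
  have fB: "F \<in> A \<Longrightarrow> f F \<in> B" for F using bij_betwE[OF f(1)] by blast
  show ?thesis unfolding dim_iso_def
    by (rule exI[of _ "g \<circ> f"]) (use bij_betw_trans[OF f(1) g(1)] f g fB in auto)
qed

lemma bij_betw_dim_restrict:
  assumes "bij_betw f A B" "\<forall>F\<in>A. aff_dim (f F) = aff_dim F"
  shows "bij_betw f {F \<in> A. p (aff_dim F)} {F \<in> B. p (aff_dim F)}"
proof -
  have "f ` {F \<in> A. p (aff_dim F)} = {F \<in> B. p (aff_dim F)}"
    using bij_betw_imp_surj_on[OF assms(1)] assms(2) by auto
  then show ?thesis using bij_betw_imp_inj_on[OF assms(1)] by (auto simp: bij_betw_def inj_on_def)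
qed

lemma dim_iso_restrict:
  assumes "dim_iso A B"
  shows "dim_iso {F \<in> A. p (aff_dim F)} {F \<in> B. p (aff_dim F)}"
proof -
  obtain f where f: "bij_betw f A B" "\<And>F G. F \<in> A \<Longrightarrow> G \<in> A \<Longrightarrow> F \<subseteq> G \<longleftrightarrow> f F \<subseteq> f G"
    "\<And>F. F \<in> A \<Longrightarrow> aff_dim (f F) = aff_dim F" using assms(1) by (auto simp: dim_iso_def)
  have "f ` {F \<in> A. p (aff_dim F)} = {F \<in> B. p (aff_dim F)}"
    using bij_betw_imp_surj_on[OF f(1)] f(3) by auto
  then have "bij_betw f {F \<in> A. p (aff_dim F)} {F \<in> B. p (aff_dim F)}"
    using bij_betw_imp_inj_on[OF f(1)] by (auto simp: bij_betw_def inj_on_def)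
  then show ?thesis unfolding dim_iso_def using f(2,3) by blast
qed

lemma dim_iso_imp_poset_isomorphic: "dim_iso A B \<Longrightarrow> A \<cong>\<^sub>p B"
  by (auto simp: dim_iso_def poset_isomorphic_def)

lemma dim_iso_translation:
  fixes P :: "'a::euclidean_space set"
  shows "dim_iso {F. F face_of P \<and> p (aff_dim F)} {F. F face_of (+) a ` P \<and> p (aff_dim F)}"
proof -
  have "bij_betw ((`) ((+) a)) {F. F face_of P \<and> p (aff_dim F)} {F. F face_of (+) a ` P \<and> p (aff_dim F)}"
  proof (rule bij_betw_imageI)
    show "inj_on ((`) ((+) a)) {F. F face_of P \<and> p (aff_dim F)}"
      by (rule inj_onI) (simp add: inj_image_eq_iff)
    show "(`) ((+) a) ` {F. F face_of P \<and> p (aff_dim F)} = {F. F face_of (+) a ` P \<and> p (aff_dim F)}"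
    proof (intro equalityI subsetI)
      fix G assume "G \<in> (`) ((+) a) ` {F. F face_of P \<and> p (aff_dim F)}"
      then obtain F where F: "F face_of P" "p (aff_dim F)" "G = ((+) a) ` F" by blast
      have "G \<in> {T. T face_of ((+) a) ` P}" unfolding faces_of_translation[of a P] using F by blast
      then show "G \<in> {F. F face_of ((+) a) ` P \<and> p (aff_dim F)}" using F by (simp add: aff_dim_translation_eq)
    next
      fix G assume G: "G \<in> {F. F face_of ((+) a) ` P \<and> p (aff_dim F)}"
      then have "G \<in> {T. T face_of ((+) a) ` P}" by simp
      then obtain F where F: "F face_of P" "G = ((+) a) ` F" unfolding faces_of_translation[of a P] by blast
      have "p (aff_dim F)" using G F(2) by (simp add: aff_dim_translation_eq)
      then show "G \<in> (`) ((+) a) ` {F. F face_of P \<and> p (aff_dim F)}" using F by blast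
    qed
  qed
  then show ?thesis unfolding dim_iso_def
    by (intro exI[of _ "(`) ((+) a)"]) (auto simp: aff_dim_translation_eq inj_image_subset_iff)
qed

lemma dim_iso_linear_image:
  fixes P :: "'a::euclidean_space set" and f :: "'a \<Rightarrow> 'a"
  assumes f: "linear f" "inj f"
  shows "dim_iso {F. F face_of P \<and> p (aff_dim F)} {F. F face_of f ` P \<and> p (aff_dim F)}"
proof -
  have "bij_betw ((`) f) {F. F face_of P \<and> p (aff_dim F)} {F. F face_of f ` P \<and> p (aff_dim F)}"
  proof (rule bij_betw_imageI)
    show "inj_on ((`) f) {F. F face_of P \<and> p (aff_dim F)}"
      by (rule inj_onI) (simp add: inj_image_eq_iff f)
    show "(`) f ` {F. F face_of P \<and> p (aff_dim F)} = {F. F face_of f ` P \<and> p (aff_dim F)}"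
    proof (intro equalityI subsetI)
      fix G assume "G \<in> (`) f ` {F. F face_of P \<and> p (aff_dim F)}"
      then obtain F where F: "F face_of P" "p (aff_dim F)" "G = f ` F" by blast
      have "G \<in> {T. T face_of f ` P}" unfolding faces_of_linear_image[OF f, of P] using F by blast
      then show "G \<in> {F. F face_of f ` P \<and> p (aff_dim F)}" using F by (simp add: aff_dim_injective_linear_image[OF f])
    next
      fix G assume G: "G \<in> {F. F face_of f ` P \<and> p (aff_dim F)}"
      then have "G \<in> {T. T face_of f ` P}" by simp
      then obtain F where F: "F face_of P" "G = f ` F" unfolding faces_of_linear_image[OF f, of P] by blast
      have "p (aff_dim F)" using G F(2) by (simp add: aff_dim_injective_linear_image[OF f])
      then show "G \<in> (`) f ` {F. F face_of P \<and> p (aff_dim F)}" using F by blast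
    qed
  qed
  then show ?thesis unfolding dim_iso_def
    by (intro exI[of _ "(`) f"]) (auto simp: aff_dim_injective_linear_image[OF f] inj_image_subset_iff[OF f(2)])
qed

text \<open>An order isomorphism is strictly increasing in both directions, so dimensions can
  neither drop nor rise.\<close>

lemma skeleton_iso_preserves_dim:
  fixes P :: "'a::euclidean_space set" and Q :: "'b::euclidean_space set"
  assumes P: "polytope P" and Q: "polytope Q"
    and iso: "{F. F face_of P \<and> a \<le> aff_dim F \<and> aff_dim F \<le> b} \<cong>\<^sub>p {F. F face_of Q \<and> a \<le> aff_dim F \<and> aff_dim F \<le> b}"
  shows "dim_iso {F. F face_of P \<and> a \<le> aff_dim F \<and> aff_dim F \<le> b}
    {F. F face_of Q \<and> a \<le> aff_dim F \<and> aff_dim F \<le> b}"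
proof -
  let ?A = "{F. F face_of P \<and> a \<le> aff_dim F \<and> aff_dim F \<le> b}"
  let ?B = "{F. F face_of Q \<and> a \<le> aff_dim F \<and> aff_dim F \<le> b}"
  obtain f where f: "bij_betw f ?A ?B" "\<forall>F\<in>?A. \<forall>G\<in>?A. F \<le> G \<longleftrightarrow> f F \<le> f G"
    using iso unfolding poset_isomorphic_def by (elim exE conjE)
  let ?g = "the_inv_into ?A f"
  have g: "bij_betw ?g ?B ?A" by (rule bij_betw_the_inv_into[OF f(1)])
  have fg: "f (?g G) = G" if "G \<in> ?B" for G using f_the_inv_into_f_bij_betw[OF f(1)] that by blast
  have gf: "?g (f F) = F" if "F \<in> ?A" for F using the_inv_into_f_f[OF bij_betw_imp_inj_on[OF f(1)] that] .
  have fB: "f F \<in> ?B" if "F \<in> ?A" for F using bij_betwE[OF f(1)] that by blast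
  have gA: "?g G \<in> ?A" if "G \<in> ?B" for G using bij_betwE[OF g] that by blast
  have fs: "f F \<subset> f G \<longleftrightarrow> F \<subset> G" if "F \<in> ?A" "G \<in> ?A" for F G
    using f(2) that by (auto simp: less_le_not_le)
  have le1: "aff_dim F \<le> aff_dim (f F)" if F: "F \<in> ?A" for F
  proof (rule strict_mono_dim_le[OF P Q, where a = a and b = b])
    show "F face_of P" "a \<le> aff_dim F" "aff_dim F \<le> b" using F by auto
    fix F assume "F face_of P" "a \<le> aff_dim F" "aff_dim F \<le> b"
    then show "f F face_of Q \<and> a \<le> aff_dim (f F)" using fB[of F] by auto
  next
    fix F G assume FG: "F face_of P" "a \<le> aff_dim F" "G face_of P" "aff_dim G \<le> b" "F \<subset> G"
    have le: "aff_dim F \<le> aff_dim G" using FG(5) by (intro aff_dim_subset) auto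
    have "F \<in> ?A" "G \<in> ?A" using FG(1-4) le by simp_all
    then show "f F \<subset> f G" using fs[of F G] FG(5) by simp
  qed
  have le2: "aff_dim G \<le> aff_dim (?g G)" if G: "G \<in> ?B" for G
  proof (rule strict_mono_dim_le[OF Q P, where a = a and b = b])
    show "G face_of Q" "a \<le> aff_dim G" "aff_dim G \<le> b" using G by auto
    fix F assume "F face_of Q" "a \<le> aff_dim F" "aff_dim F \<le> b"
    then show "?g F face_of P \<and> a \<le> aff_dim (?g F)" using gA[of F] by auto
  next
    fix F G assume FG: "F face_of Q" "a \<le> aff_dim F" "G face_of Q" "aff_dim G \<le> b" "F \<subset> G"
    have le: "aff_dim F \<le> aff_dim G" using FG(5) by (intro aff_dim_subset) auto
    have B: "F \<in> ?B" "G \<in> ?B" using FG(1-4) le by simp_all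
    then show "?g F \<subset> ?g G" using fs[OF gA gA, of F G] fg FG(5) by simp
  qed
  show ?thesis unfolding dim_iso_def
  proof (intro exI conjI)
    show "bij_betw f ?A ?B" by fact
    show "\<forall>F\<in>?A. \<forall>G\<in>?A. F \<subseteq> G \<longleftrightarrow> f F \<subseteq> f G" by (rule f(2))
    show "\<forall>F\<in>?A. aff_dim (f F) = aff_dim F"
    proof
      fix F assume F: "F \<in> ?A"
      show "aff_dim (f F) = aff_dim F" using le1[OF F] le2[OF fB[OF F]] gf[OF F] by simp
    qed
  qed
qed

lemma face_lattice_iso_preserves_dim:
  fixes P :: "'a::euclidean_space set" and Q :: "'a set"
  assumes "polytope P" "polytope Q" "{F. F face_of P} \<cong>\<^sub>p {F. F face_of Q}"
  shows "dim_iso {F. F face_of P} {F. F face_of Q}"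
proof -
  have all: "{F. F face_of R \<and> -1 \<le> aff_dim F \<and> aff_dim F \<le> int DIM('a)} = {F. F face_of R}" for R :: "'a set"
    using aff_dim_geq aff_dim_le_DIM by blast
  show ?thesis
    using skeleton_iso_preserves_dim[OF assms(1,2), of "-1" "int DIM('a)"] assms(3) unfolding all by blast
qed

section \<open>The graph of a polytope and its vertex figures\<close>

lemma rtranclp_weaken:
  assumes "R\<^sup>*\<^sup>* x y" "\<And>a b. R a b \<Longrightarrow> S a b"
  shows "S\<^sup>*\<^sup>* x y"
  using assms(1) by induction (auto intro: rtranclp.rtrancl_into_rtrancl assms(2))

lemma rtranclp_reverse:
  assumes "R\<^sup>*\<^sup>* x y" "\<And>a b. R a b \<Longrightarrow> R b a"
  shows "R\<^sup>*\<^sup>* y x"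
  using assms(1) by induction (auto intro: converse_rtranclp_into_rtranclp assms(2))

lemma segment_crosses:
  fixes h :: "'a::euclidean_space"
  assumes "h \<bullet> v > c" "h \<bullet> x < c"
  shows "\<exists>y \<in> open_segment v x. h \<bullet> y = c"
proof -
  define t where "t = (h \<bullet> v - c) / (h \<bullet> v - h \<bullet> x)"
  have t: "0 < t" "t < 1" using assms by (auto simp: t_def)
  have "h \<bullet> ((1 - t) *\<^sub>R v + t *\<^sub>R x) = h \<bullet> v - t * (h \<bullet> v - h \<bullet> x)"
    by (simp add: inner_add_right algebra_simps)
  also have "\<dots> = c" using assms by (simp add: t_def)
  finally have "h \<bullet> ((1 - t) *\<^sub>R v + t *\<^sub>R x) = c" .
  moreover have "(1 - t) *\<^sub>R v + t *\<^sub>R x \<in> open_segment v x"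
    using t assms by (auto simp: in_segment)
  ultimately show ?thesis by blast
qed

lemma inner_open_segment_less:
  fixes g :: "'a::euclidean_space"
  assumes "y \<in> open_segment v x"
  shows "g \<bullet> y < g \<bullet> v \<longleftrightarrow> g \<bullet> x < g \<bullet> v"
proof -
  obtain t where t: "0 < t" "t < 1" "y = (1 - t) *\<^sub>R v + t *\<^sub>R x"
    using assms by (auto simp: in_segment)
  have "g \<bullet> y = g \<bullet> v + t * (g \<bullet> x - g \<bullet> v)"
    unfolding t(3) by (simp add: inner_add_right inner_diff_right algebra_simps)
  then show ?thesis using t by (simp add: mult_less_0_iff)
qed

lemma segment_level_unique:
  fixes h :: "'a::euclidean_space"
  assumes "z \<in> closed_segment v u" "y \<in> closed_segment v u" "h \<bullet> z = h \<bullet> y" "h \<bullet> u \<noteq> h \<bullet> v"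
  shows "z = y"
proof -
  obtain s where s: "z = (1 - s) *\<^sub>R v + s *\<^sub>R u" using assms(1) by (auto simp: in_segment)
  obtain t where t: "y = (1 - t) *\<^sub>R v + t *\<^sub>R u" using assms(2) by (auto simp: in_segment)
  have "h \<bullet> z = h \<bullet> v + s * (h \<bullet> u - h \<bullet> v)" "h \<bullet> y = h \<bullet> v + t * (h \<bullet> u - h \<bullet> v)"
    unfolding s t by (simp_all add: inner_add_right right_diff_distrib left_diff_distrib)
  then have "s * (h \<bullet> u - h \<bullet> v) = t * (h \<bullet> u - h \<bullet> v)" using assms(3) by linarith
  then have "s = t" using assms(4) by simp
  then show ?thesis unfolding s t by (rule arg_cong[where f = "\<lambda>s. (1 - s) *\<^sub>R v + s *\<^sub>R u"])
qed

text \<open>Edges are given by their end points, so that paths in the graph of a polytope are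
  sequences of points.\<close>

definition adj :: "'a::euclidean_space set \<Rightarrow> 'a \<Rightarrow> 'a \<Rightarrow> bool" where
  "adj P x y \<longleftrightarrow> x \<noteq> y \<and> closed_segment x y face_of P"

lemma adj_sym: "adj P x y \<longleftrightarrow> adj P y x"
  by (auto simp: adj_def closed_segment_commute)

lemma adj_extreme: "adj P x y \<Longrightarrow> x extreme_point_of P \<and> y extreme_point_of P"
  using segment_face_of unfolding adj_def by blast

lemma adj_face:
  assumes "F face_of P"
  shows "adj F x y \<longleftrightarrow> adj P x y \<and> x \<in> F \<and> y \<in> F"
proof -
  have "closed_segment x y \<subseteq> F \<longleftrightarrow> x \<in> F \<and> y \<in> F"
    using face_of_imp_convex[OF assms] closed_segment_subset by (auto simp: subset_iff)
  then show ?thesis using face_of_face[OF assms] by (auto simp: adj_def)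
qed

lemma extreme_point_in_edge:
  assumes "w extreme_point_of P" "w \<in> closed_segment x y" "x \<in> P" "y \<in> P"
  shows "w = x \<or> w = y"
  using assms by (auto simp: extreme_point_of_def open_segment_def)

lemma edge_at_vertex:
  fixes P :: "'a::euclidean_space set"
  assumes "polytope P" "e face_of P" "aff_dim e = 1" "v extreme_point_of P" "v \<in> e"
  obtains u where "adj P v u" "e = closed_segment v u"
proof -
  obtain x y where xy: "x \<noteq> y" "e = closed_segment x y" "x extreme_point_of P" "y extreme_point_of P"
    using edge_segment assms by blast
  then have "v = x \<or> v = y"
    using extreme_point_in_edge[OF assms(4), of x y] assms(5) by (auto simp: extreme_point_of_def)
  moreover have "adj P x y" "adj P y x" "e = closed_segment y x"
    using xy assms(2) by (auto simp: adj_def closed_segment_commute)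
  ultimately show ?thesis using that xy(2) by blast
qed

text \<open>A hyperplane separates the vertex \<open>v\<close> from all other vertices.
  Intersecting with it, as carried out below, turns the faces through \<open>v\<close> into the
  faces of the slice \<open>K\<close>, keeps their order and lowers dimensions by one: edges at
  \<open>v\<close> become vertices, 2-faces become edges.\<close>

locale vertex_figure =
  fixes P :: "'a::euclidean_space set" and v h :: 'a and c :: real
  assumes poly: "polytope P" and vert: "v extreme_point_of P"
    and above: "h \<bullet> v > c" and below: "\<And>x. x extreme_point_of P \<Longrightarrow> x \<noteq> v \<Longrightarrow> h \<bullet> x < c"
begin

definition "H = {x. h \<bullet> x = c}"

definition "K = P \<inter> H"

lemma convP: "convex P" using poly polytope_imp_convex by blast

lemma vP: "v \<in> P" using vert by (simp add: extreme_point_of_def)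

lemma affH: "affine H" by (simp add: H_def affine_hyperplane)

lemma polyK: "polytope K"
  unfolding K_def H_def using poly polyhedron_hyperplane polytope_Int_polyhedron by blast

text \<open>From \<open>v\<close>, every other vertex of \<open>F\<close> is seen through a point
  of the slice.\<close>

lemma face_slice_subset:
  assumes F: "F face_of P" and G: "G face_of P" "v \<in> G" and sub: "F \<inter> H \<subseteq> G" and vF: "v \<in> F"
  shows "F \<subseteq> G"
proof -
  have "polytope F" using F poly face_of_polytope_polytope by blast
  moreover have "{x. x extreme_point_of F} \<subseteq> G"
  proof safe
    fix x assume x: "x extreme_point_of F"
    then have xP: "x extreme_point_of P" "x \<in> F" "x \<in> P"
      using extreme_point_of_face[OF F] by (auto simp: extreme_point_of_def)
    show "x \<in> G"
    proof (cases "x = v")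
      case False
      obtain y where y: "y \<in> open_segment v x" "h \<bullet> y = c"
        using segment_crosses[OF above below[OF xP(1) False]] by blast
      have "y \<in> F" using y(1) vF xP(2) face_of_imp_convex[OF F] convex_contains_open_segment by blast
      then have "y \<in> G" using sub y(2) by (auto simp: H_def)
      then show ?thesis using face_ofD[OF G(1) y(1) vP xP(3)] by blast
    qed (use G in simp)
  qed
  ultimately show ?thesis
    using polytope_hull_extreme[of F] hull_minimal[of _ G convex] face_of_imp_convex[OF G(1)] by metis
qed

text \<open>Take the face of \<open>P\<close> having in its relative interior a relative interior
  point of \<open>J\<close>. It contains \<open>v\<close>, since otherwise all its vertices would
  lie strictly below the slice.\<close>

lemma face_lift:
  assumes J: "J face_of K" "J \<noteq> {}"
  obtains F where "F face_of P" "v \<in> F" "J = F \<inter> H" "aff_dim F = aff_dim J + 1"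
proof -
  obtain y where y: "y \<in> rel_interior J"
    using J face_of_imp_convex rel_interior_eq_empty by blast
  have yJ: "y \<in> J" using y rel_interior_subset by blast
  then have yK: "y \<in> P" "y \<in> H" using face_of_imp_subset[OF J(1)] by (auto simp: K_def)
  obtain F where F: "F face_of P" and rF: "y \<in> rel_interior F"
    using face_through_point[OF poly yK(1)] .
  have yF: "y \<in> F" using rF rel_interior_subset by blast
  have polyF: "polytope F" using F poly face_of_polytope_polytope by blast
  have ne: "rel_interior F \<inter> H \<noteq> {}" using rF yK by blast
  have "rel_interior (F \<inter> H) = rel_interior F \<inter> H"
    using convex_affine_rel_interior_Int[OF face_of_imp_convex[OF F] affH ne] .
  then have "rel_interior (F \<inter> H) \<inter> rel_interior J \<noteq> {}" using rF y yK by blast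
  moreover have "(F \<inter> H) face_of K" unfolding K_def
    using face_of_slice[OF F affine_imp_convex[OF affH]] .
  ultimately have JF: "J = F \<inter> H" using face_of_eq[OF J(1)] by blast
  have vF: "v \<in> F"
  proof (rule ccontr)
    assume "v \<notin> F"
    then have "{x. x extreme_point_of F} \<subseteq> {x. h \<bullet> x < c}"
      using extreme_point_of_face[OF F] below by auto
    then have "F \<subseteq> {x. h \<bullet> x < c}"
      using polytope_hull_extreme[OF polyF] hull_minimal[of _ "{x. h \<bullet> x < c}" convex] convex_halfspace_lt
      by metis
    then show False using yF yK by (auto simp: H_def)
  qed
  have "\<not> F \<subseteq> H" using vF above by (auto simp: H_def)
  then have "aff_dim F = aff_dim J + 1"
    using aff_dim_slice[of F h c] ne unfolding JF H_def by simp
  then show ?thesis by (rule that[OF F vF JF])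
qed

lemma aff_dim_K:
  assumes "P \<noteq> {v}"
  shows "K \<noteq> {}" "aff_dim P = aff_dim K + 1"
proof -
  have "\<not> {x. x extreme_point_of P} \<subseteq> {v}"
  proof
    assume "{x. x extreme_point_of P} \<subseteq> {v}"
    then have "convex hull {x. x extreme_point_of P} \<subseteq> {v}"
      by (rule hull_minimal) (rule convex_singleton)
    then have "P \<subseteq> {v}" unfolding polytope_hull_extreme[OF poly, symmetric] .
    then show False using assms vP by blast
  qed
  then obtain x where x: "x extreme_point_of P" "x \<noteq> v" by blast
  then obtain y where y: "y \<in> open_segment v x" "h \<bullet> y = c"
    using segment_crosses[OF above below] by blast
  have "y \<in> P" using y(1) vP x(1) convP convex_contains_open_segment
    unfolding extreme_point_of_def by blast
  then show ne: "K \<noteq> {}" using y by (auto simp: K_def H_def)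
  obtain F where F: "F face_of P" "v \<in> F" "K = F \<inter> H" "aff_dim F = aff_dim K + 1"
    using face_lift[OF face_of_refl ne] polyK polytope_imp_convex by blast
  have "P \<subseteq> F"
    using face_slice_subset[OF face_of_refl[OF convP] F(1,2) _ vP] F(3) by (auto simp: K_def)
  then have "F = P" using face_of_imp_subset[OF F(1)] by blast
  then show "aff_dim P = aff_dim K + 1" using F by simp
qed

lemma adj_slice:
  assumes "adj P v u"
  obtains y where "y \<in> open_segment v u" "y \<in> H" "y extreme_point_of K"
proof -
  have u: "u extreme_point_of P" "u \<noteq> v" and e: "closed_segment v u face_of P"
    using assms adj_extreme by (auto simp: adj_def)
  obtain y where y: "y \<in> open_segment v u" "h \<bullet> y = c"
    using segment_crosses[OF above below[OF u]] by blast
  have "closed_segment v u \<inter> H = {y}"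
  proof -
    have "z = y" if z: "z \<in> closed_segment v u" "h \<bullet> z = c" for z
    proof (rule segment_level_unique[OF z(1) open_closed_segment[OF y(1)]])
      show "h \<bullet> z = h \<bullet> y" using z(2) y(2) by simp
      show "h \<bullet> u \<noteq> h \<bullet> v" using below[OF u] above by simp
    qed
    moreover have "y \<in> closed_segment v u \<inter> H" using y open_closed_segment[OF y(1)] by (simp add: H_def)
    ultimately show ?thesis unfolding H_def by blast
  qed
  then have "{y} face_of K" using face_of_slice[OF e affine_imp_convex[OF affH]] by (simp add: K_def)
  then show ?thesis using that y by (auto simp: face_of_singleton H_def)
qed

lemma slice_adj:
  assumes "y extreme_point_of K"
  obtains u where "adj P v u" "y \<in> open_segment v u"
proof -
  obtain F where F: "F face_of P" "v \<in> F" "{y} = F \<inter> H" "aff_dim F = aff_dim {y} + 1"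
    using face_lift[of "{y}"] assms by (auto simp: face_of_singleton)
  have dim: "aff_dim F = 1" using F(4) aff_dim_sing[of y] by linarith
  obtain u where u: "adj P v u" "F = closed_segment v u"
    using edge_at_vertex[OF poly F(1) dim vert F(2)] by blast
  have yF: "y \<in> F" "h \<bullet> y = c" using F(3) unfolding H_def by blast+
  have "h \<bullet> u < c" using below[of u] adj_extreme[OF u(1)] u(1) by (auto simp: adj_def)
  then have "y \<noteq> v" "y \<noteq> u" using yF(2) above by auto
  then have "y \<in> open_segment v u" using yF(1) u(2) by (simp add: open_segment_def)
  then show ?thesis using that u by blast
qed

lemma adj_slice_unique:
  assumes "adj P v u" "adj P v u'" "y \<in> open_segment v u" "y \<in> open_segment v u'"
  shows "u = u'"
proof -
  have "closed_segment v u = closed_segment v u'"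
    using face_of_eq[of "closed_segment v u" P "closed_segment v u'"] assms
    by (auto simp: adj_def rel_interior_closed_segment)
  then show ?thesis by (metis closed_segment_eq doubleton_eq_iff)
qed

text \<open>A path in the graph of the vertex figure is a sequence of edges at \<open>v\<close>, consecutive ones
  lying in a common 2-face.\<close>

lemma path_lift:
  assumes "(\<lambda>a b. adj K a b \<and> \<Psi> a \<and> \<Psi> b \<and> \<Phi> (closed_segment a b))\<^sup>*\<^sup>* y y'"
    and "adj P v u" "y \<in> open_segment v u" "adj P v u'" "y' \<in> open_segment v u'"
  shows "(\<lambda>a b. adj P v a \<and> adj P v b \<and> (\<exists>z \<in> open_segment v a. \<Psi> z) \<and> (\<exists>z \<in> open_segment v b. \<Psi> z) \<and>
     (\<exists>t. t face_of P \<and> aff_dim t = 2 \<and> {v, a, b} \<subseteq> t \<and> \<Phi> (t \<inter> H)))\<^sup>*\<^sup>* u u'"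
    (is "?R\<^sup>*\<^sup>* u u'")
  using assms(1,4,5)
proof (induction arbitrary: u' rule: rtranclp_induct)
  case base
  then show ?case using adj_slice_unique assms by blast
next
  case (step z z')
  have ext: "z extreme_point_of K" using step.hyps adj_extreme by blast
  obtain w where w: "adj P v w" "z \<in> open_segment v w" using slice_adj[OF ext] by blast
  have e: "closed_segment z z' face_of K" "z \<noteq> z'" using step.hyps by (auto simp: adj_def)
  obtain t where t: "t face_of P" "v \<in> t" "closed_segment z z' = t \<inter> H"
      "aff_dim t = aff_dim (closed_segment z z') + 1"
    using face_lift[OF e(1)] by auto
  have dim: "aff_dim t = 2" using t(4) aff_dim_segment[OF e(2)] by simp
  have zt: "z \<in> t" "z' \<in> t" using t(3) by auto
  have "w \<in> t"
    using face_ofD[OF t(1) w(2) vP _ zt(1)] adj_extreme[OF w(1)] by (auto simp: extreme_point_of_def)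
  moreover have "u' \<in> t"
    using face_ofD[OF t(1) step.prems(2) vP _ zt(2)] adj_extreme[OF step.prems(1)]
    by (auto simp: extreme_point_of_def)
  ultimately have "?R w u'"
    using w step.prems step.hyps(2) t dim by auto
  moreover have "?R\<^sup>*\<^sup>* u w" using step.IH[OF w] .
  ultimately show ?case by (rule rtranclp.rtrancl_into_rtrancl[rotated])
qed

end

lemma vertex_figure_exists:
  fixes P :: "'a::euclidean_space set"
  assumes P: "polytope P" and v: "v extreme_point_of P"
  obtains h c where "vertex_figure P v h c"
proof -
  have "{v} exposed_face_of P"
    using v exposed_face_of_polyhedron[OF polytope_imp_polyhedron[OF P]] by (simp add: face_of_singleton)
  then consider "{v} = P" | a b where "P \<subseteq> {x. a \<bullet> x \<le> b}" "{v} = P \<inter> {x. a \<bullet> x = b}"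
    by (auto simp: exposed_face_of)
  then show ?thesis
  proof cases
    case 1
    then have "vertex_figure P v 0 (-1)"
      using P v by unfold_locales (auto simp: extreme_point_of_def)
    then show ?thesis using that by blast
  next
    case 2
    let ?A = "(\<bullet>) a ` {x. x extreme_point_of P \<and> x \<noteq> v}"
    have fin: "finite ?A" using finite_extreme_points[OF P] by simp
    have lt: "r < b" if r: "r \<in> ?A" for r
    proof -
      obtain x where x: "x extreme_point_of P" "x \<noteq> v" "r = a \<bullet> x" using r by blast
      then have "x \<in> P" by (simp add: extreme_point_of_def)
      then show ?thesis using 2 x by force
    qed
    define M where "M = Max ?A"
    define c where "c = (if ?A = {} then b - 1 else (M + b) / 2)"
    have c: "c < b" "\<And>r. r \<in> ?A \<Longrightarrow> r < c"
    proof -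
      have mx: "M < b" if "?A \<noteq> {}" using lt[OF Max_in[OF fin that]] by (simp only: M_def)
      then show "c < b" by (auto simp: c_def)
      fix r assume r: "r \<in> ?A"
      have ne: "?A \<noteq> {}" using r by blast
      have "r \<le> M" using Max_ge[OF fin r] by (simp only: M_def)
      then show "r < c" using mx[OF ne] unfolding c_def if_not_P[OF ne] by simp
    qed
    have "a \<bullet> v = b" using 2 by blast
    then have "vertex_figure P v a c"
      using P v c by unfold_locales auto
    then show ?thesis using that by blast
  qed
qed

text \<open>The step of the simplex algorithm. If some point lies below \<open>v\<close>, so does
  some point of the vertex figure, hence one of its vertices, and that one lies on an edge at
  \<open>v\<close>.\<close>

lemma descending_edge:
  fixes P :: "'a::euclidean_space set"
  assumes P: "polytope P" and v: "v extreme_point_of P" and x: "x \<in> P" "g \<bullet> x < g \<bullet> v"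
  obtains u where "adj P v u" "g \<bullet> u < g \<bullet> v"
proof -
  obtain h c where "vertex_figure P v h c" using vertex_figure_exists[OF P v] by blast
  then interpret vertex_figure P v h c .
  obtain w where w: "w extreme_point_of P" "g \<bullet> w < g \<bullet> v" using extreme_lower[OF P x] by blast
  then have "w \<noteq> v" by auto
  then obtain y where y: "y \<in> open_segment v w" "h \<bullet> y = c"
    using segment_crosses[OF above below[OF w(1)]] by blast
  have "y \<in> P" using y(1) vP w(1) convP convex_contains_open_segment
    unfolding extreme_point_of_def by blast
  then have "y \<in> K" using y by (simp add: K_def H_def)
  moreover have "g \<bullet> y < g \<bullet> v" using inner_open_segment_less[OF y(1)] w(2) by blast
  ultimately obtain z where z: "z extreme_point_of K" "g \<bullet> z < g \<bullet> v"
    using extreme_lower[OF polyK] by blast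
  obtain u where u: "adj P v u" "z \<in> open_segment v u" using slice_adj[OF z(1)] by blast
  then show ?thesis using that z inner_open_segment_less[OF u(2)] by blast
qed

lemma descending_path:
  fixes P :: "'a::euclidean_space set"
  assumes P: "polytope P" and v: "v extreme_point_of P"
    and m: "z \<in> P" "g \<bullet> z = m" "\<And>x. x \<in> P \<Longrightarrow> m \<le> g \<bullet> x"
  shows "\<exists>u. u extreme_point_of P \<and> g \<bullet> u = m \<and> (\<lambda>a b. adj P a b \<and> g \<bullet> b < g \<bullet> a)\<^sup>*\<^sup>* v u"
  using v
proof (induction "card {x. x extreme_point_of P \<and> g \<bullet> x < g \<bullet> v}" arbitrary: v rule: less_induct)
  case less
  show ?case
  proof (cases "g \<bullet> v = m")
    case True then show ?thesis using less.prems by blast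
  next
    case False
    have "v \<in> P" using less.prems by (simp add: extreme_point_of_def)
    then have "m < g \<bullet> v" using m(3)[of v] False by simp
    then obtain u where u: "adj P v u" "g \<bullet> u < g \<bullet> v"
      using descending_edge[OF P less.prems m(1)] m(2) by blast
    have ue: "u extreme_point_of P" using adj_extreme[OF u(1)] by blast
    have "{x. x extreme_point_of P \<and> g \<bullet> x < g \<bullet> u} \<subset> {x. x extreme_point_of P \<and> g \<bullet> x < g \<bullet> v}"
      using ue u(2) by auto
    then have "card {x. x extreme_point_of P \<and> g \<bullet> x < g \<bullet> u} < card {x. x extreme_point_of P \<and> g \<bullet> x < g \<bullet> v}"
      using finite_extreme_points[OF P] by (intro psubset_card_mono) auto
    then obtain w where "w extreme_point_of P" "g \<bullet> w = m" "(\<lambda>a b. adj P a b \<and> g \<bullet> b < g \<bullet> a)\<^sup>*\<^sup>* u w"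
      using less.hyps ue by blast
    then show ?thesis using u converse_rtranclp_into_rtranclp[of "\<lambda>a b. adj P a b \<and> g \<bullet> b < g \<bullet> a" v u w] by blast
  qed
qed

lemma minimum_exists:
  fixes P :: "'a::euclidean_space set"
  assumes "polytope P" "x \<in> P"
  obtains z m where "z \<in> P" "g \<bullet> z = m" "\<And>x. x \<in> P \<Longrightarrow> m \<le> g \<bullet> x"
proof -
  have "continuous_on P (\<lambda>x. g \<bullet> x)" by (intro continuous_intros)
  then show ?thesis
    using continuous_attains_inf[of P "\<lambda>x. g \<bullet> x"] polytope_imp_compact[OF assms(1)] assms(2) that
    by (metis empty_iff)
qed

text \<open>Both vertices descend to the face where the functional is minimal. That face has
  smaller dimension unless the functional is constant on \<open>P\<close>; in the latter case the
  condition on the functional is void along every path, and a functional separating the two vertices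
  serves as well.\<close>

lemma graph_connected_below:
  fixes P :: "'a::euclidean_space set"
  assumes "polytope P" "x extreme_point_of P" "y extreme_point_of P" "g \<bullet> x < c" "g \<bullet> y < c"
  shows "(\<lambda>a b. adj P a b \<and> g \<bullet> a < c \<and> g \<bullet> b < c)\<^sup>*\<^sup>* x y"
  using assms
proof (induction "nat (aff_dim P)" arbitrary: P x y g c rule: less_induct)
  case less
  note P = less.prems(1)
  have xyP: "x \<in> P" "y \<in> P" using less.prems by (auto simp: extreme_point_of_def)
  have main: "(\<lambda>a b. adj P a b \<and> g \<bullet> a < c \<and> g \<bullet> b < c)\<^sup>*\<^sup>* x y"
    if g: "p \<in> P" "q \<in> P" "g \<bullet> p \<noteq> g \<bullet> q" "g \<bullet> x < c" "g \<bullet> y < c" for p q g c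
  proof -
    let ?R = "\<lambda>a b. adj P a b \<and> g \<bullet> a < c \<and> g \<bullet> b < c"
    obtain z m where m: "z \<in> P" "g \<bullet> z = m" "\<And>x. x \<in> P \<Longrightarrow> m \<le> g \<bullet> x"
      using minimum_exists[OF P xyP(1)] by metis
    define F where "F = P \<inter> {x. g \<bullet> x = m}"
    have F: "F face_of P" unfolding F_def
      using face_of_Int_supporting_hyperplane_ge[OF polytope_imp_convex[OF P]] m(3) by blast
    have "\<not> P \<subseteq> F"
    proof
      assume "P \<subseteq> F"
      then have "g \<bullet> p = m" "g \<bullet> q = m" using g(1,2) unfolding F_def by blast+
      then show False using g(3) by simp
    qed
    then have "F \<noteq> P" by blast
    then have "aff_dim F < aff_dim P" using face_of_aff_dim_lt[OF polytope_imp_convex[OF P] F] by blast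
    moreover have "0 \<le> aff_dim F"
    proof -
      have "z \<in> F" using m(1,2) by (simp add: F_def)
      then have "\<not> aff_dim F < 0" unfolding aff_dim_negative_iff by blast
      then show ?thesis by linarith
    qed
    ultimately have dim: "nat (aff_dim F) < nat (aff_dim P)" by simp
    have polyF: "polytope F" using F P face_of_polytope_polytope by blast
    have path: "\<exists>u. u extreme_point_of P \<and> g \<bullet> u = m \<and> ?R\<^sup>*\<^sup>* v u" if v: "v extreme_point_of P" "g \<bullet> v < c" for v
    proof -
      obtain u where u: "u extreme_point_of P" "g \<bullet> u = m" "(\<lambda>a b. adj P a b \<and> g \<bullet> b < g \<bullet> a)\<^sup>*\<^sup>* v u"
        using descending_path[OF P v(1) m] by blast
      from u(3) have "?R\<^sup>*\<^sup>* v u \<and> g \<bullet> u < c"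
      proof (induction rule: rtranclp_induct)
        case base then show ?case using v by simp
      next
        case (step a b)
        then have "?R a b" by auto
        moreover have "?R\<^sup>*\<^sup>* v a" using step.IH by blast
        ultimately have "?R\<^sup>*\<^sup>* v b" by (rule rtranclp.rtrancl_into_rtrancl[rotated])
        then show ?case using \<open>?R a b\<close> by blast
      qed
      then show ?thesis using u by blast
    qed
    obtain u where u: "u extreme_point_of P" "g \<bullet> u = m" "?R\<^sup>*\<^sup>* x u" using path less.prems g by blast
    obtain w where w: "w extreme_point_of P" "g \<bullet> w = m" "?R\<^sup>*\<^sup>* y w" using path less.prems g by blast
    have "u extreme_point_of F" "w extreme_point_of F"
      using u w extreme_point_of_face[OF F] by (auto simp: F_def extreme_point_of_def)
    then have "(\<lambda>a b. adj F a b \<and> g \<bullet> a < m + 1 \<and> g \<bullet> b < m + 1)\<^sup>*\<^sup>* u w"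
      using less.hyps[OF dim polyF] u(2) w(2) by simp
    moreover have "?R a b" if "adj F a b \<and> g \<bullet> a < m + 1 \<and> g \<bullet> b < m + 1" for a b
      using that adj_face[OF F] m(3)[of x] g(4) xyP(1) by (auto simp: F_def)
    ultimately have uw: "?R\<^sup>*\<^sup>* u w" by (rule rtranclp_weaken)
    have "?R\<^sup>*\<^sup>* w y" by (rule rtranclp_reverse[OF w(3)]) (auto simp: adj_sym)
    then show ?thesis using u(3) uw rtranclp_trans[of ?R] by blast
  qed
  show ?case
  proof (cases "x = y")
    case True then show ?thesis by simp
  next
    case False
    show ?thesis
    proof (cases "\<exists>p\<in>P. \<exists>q\<in>P. g \<bullet> p \<noteq> g \<bullet> q")
      case True then show ?thesis using main less.prems by blast
    next
      case const: False
      define g' where "g' = y - x"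
      have "g' \<bullet> x \<noteq> g' \<bullet> y" using False
        by (metis g'_def inner_diff_right inner_eq_zero_iff right_minus_eq)
      then have conn: "(\<lambda>a b. adj P a b \<and> g' \<bullet> a < max (g' \<bullet> x) (g' \<bullet> y) + 1 \<and> g' \<bullet> b < max (g' \<bullet> x) (g' \<bullet> y) + 1)\<^sup>*\<^sup>* x y"
        using main[OF xyP, of g' "max (g' \<bullet> x) (g' \<bullet> y) + 1"] by simp
      have low: "g \<bullet> a < c \<and> g \<bullet> b < c" if "adj P a b" for a b
        using adj_extreme[OF that] const xyP less.prems(4) by (metis extreme_point_of_def)
      show ?thesis by (rule rtranclp_weaken[OF conn]) (use low in blast)
    qed
  qed
qed

lemma graph_connected:
  fixes P :: "'a::euclidean_space set"
  assumes "polytope P" "x extreme_point_of P" "y extreme_point_of P"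
  shows "(adj P)\<^sup>*\<^sup>* x y"
  using graph_connected_below[OF assms, of 0 1] by simp

text \<open>If \<open>F\<close> is all of \<open>P\<close>, vertices and edges are too small to
  contain it. Otherwise, a functional that is maximal exactly on \<open>F\<close> leads from every
  vertex down to the opposite face. Only the first step can start in \<open>F\<close>, and an edge
  that leaves \<open>F\<close> contains \<open>F\<close> only if \<open>F\<close> is its starting
  point.\<close>

lemma graph_connected_away_from_face:
  fixes P :: "'a::euclidean_space set"
  assumes P: "polytope P" and dim: "2 \<le> aff_dim P" and F: "F face_of P" "F \<noteq> {}"
    and x: "x extreme_point_of P" "{x} \<noteq> F" and y: "y extreme_point_of P" "{y} \<noteq> F"
  shows "(\<lambda>a b. adj P a b \<and> {a} \<noteq> F \<and> {b} \<noteq> F \<and> \<not> F \<subseteq> closed_segment a b)\<^sup>*\<^sup>* x y"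
    (is "?R\<^sup>*\<^sup>* x y")
proof (cases "F = P")
  case True
  have "\<not> P \<subseteq> closed_segment a b" for a b
    using aff_dim_subset[of P "closed_segment a b"] dim aff_dim_segment[of a b] by (cases "a = b") auto
  moreover have "{a} \<noteq> P" for a using dim by auto
  ultimately show ?thesis using graph_connected[OF P x(1) y(1)] True by simp
next
  case False
  have "F exposed_face_of P"
    using F exposed_face_of_polyhedron[OF polytope_imp_polyhedron[OF P]] by simp
  then obtain a b where ab: "P \<subseteq> {x. a \<bullet> x \<le> b}" "F = P \<inter> {x. a \<bullet> x = b}"
    using False F(2) by (auto simp: exposed_face_of)
  obtain z m where m: "z \<in> P" "a \<bullet> z = m" "\<And>x. x \<in> P \<Longrightarrow> m \<le> a \<bullet> x"
    using minimum_exists[OF P, of x] x(1) by (metis extreme_point_of_def)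
  have "m < b"
  proof (rule ccontr)
    assume "\<not> m < b"
    then have "P \<subseteq> F" using ab m(3) by force
    then show False using False F(1) face_of_imp_subset by blast
  qed
  define M where "M = P \<inter> {x. a \<bullet> x = m}"
  have M: "M face_of P" unfolding M_def
    using face_of_Int_supporting_hyperplane_ge[OF polytope_imp_convex[OF P]] m(3) by blast
  have polyM: "polytope M" using M P face_of_polytope_polytope by blast
  have below: "?R u w" if uw: "adj P u w" "a \<bullet> u < b" "a \<bullet> w < b" for u w
  proof -
    have "closed_segment u w \<subseteq> {x. a \<bullet> x < b}"
      using uw closed_segment_subset[of u "{x. a \<bullet> x < b}" w] convex_halfspace_lt by auto
    then show ?thesis using uw F(2) ab(2) by auto
  qed
  have edge_ok: "?R u w" if uw: "adj P u w" "{u} \<noteq> F" "a \<bullet> w < b" for u w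
  proof (cases "a \<bullet> u < b")
    case True then show ?thesis using below uw by blast
  next
    case False
    have uP: "u extreme_point_of P" "w extreme_point_of P" "u \<in> P" using adj_extreme[OF uw(1)] by (auto simp: extreme_point_of_def)
    then have uF: "u \<in> F" using False ab by auto
    have "\<not> F \<subseteq> closed_segment u w"
    proof
      assume sub: "F \<subseteq> closed_segment u w"
      have "{x. x extreme_point_of F} \<subseteq> {u}"
      proof safe
        fix x assume "x extreme_point_of F"
        then have "x extreme_point_of P" "x \<in> F" using extreme_point_of_face[OF F(1)] by auto
        then have "x = u \<or> x = w"
          using extreme_point_in_edge[of x P u w] sub uP by (auto simp: extreme_point_of_def)
        then show "x = u" using \<open>x \<in> F\<close> uw(3) ab by auto
      qed
      moreover have "F = convex hull {x. x extreme_point_of F}"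
        using polytope_hull_extreme face_of_polytope_polytope[OF P F(1)] by blast
      ultimately have "F \<subseteq> convex hull {u}" using hull_mono by metis
      then show False using uw(2) F(2) by auto
    qed
    moreover have "{w} \<noteq> F" using uw(3) ab by auto
    ultimately show ?thesis using uw by auto
  qed
  have path: "\<exists>u. u extreme_point_of M \<and> ?R\<^sup>*\<^sup>* v u" if v: "v extreme_point_of P" "{v} \<noteq> F" for v
  proof -
    obtain u where u: "u extreme_point_of P" "a \<bullet> u = m" "(\<lambda>p q. adj P p q \<and> a \<bullet> q < a \<bullet> p)\<^sup>*\<^sup>* v u"
      using descending_path[OF P v(1) m] by blast
    from u(3) have "?R\<^sup>*\<^sup>* v u \<and> {u} \<noteq> F"
    proof (induction rule: rtranclp_induct)
      case base then show ?case using v by simp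
    next
      case (step p q)
      have "p \<in> P" using adj_extreme step.hyps by (auto simp: extreme_point_of_def)
      then have "a \<bullet> q < b" using step.hyps ab(1) by force
      then have "?R p q" using edge_ok[of p q] step by blast
      moreover have "?R\<^sup>*\<^sup>* v p" using step.IH by blast
      ultimately have "?R\<^sup>*\<^sup>* v q" by (rule rtranclp.rtrancl_into_rtrancl[rotated])
      then show ?case using \<open>?R p q\<close> by blast
    qed
    moreover have "u extreme_point_of M"
      using u extreme_point_of_face[OF M] by (auto simp: M_def extreme_point_of_def)
    ultimately show ?thesis by blast
  qed
  obtain u where u: "u extreme_point_of M" "?R\<^sup>*\<^sup>* x u" using path x by blast
  obtain w where w: "w extreme_point_of M" "?R\<^sup>*\<^sup>* y w" using path y by blast
  have "(adj M)\<^sup>*\<^sup>* u w" using graph_connected[OF polyM u(1) w(1)] .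
  moreover have "?R p q" if "adj M p q" for p q
    using that adj_face[OF M] below[of p q] \<open>m < b\<close> by (auto simp: M_def)
  ultimately have uw: "?R\<^sup>*\<^sup>* u w" by (rule rtranclp_weaken)
  have "?R\<^sup>*\<^sup>* w y" by (rule rtranclp_reverse[OF w(2)]) (auto simp: adj_sym closed_segment_commute)
  then show ?thesis using u(2) uw rtranclp_trans[of ?R] by blast
qed

text \<open>The vertex figure of a polygon is a segment.\<close>

lemma polygon_neighbours:
  fixes t :: "'a::euclidean_space set"
  assumes "polytope t" "aff_dim t = 2" "v extreme_point_of t"
  obtains u1 u2 where "u1 \<noteq> u2" "\<And>u. adj t v u \<longleftrightarrow> u = u1 \<or> u = u2"
proof -
  obtain h c where "vertex_figure t v h c" using vertex_figure_exists assms by blast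
  then interpret vertex_figure t v h c .
  have "t \<noteq> {v}" using assms(2) by auto
  then have "aff_dim K = 1" using aff_dim_K(2) assms(2) by linarith
  then obtain y1 y2 where y: "y1 \<noteq> y2" "K = closed_segment y1 y2"
    using edge_segment[OF polyK face_of_refl[OF polytope_imp_convex[OF polyK]]] by blast
  have ext: "y extreme_point_of K \<longleftrightarrow> y = y1 \<or> y = y2" for y
    unfolding y(2) by (rule extreme_point_of_segment)
  obtain u1 where u1: "adj t v u1" "y1 \<in> open_segment v u1" using slice_adj ext by blast
  obtain u2 where u2: "adj t v u2" "y2 \<in> open_segment v u2" using slice_adj ext by blast
  have yH: "h \<bullet> y1 = c" "h \<bullet> y2 = c"
    using y(2) ends_in_segment[of y1 y2] by (auto simp: K_def H_def)
  have "u1 \<noteq> u2"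
  proof
    assume eq: "u1 = u2"
    have "h \<bullet> u1 \<noteq> h \<bullet> v" using below[of u1] above adj_extreme[OF u1(1)] u1(1) by (auto simp: adj_def)
    moreover have "y1 \<in> closed_segment v u1" "y2 \<in> closed_segment v u1"
      using open_closed_segment[OF u1(2)] open_closed_segment[OF u2(2)] eq by simp_all
    ultimately show False using segment_level_unique[of y1 v u1 y2 h] yH y(1) by simp
  qed
  moreover have "adj t v u \<longleftrightarrow> u = u1 \<or> u = u2" for u
  proof
    assume u: "adj t v u"
    obtain y where yu: "y \<in> open_segment v u" "y extreme_point_of K" using adj_slice[OF u] by blast
    have "y = y1 \<or> y = y2" using ext yu(2) by blast
    then show "u = u1 \<or> u = u2"
      using adj_slice_unique[OF u u1(1) yu(1)] adj_slice_unique[OF u u2(1) yu(1)] u1(2) u2(2) by auto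
  next
    assume "u = u1 \<or> u = u2"
    then show "adj t v u" using u1 u2 by blast
  qed
  ultimately show ?thesis by (rule that)
qed

text \<open>The edges from \<open>v\<close> to \<open>a\<close> and to \<open>b\<close> lie in a
  common 2-face, that is, the corresponding vertices of the vertex figure are adjacent or
  equal.\<close>

definition linked :: "'a::euclidean_space set \<Rightarrow> 'a \<Rightarrow> 'a \<Rightarrow> 'a \<Rightarrow> bool" where
  "linked P v a b \<longleftrightarrow> (\<exists>t. t face_of P \<and> aff_dim t = 2 \<and> {v, a, b} \<subseteq> t)"

text \<open>Since points of the slice are lower than \<open>v\<close> exactly if the edges through
  them descend, this is connectedness below a level in the graph of the vertex figure.\<close>

lemma lower_edges_linked:
  fixes P :: "'a::euclidean_space set"
  assumes P: "polytope P" and x: "adj P v x" "g \<bullet> x < g \<bullet> v" and x': "adj P v x'" "g \<bullet> x' < g \<bullet> v"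
  shows "(\<lambda>a b. adj P v a \<and> adj P v b \<and> g \<bullet> a < g \<bullet> v \<and> g \<bullet> b < g \<bullet> v \<and> linked P v a b)\<^sup>*\<^sup>* x x'"
proof -
  have "v extreme_point_of P" using adj_extreme x(1) by blast
  then obtain h c where "vertex_figure P v h c" using vertex_figure_exists P by blast
  then interpret vertex_figure P v h c .
  obtain y where y: "y \<in> open_segment v x" "y extreme_point_of K" using adj_slice[OF x(1)] by blast
  obtain y' where y': "y' \<in> open_segment v x'" "y' extreme_point_of K" using adj_slice[OF x'(1)] by blast
  have "(\<lambda>a b. adj K a b \<and> g \<bullet> a < g \<bullet> v \<and> g \<bullet> b < g \<bullet> v)\<^sup>*\<^sup>* y y'"
    using graph_connected_below[OF polyK y(2) y'(2)] inner_open_segment_less[OF y(1)]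
      inner_open_segment_less[OF y'(1)] x(2) x'(2) by blast
  then have path: "(\<lambda>a b. adj K a b \<and> g \<bullet> a < g \<bullet> v \<and> g \<bullet> b < g \<bullet> v \<and> True)\<^sup>*\<^sup>* y y'" by simp
  show ?thesis
    by (rule rtranclp_weaken[OF path_lift[where \<Psi> = "\<lambda>a. g \<bullet> a < g \<bullet> v" and \<Phi> = "\<lambda>_. True", OF path x(1) y(1) x'(1) y'(1)]])
      (use inner_open_segment_less in \<open>auto simp: linked_def\<close>)
qed

lemma edges_linked:
  fixes P :: "'a::euclidean_space set"
  assumes P: "polytope P" and x: "adj P v x" and x': "adj P v x'"
  shows "(\<lambda>a b. adj P v a \<and> adj P v b \<and> linked P v a b)\<^sup>*\<^sup>* x x'"
proof -
  have "v extreme_point_of P" using adj_extreme x(1) by blast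
  then obtain h c where "vertex_figure P v h c" using vertex_figure_exists P by blast
  then interpret vertex_figure P v h c .
  obtain y where y: "y \<in> open_segment v x" "y extreme_point_of K" using adj_slice[OF x(1)] by blast
  obtain y' where y': "y' \<in> open_segment v x'" "y' extreme_point_of K" using adj_slice[OF x'(1)] by blast
  have path: "(\<lambda>a b. adj K a b \<and> True \<and> True \<and> True)\<^sup>*\<^sup>* y y'"
    using graph_connected[OF polyK y(2) y'(2)] by simp
  show ?thesis
    by (rule rtranclp_weaken[OF path_lift[where \<Psi> = "\<lambda>_. True" and \<Phi> = "\<lambda>_. True", OF path x(1) y(1) x'(1) y'(1)]])
      (auto simp: linked_def)
qed

text \<open>In the vertex figure at \<open>v\<close>, the faces coming from faces through
  \<open>w\<close> are those that contain the slice \<open>J\<close> of the smallest face through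
  \<open>v\<close> and \<open>w\<close>. So this is connectedness of the graph of the vertex figure
  away from \<open>J\<close>.\<close>

lemma edges_linked_avoiding:
  fixes P :: "'a::euclidean_space set"
  assumes P: "polytope P" and dim: "3 \<le> aff_dim P" and w: "w extreme_point_of P" "w \<noteq> v"
    and x: "adj P v x" "x \<noteq> w" and x': "adj P v x'" "x' \<noteq> w"
  shows "(\<lambda>a b. adj P v a \<and> adj P v b \<and> (\<exists>t. t face_of P \<and> aff_dim t = 2 \<and> {v, a, b} \<subseteq> t \<and> w \<notin> t))\<^sup>*\<^sup>* x x'"
proof -
  have "v extreme_point_of P" using adj_extreme x(1) by blast
  then obtain h c where "vertex_figure P v h c" using vertex_figure_exists P by blast
  then interpret vertex_figure P v h c .
  have wP: "w \<in> P" using w by (simp add: extreme_point_of_def)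
  obtain y where y: "y \<in> open_segment v x" "y \<in> H" "y extreme_point_of K" using adj_slice[OF x(1)] by blast
  obtain y' where y': "y' \<in> open_segment v x'" "y' \<in> H" "y' extreme_point_of K" using adj_slice[OF x'(1)] by blast
  define F where "F = \<Inter>{F. F face_of P \<and> v \<in> F \<and> w \<in> F}"
  have F: "F face_of P" unfolding F_def
    using face_of_refl[OF convP] vP wP by (intro face_of_Inter) auto
  have vwF: "v \<in> F" "w \<in> F" by (auto simp: F_def)
  have Fmin: "F \<subseteq> G" if "G face_of P" "v \<in> G" "w \<in> G" for G using that by (auto simp: F_def)
  define J where "J = F \<inter> H"
  have J: "J face_of K" unfolding J_def K_def by (rule face_of_slice[OF F affine_imp_convex[OF affH]])
  obtain z where z: "z \<in> open_segment v w" "h \<bullet> z = c"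
    using segment_crosses[OF above below[OF w]] by blast
  have "z \<in> F" using z(1) vwF face_of_imp_convex[OF F] convex_contains_open_segment by blast
  then have J0: "J \<noteq> {}" using z(2) by (auto simp: J_def H_def)
  have away: "w \<notin> G" if G: "G face_of P" "v \<in> G" "\<not> J \<subseteq> G \<inter> H" for G
    using Fmin[OF G(1,2)] G(3) by (auto simp: J_def)
  have single: "{y} \<noteq> J" if y: "y \<in> open_segment v x" and x: "adj P v x" "x \<noteq> w" for x y
  proof
    assume "{y} = J"
    then have "F \<inter> H \<subseteq> closed_segment v x" using open_closed_segment[OF y] by (auto simp: J_def)
    then have "F \<subseteq> closed_segment v x"
      using face_slice_subset[OF F _ _ _ vwF(1), of "closed_segment v x"] x(1) by (simp add: adj_def)
    then have "w = v \<or> w = x"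
      using extreme_point_in_edge[OF w(1)] vwF(2) adj_extreme[OF x(1)] by (auto simp: extreme_point_of_def)
    then show False using w(2) x(2) by blast
  qed
  have "P \<noteq> {v}" using wP w(2) by blast
  then have dimK: "2 \<le> aff_dim K" using aff_dim_K(2) dim by linarith
  have "(\<lambda>a b. adj K a b \<and> {a} \<noteq> J \<and> {b} \<noteq> J \<and> \<not> J \<subseteq> closed_segment a b)\<^sup>*\<^sup>* y y'"
    by (rule graph_connected_away_from_face[OF polyK dimK J J0 y(3) single[OF y(1) x] y'(3) single[OF y'(1) x']])
  then have path: "(\<lambda>a b. adj K a b \<and> True \<and> True \<and> \<not> J \<subseteq> closed_segment a b)\<^sup>*\<^sup>* y y'"
    by (rule rtranclp_weaken) blast
  show ?thesis
    by (rule rtranclp_weaken[OF path_lift[where \<Psi> = "\<lambda>_. True" and \<Phi> = "\<lambda>A. \<not> J \<subseteq> A", OF path x(1) y(1) x'(1) y'(1)]])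
      (use away in blast)
qed

section \<open>Even edge sets are cuts\<close>

text \<open>Finitely many hyperplanes, one for each pair of points to be separated, have measure
  zero.\<close>

lemma generic_functional:
  fixes V :: "'a::euclidean_space set"
  assumes "finite V"
  obtains g where "inj_on (\<lambda>x. g \<bullet> x) V"
proof -
  let ?B = "(\<Union>(x, y) \<in> {(x, y). x \<in> V \<and> y \<in> V \<and> x \<noteq> y}. {g. (x - y) \<bullet> g = 0})"
  have "finite {(x, y). x \<in> V \<and> y \<in> V \<and> x \<noteq> y}"
    by (rule finite_subset[of _ "V \<times> V"]) (use assms in auto)
  then have "negligible ?B"
    by (intro negligible_Union) (auto intro!: negligible_hyperplane)
  then have "?B \<noteq> UNIV" using non_negligible_UNIV by metis
  then obtain g where g: "g \<notin> ?B" by blast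
  have "inj_on (\<lambda>x. g \<bullet> x) V"
  proof (rule inj_onI)
    fix x y assume xy: "x \<in> V" "y \<in> V" "g \<bullet> x = g \<bullet> y"
    then have "(x - y) \<bullet> g = 0" by (simp add: inner_diff_left inner_diff_right inner_commute)
    then show "x = y" using g xy by blast
  qed
  then show ?thesis by (rule that)
qed

definition edges :: "'a::euclidean_space set \<Rightarrow> 'a set set" where
  "edges P = {e. e face_of P \<and> aff_dim e = 1}"

lemma edges_obtain:
  assumes "polytope P" "e \<in> edges P"
  obtains x y where "adj P x y" "e = closed_segment x y"
proof -
  have e: "e face_of P" "aff_dim e = 1" using assms(2) by (auto simp: edges_def)
  obtain x y where "x \<noteq> y" "e = closed_segment x y"
    using edge_segment[OF assms(1) e] by metis
  then show ?thesis using that e(1) by (auto simp: adj_def)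
qed

lemma adj_edge: "adj P x y \<Longrightarrow> closed_segment x y \<in> edges P"
  by (auto simp: edges_def adj_def aff_dim_segment)

lemma edges_face: "t face_of P \<Longrightarrow> edges t = {e \<in> edges P. e \<subseteq> t}"
  using face_of_face by (auto simp: edges_def)

lemma edge_extreme_points:
  assumes "adj P x y"
  shows "{z. z extreme_point_of P \<and> z \<in> closed_segment x y} = {x, y}"
  using adj_extreme[OF assms] extreme_point_in_edge[of _ P x y] by (auto simp: extreme_point_of_def)

lemma finite_edges: "polytope P \<Longrightarrow> finite (edges P)"
  unfolding edges_def by (rule finite_subset[OF _ finite_polytope_faces]) auto

lemma polygon_edges_at_vertex:
  assumes "polytope t" "aff_dim t = 2" "v extreme_point_of t"
  shows "card {e \<in> edges t. v \<in> e} = 2"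
proof -
  obtain u1 u2 where u: "u1 \<noteq> u2" "\<And>u. adj t v u \<longleftrightarrow> u = u1 \<or> u = u2"
    using polygon_neighbours[OF assms] by metis
  have "{e \<in> edges t. v \<in> e} = {closed_segment v u1, closed_segment v u2}"
  proof (intro equalityI subsetI)
    fix e assume "e \<in> {e \<in> edges t. v \<in> e}"
    then obtain w where "adj t v w" "e = closed_segment v w"
      using edge_at_vertex[OF assms(1) _ _ assms(3), of e] by (auto simp: edges_def)
    then show "e \<in> {closed_segment v u1, closed_segment v u2}" using u(2) by auto
  next
    fix e assume "e \<in> {closed_segment v u1, closed_segment v u2}"
    then show "e \<in> {e \<in> edges t. v \<in> e}" using adj_edge u(2) by fastforce
  qed
  moreover have "closed_segment v u1 \<noteq> closed_segment v u2"
    using u(1) by (auto simp: closed_segment_eq doubleton_eq_iff)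
  ultimately show ?thesis by simp
qed

text \<open>Count the pairs of an edge of the polygon and a marked end point of it. Each vertex
  lies on two edges, so the count is even. Hence the number of edges with ends of different colours
  is even too, and if membership in \<open>S\<close> agrees with having differently coloured ends
  for all edges but one, it agrees for the last one.\<close>

lemma polygon_parity:
  fixes t :: "'a::euclidean_space set" and k :: "'a \<Rightarrow> bool"
  assumes t: "polytope t" "aff_dim t = 2" and even: "even (card (edges t \<inter> S))"
    and xy: "adj t x y"
    and others: "\<And>a b. adj t a b \<Longrightarrow> closed_segment a b \<noteq> closed_segment x y \<Longrightarrow>
      closed_segment a b \<in> S \<longleftrightarrow> k a \<noteq> k b"
  shows "closed_segment x y \<in> S \<longleftrightarrow> k x \<noteq> k y"
proof -
  let ?V = "{z. z extreme_point_of t}"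
  let ?f = "\<lambda>e. \<Sum>z \<in> {z \<in> ?V. z \<in> e}. of_bool (k z) :: nat"
  let ?s = "\<lambda>e. of_bool (e \<in> S) :: nat"
  have fin: "finite ?V" "finite (edges t)" using finite_extreme_points finite_edges t(1) by auto
  have f: "?f (closed_segment a b) = of_bool (k a) + of_bool (k b)" if "adj t a b" for a b
  proof -
    have "{z \<in> ?V. z \<in> closed_segment a b} = {a, b}" using edge_extreme_points[OF that] by auto
    moreover have "a \<noteq> b" using that by (auto simp: adj_def)
    ultimately show ?thesis by simp
  qed
  have "(\<Sum>e\<in>edges t. ?f e) = (\<Sum>z\<in>?V. \<Sum>e\<in>{e \<in> edges t. z \<in> e}. of_bool (k z))"
    using sum.swap_restrict[OF fin(2,1), of "\<lambda>e z. of_bool (k z) :: nat" "\<lambda>e z. z \<in> e"] by simp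
  also have "\<dots> = (\<Sum>z\<in>?V. 2 * of_bool (k z))"
    using polygon_edges_at_vertex[OF t] by (intro sum.cong) auto
  finally have "even (\<Sum>e\<in>edges t. ?f e)" by (simp flip: sum_distrib_left)
  moreover have "(\<Sum>e\<in>edges t. ?s e) = card (edges t \<inter> S)"
    using fin(2) by (simp add: sum.If_cases of_bool_def)
  ultimately have ev: "even (\<Sum>e\<in>edges t. ?f e + ?s e)" using even by (simp add: sum.distrib)
  have e: "closed_segment x y \<in> edges t" using adj_edge[OF xy] .
  have "even (\<Sum>e\<in>edges t - {closed_segment x y}. ?f e + ?s e)"
  proof (rule dvd_sum)
    fix e assume e: "e \<in> edges t - {closed_segment x y}"
    then obtain a b where ab: "adj t a b" "e = closed_segment a b" using edges_obtain[OF t(1)] by blast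
    then show "even (?f e + ?s e)" using others[OF ab(1)] e f[OF ab(1)] by auto
  qed
  then have "even (?f (closed_segment x y) + ?s (closed_segment x y))"
    using ev sum.remove[OF fin(2) e, of "\<lambda>e. ?f e + ?s e"] by simp
  then show ?thesis unfolding f[OF xy] by auto
qed

text \<open>Colour the vertices in the order of a generic linear functional. The colour of a new
  vertex \<open>v\<close> is dictated by any edge descending from it. The descending edges at
  \<open>v\<close> are linked by 2-faces having \<open>v\<close> as their top vertex, whose other
  vertices are coloured already, so by parity all descending edges dictate the same colour.\<close>

lemma cocycle_is_coboundary:
  fixes P :: "'a::euclidean_space set"
  assumes P: "polytope P"
    and even: "\<And>t. t face_of P \<Longrightarrow> aff_dim t = 2 \<Longrightarrow> even (card (edges t \<inter> S))"
  obtains k :: "'a \<Rightarrow> bool" where "\<And>x y. adj P x y \<Longrightarrow> closed_segment x y \<in> S \<longleftrightarrow> k x \<noteq> k y"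
proof -
  let ?V = "{x. x extreme_point_of P}"
  obtain g where g: "inj_on (\<lambda>x. g \<bullet> x) ?V" using generic_functional[OF finite_extreme_points[OF P]] .
  have "\<exists>k :: 'a \<Rightarrow> bool. \<forall>x\<in>D. \<forall>y\<in>D. adj P x y \<longrightarrow> (closed_segment x y \<in> S \<longleftrightarrow> k x \<noteq> k y)"
    if "finite D" "D \<subseteq> ?V" "\<forall>x\<in>D. \<forall>y\<in>?V. g \<bullet> y < g \<bullet> x \<longrightarrow> y \<in> D" for D
    using that
  proof (induction "card D" arbitrary: D)
    case 0
    then show ?case by simp
  next
    case (Suc n)
    have ne: "D \<noteq> {}" using Suc.hyps(2) by auto
    obtain v where v: "v \<in> D" "\<And>x. x \<in> D \<Longrightarrow> g \<bullet> x \<le> g \<bullet> v"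
    proof -
      have "Max ((\<bullet>) g ` D) \<in> (\<bullet>) g ` D" using ne Suc.prems(1) by (intro Max_in) auto
      then obtain v where v: "v \<in> D" "g \<bullet> v = Max ((\<bullet>) g ` D)" by force
      then have "\<And>x. x \<in> D \<Longrightarrow> g \<bullet> x \<le> g \<bullet> v" using Suc.prems(1) by simp
      then show thesis using that v(1) by blast
    qed
    have less: "g \<bullet> x < g \<bullet> v" if "x \<in> D" "x \<noteq> v" for x
      using v that g Suc.prems(2) by (meson inj_on_eq_iff le_neq_trans subsetD)
    have vP: "v extreme_point_of P" using v(1) Suc.prems(2) by blast
    have IH: "\<exists>k :: 'a \<Rightarrow> bool. \<forall>x\<in>D - {v}. \<forall>y\<in>D - {v}. adj P x y \<longrightarrow> (closed_segment x y \<in> S \<longleftrightarrow> k x \<noteq> k y)"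
    proof (rule Suc.hyps(1))
      show "n = card (D - {v})" using Suc.hyps(2) v(1) Suc.prems(1) by simp
      show "finite (D - {v})" "D - {v} \<subseteq> ?V" using Suc.prems(1,2) by auto
      show "\<forall>x\<in>D - {v}. \<forall>y\<in>?V. g \<bullet> y < g \<bullet> x \<longrightarrow> y \<in> D - {v}"
        using Suc.prems(3) less by fastforce
    qed
    then obtain k :: "'a \<Rightarrow> bool" where k: "\<And>x y. x \<in> D - {v} \<Longrightarrow> y \<in> D - {v} \<Longrightarrow> adj P x y \<Longrightarrow> (closed_segment x y \<in> S \<longleftrightarrow> k x \<noteq> k y)"
      by blast
    show ?case
    proof (cases "\<exists>u\<in>D. adj P v u")
      case False
      have "\<forall>x\<in>D. \<forall>y\<in>D. adj P x y \<longrightarrow> (closed_segment x y \<in> S \<longleftrightarrow> k x \<noteq> k y)"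
        using False k adj_sym by blast
      then show ?thesis by blast
    next
      case True
      then obtain u0 where u0: "u0 \<in> D" "adj P v u0" by blast
      \<comment> \<open>an arbitrary descending edge fixes the new colour\<close>
      define k' where "k' = k(v := (k u0 \<noteq> (closed_segment v u0 \<in> S)))"
      have k'v: "k' v = (k u0 \<noteq> (closed_segment v u0 \<in> S))" and k'o: "\<And>x. x \<noteq> v \<Longrightarrow> k' x = k x"
        by (auto simp: k'_def)
      have nv: "u \<noteq> v" if "adj P v u" for u using that by (auto simp: adj_def)
      have star: "closed_segment v u \<in> S \<longleftrightarrow> k' v \<noteq> k' u" if u: "u \<in> D" "adj P v u" for u
      proof -
        have "(\<lambda>a b. adj P v a \<and> adj P v b \<and> g \<bullet> a < g \<bullet> v \<and> g \<bullet> b < g \<bullet> v \<and> linked P v a b)\<^sup>*\<^sup>* u0 u"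
          using lower_edges_linked[OF P u0(2) _ u(2)] less u0 u nv by blast
        then show ?thesis
        proof (induction rule: rtranclp_induct)
          case base
          then show ?case using k'v k'o[OF nv[OF u0(2)]] by blast
        next
          case (step a b)
          show ?case
          proof (cases "a = b")
            case True then show ?thesis using step.IH by simp
          next
            case False
            obtain t where t: "t face_of P" "aff_dim t = 2" "v \<in> t" "a \<in> t" "b \<in> t"
              using step.hyps(2) by (auto simp: linked_def)
            have pt: "polytope t" using t(1) P face_of_polytope_polytope by blast
            have vt: "v extreme_point_of t" using extreme_point_of_face[OF t(1)] vP t(3) by blast
            obtain u1 u2 where uu: "\<And>u. adj t v u \<longleftrightarrow> u = u1 \<or> u = u2"
              using polygon_neighbours[OF pt t(2) vt] by metis
            have ab: "adj t v a" "adj t v b" using adj_face[OF t(1)] t step.hyps(2) by blast+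
            have nb: "u = a \<or> u = b" if "adj t v u" for u
              using uu[of a] uu[of b] uu[of u] ab False that by auto
            have top: "g \<bullet> x \<le> g \<bullet> v" if x: "x \<in> t" for x
            proof (rule ccontr)
              assume "\<not> ?thesis"
              then have "(- g) \<bullet> x < (- g) \<bullet> v" by simp
              then obtain u where "adj t v u" "(- g) \<bullet> u < (- g) \<bullet> v" using descending_edge[OF pt vt x] by blast
              then show False using nb[of u] step.hyps(2) by auto
            qed
            have inD: "x \<in> D" if x: "x extreme_point_of t" for x
            proof (cases "x = v")
              case False
              have xP: "x extreme_point_of P" "x \<in> t" using extreme_point_of_face[OF t(1)] x by blast+
              then have "g \<bullet> x \<noteq> g \<bullet> v" using g False vP by (auto simp: inj_on_def)
              then have "g \<bullet> x < g \<bullet> v" using top[OF xP(2)] by simp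
              then show ?thesis using Suc.prems(3) v(1) xP(1) by blast
            qed (use v in simp)
            show ?thesis
            proof (rule polygon_parity[OF pt t(2) even[OF t(1,2)]])
              show "adj t v b" by fact
              fix p q assume pq: "adj t p q" and ne: "closed_segment p q \<noteq> closed_segment v b"
              have D: "p \<in> D" "q \<in> D" using inD adj_extreme[OF pq] by blast+
              have pqP: "adj P p q" using adj_face[OF t(1)] pq by blast
              consider "p = v" | "q = v" | "p \<noteq> v" "q \<noteq> v" by blast
              then show "closed_segment p q \<in> S \<longleftrightarrow> k' p \<noteq> k' q"
              proof cases
                case 1
                then have "q = a" using nb[of q] pq ne by blast
                then show ?thesis using 1 step.IH by simp
              next
                case 2
                then have "p = a" using nb[of p] pq ne adj_sym[of t] by (metis closed_segment_commute)
                then show ?thesis using step.IH unfolding 2 closed_segment_commute[of p v] by blast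
              next
                case 3
                then show ?thesis using k[of p q] D pqP k'o by simp
              qed
            qed
          qed
        qed
      qed
      have "\<forall>x\<in>D. \<forall>y\<in>D. adj P x y \<longrightarrow> (closed_segment x y \<in> S \<longleftrightarrow> k' x \<noteq> k' y)"
      proof (intro ballI impI)
        fix x y assume xy: "x \<in> D" "y \<in> D" "adj P x y"
        consider "x = v" | "y = v" | "x \<noteq> v" "y \<noteq> v" by blast
        then show "closed_segment x y \<in> S \<longleftrightarrow> k' x \<noteq> k' y"
        proof cases
          case 1 then show ?thesis using star xy by simp
        next
          case 2
          then show ?thesis using star[of x] xy adj_sym[of P x v] unfolding 2 closed_segment_commute[of x v] by blast
        next
          case 3 then show ?thesis using k[of x y] xy k'o by simp
        qed
      qed
      then show ?thesis by blast
    qed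
  qed
  from this[of ?V] obtain k :: "'a \<Rightarrow> bool" where
    "\<forall>x\<in>?V. \<forall>y\<in>?V. adj P x y \<longrightarrow> (closed_segment x y \<in> S \<longleftrightarrow> k x \<noteq> k y)"
    using finite_extreme_points[OF P] by blast
  then show ?thesis using that[of k] adj_extreme by blast
qed

section \<open>Vertices from edges and 2-faces\<close>

text \<open>Two vertices other than \<open>v\<close> are joined by a path avoiding
  \<open>v\<close>, and at each vertex of the path the edges avoiding \<open>v\<close> are linked by
  2-faces avoiding \<open>v\<close>.\<close>

lemma antistar_connected:
  fixes P :: "'a::euclidean_space set"
  assumes P: "polytope P" and dim: "3 \<le> aff_dim P" and v: "v extreme_point_of P"
    and e: "e \<in> edges P" "v \<notin> e" and e': "e' \<in> edges P" "v \<notin> e'"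
  shows "(\<lambda>a b. a \<in> edges P \<and> b \<in> edges P \<and>
    (\<exists>t. t face_of P \<and> aff_dim t = 2 \<and> v \<notin> t \<and> a \<subseteq> t \<and> b \<subseteq> t))\<^sup>*\<^sup>* e e'" (is "?R\<^sup>*\<^sup>* e e'")
proof -
  have star: "?R\<^sup>*\<^sup>* (closed_segment u x) (closed_segment u x')"
    if u: "u \<noteq> v" "adj P u x" "x \<noteq> v" "adj P u x'" "x' \<noteq> v" for u x x'
  proof -
    have "(\<lambda>a b. adj P u a \<and> adj P u b \<and> (\<exists>t. t face_of P \<and> aff_dim t = 2 \<and> {u, a, b} \<subseteq> t \<and> v \<notin> t))\<^sup>*\<^sup>* x x'"
      using edges_linked_avoiding[OF P dim v _ u(2,3,4,5)] u(1) by blast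
    then show ?thesis
    proof (induction rule: rtranclp_induct)
      case (step a b)
      then obtain t where t: "t face_of P" "aff_dim t = 2" "{u, a, b} \<subseteq> t" "v \<notin> t" by blast
      have "closed_segment u a \<subseteq> t" "closed_segment u b \<subseteq> t"
        using t(3) closed_segment_subset[OF _ _ face_of_imp_convex[OF t(1)]] by simp_all
      then have "?R (closed_segment u a) (closed_segment u b)"
        using t step.hyps(2) adj_edge by blast
      then show ?case by (rule rtranclp.rtrancl_into_rtrancl[OF step.IH])
    qed blast
  qed
  obtain p q where pq: "adj P p q" "e = closed_segment p q" using edges_obtain[OF P e(1)] .
  obtain p' q' where pq': "adj P p' q'" "e' = closed_segment p' q'" using edges_obtain[OF P e'(1)] .
  have ne: "p \<noteq> v" "q \<noteq> v" "p' \<noteq> v" "q' \<noteq> v" using pq pq' e e' by auto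
  have "{v} face_of P" using v by (simp add: face_of_singleton)
  then have "(\<lambda>a b. adj P a b \<and> {a} \<noteq> {v} \<and> {b} \<noteq> {v} \<and> \<not> {v} \<subseteq> closed_segment a b)\<^sup>*\<^sup>* p p'"
    using graph_connected_away_from_face[OF P, of "{v}" p p'] dim ne adj_extreme pq(1) pq'(1) by auto
  then have "\<forall>x. adj P p' x \<longrightarrow> x \<noteq> v \<longrightarrow> ?R\<^sup>*\<^sup>* e (closed_segment p' x)"
  proof (induction rule: rtranclp_induct)
    case base
    then show ?case using star pq ne by blast
  next
    case (step a b)
    have ab: "adj P a b" "a \<noteq> v" "b \<noteq> v" using step.hyps(2) by auto
    have 1: "?R\<^sup>*\<^sup>* e (closed_segment b a)"
      using step.IH ab unfolding closed_segment_commute[of b a] by blast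
    show ?case
    proof (intro allI impI)
      fix x assume x: "adj P b x" "x \<noteq> v"
      have "?R\<^sup>*\<^sup>* (closed_segment b a) (closed_segment b x)"
        using star[of b a x] ab x adj_sym[of P] by blast
      then show "?R\<^sup>*\<^sup>* e (closed_segment b x)" by (rule rtranclp_trans[OF 1])
    qed
  qed
  then show ?thesis using pq' ne by blast
qed

lemma vertex_has_edges:
  fixes P :: "'a::euclidean_space set"
  assumes P: "polytope P" and dim: "2 \<le> aff_dim P" and v: "v extreme_point_of P"
  obtains u1 u2 where "u1 \<noteq> u2" "adj P v u1" "adj P v u2"
proof -
  have "{v} face_of P" "v \<in> P" using v by (auto simp: face_of_singleton extreme_point_of_def)
  then obtain t where t: "t face_of P" "{v} \<subseteq> t" "aff_dim t = 2"
    using face_interpolation[OF P, of "{v}" P 2] dim face_of_refl[OF polytope_imp_convex[OF P]] by auto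
  have "polytope t" using t(1) P face_of_polytope_polytope by blast
  moreover have "v extreme_point_of t" using extreme_point_of_face[OF t(1)] v t(2) by blast
  ultimately obtain u1 u2 where "u1 \<noteq> u2" "\<And>u. adj t v u \<longleftrightarrow> u = u1 \<or> u = u2"
    using polygon_neighbours t(3) by metis
  then show ?thesis using that adj_face[OF t(1)] by blast
qed

text \<open>A vertex has at least two edges, but two vertices share at most one.\<close>

lemma vertex_determined_by_edges:
  fixes P :: "'a::euclidean_space set"
  assumes P: "polytope P" and dim: "2 \<le> aff_dim P" and v: "v extreme_point_of P" and w: "w extreme_point_of P"
    and sub: "\<And>e. e \<in> edges P \<Longrightarrow> v \<in> e \<Longrightarrow> w \<in> e"
  shows "v = w"
proof (rule ccontr)
  assume ne: "v \<noteq> w"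
  obtain u1 u2 where u: "u1 \<noteq> u2" "adj P v u1" "adj P v u2" using vertex_has_edges[OF P dim v] .
  have "u = w" if u: "adj P v u" for u
  proof -
    have "w \<in> closed_segment v u" using sub[OF adj_edge[OF u]] by simp
    then show ?thesis
      using extreme_point_in_edge[OF w] adj_extreme[OF u] ne by (auto simp: extreme_point_of_def)
  qed
  then show False using u by blast
qed

lemma polygon_edges_obtain:
  assumes "polytope t" "aff_dim t = 2" "v extreme_point_of t"
  obtains e1 e2 where "e1 \<noteq> e2" "{e \<in> edges t. v \<in> e} = {e1, e2}"
  using polygon_edges_at_vertex[OF assms] by (auto simp: card_2_iff)

text \<open>Dimension at least 3 is what makes the edges away from a vertex connected through
  2-faces away from it: in a polygon there is only one 2-face, and it contains every vertex.\<close>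

locale edge_polygon_iso =
  fixes P :: "'a::euclidean_space set" and Q :: "'b::euclidean_space set" and f
  assumes P: "polytope P" "3 \<le> aff_dim P" and Q: "polytope Q" "3 \<le> aff_dim Q"
    and bij: "bij_betw f {F. F face_of P \<and> 1 \<le> aff_dim F \<and> aff_dim F \<le> 2}
      {F. F face_of Q \<and> 1 \<le> aff_dim F \<and> aff_dim F \<le> 2}"
    and dim: "\<And>F. F face_of P \<Longrightarrow> 1 \<le> aff_dim F \<Longrightarrow> aff_dim F \<le> 2 \<Longrightarrow> aff_dim (f F) = aff_dim F"
    and ord: "\<And>F G. F face_of P \<Longrightarrow> G face_of P \<Longrightarrow> 1 \<le> aff_dim F \<Longrightarrow> aff_dim F \<le> 2 \<Longrightarrow>
      1 \<le> aff_dim G \<Longrightarrow> aff_dim G \<le> 2 \<Longrightarrow> F \<subseteq> G \<longleftrightarrow> f F \<subseteq> f G"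
begin

definition polygons :: "'c::euclidean_space set \<Rightarrow> 'c set set" where
  "polygons R = {t. t face_of R \<and> aff_dim t = 2}"

lemma f_face: "F face_of P \<Longrightarrow> 1 \<le> aff_dim F \<Longrightarrow> aff_dim F \<le> 2 \<Longrightarrow> f F face_of Q"
  using bij_betwE[OF bij] by blast

lemma f_edge: "e \<in> edges P \<Longrightarrow> f e \<in> edges Q"
  using f_face dim by (simp add: edges_def)

lemma f_polygon: "t \<in> polygons P \<Longrightarrow> f t \<in> polygons Q"
  using f_face dim by (simp add: polygons_def)

lemma f_inj: "e \<in> edges P \<Longrightarrow> e' \<in> edges P \<Longrightarrow> f e = f e' \<longleftrightarrow> e = e'"
  using inj_on_eq_iff[OF bij_betw_imp_inj_on[OF bij]] by (simp add: edges_def)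

lemma f_sub: "e \<in> edges P \<Longrightarrow> t \<in> polygons P \<Longrightarrow> e \<subseteq> t \<longleftrightarrow> f e \<subseteq> f t"
  using ord by (simp add: edges_def polygons_def)

lemma f_onto:
  assumes "G face_of Q" "1 \<le> aff_dim G" "aff_dim G \<le> 2"
  obtains F where "F face_of P" "aff_dim F = aff_dim G" "f F = G"
proof -
  have "G \<in> f ` {F. F face_of P \<and> 1 \<le> aff_dim F \<and> aff_dim F \<le> 2}"
    using assms bij_betw_imp_surj_on[OF bij] by simp
  then show ?thesis using that dim by auto
qed

lemma f_onto_edge:
  assumes "e' \<in> edges Q" obtains e where "e \<in> edges P" "f e = e'"
  using f_onto[of e'] assms by (auto simp: edges_def)

lemma f_onto_polygon:
  assumes "t' \<in> polygons Q" obtains t where "t \<in> polygons P" "f t = t'"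
  using f_onto[of t'] assms by (auto simp: polygons_def)

lemma f_edges_polygon:
  assumes t: "t \<in> polygons P"
  shows "edges (f t) = f ` edges t"
proof -
  have tf: "t face_of P" "f t face_of Q" using t f_polygon by (auto simp: polygons_def)
  show ?thesis
    unfolding edges_face[OF tf(1)] edges_face[OF tf(2)]
  proof (intro equalityI subsetI)
    fix e' assume e': "e' \<in> {e \<in> edges Q. e \<subseteq> f t}"
    then obtain e where "e \<in> edges P" "f e = e'" using f_onto_edge by blast
    then show "e' \<in> f ` {e \<in> edges P. e \<subseteq> t}" using e' f_sub[OF _ t] by blast
  next
    fix e' assume "e' \<in> f ` {e \<in> edges P. e \<subseteq> t}"
    then show "e' \<in> {e \<in> edges Q. e \<subseteq> f t}" using f_edge f_sub[OF _ t] by blast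
  qed
qed

text \<open>The characterisation of stars described at the beginning. The image \<open>S\<close>
  of the star of \<open>v\<close> is a cut given by a colouring \<open>k\<close> of the vertices of
  \<open>Q\<close>, whose edges outside \<open>S\<close> all have colour \<open>c\<close>. A vertex
  \<open>u\<close> of the other colour has all its edges in \<open>S\<close>. In every 2-face
  through \<open>u\<close> these already account for the two edges of \<open>S\<close> in that
  2-face, so linking never leaves the star of \<open>u\<close>.\<close>

lemma star_image:
  assumes v: "v extreme_point_of P"
  obtains u where "u extreme_point_of Q" "\<And>e. e \<in> edges P \<Longrightarrow> v \<in> e \<longleftrightarrow> u \<in> f e"
proof -
  define E where "E = {e \<in> edges P. v \<in> e}"
  define S where "S = f ` E"
  have fS: "f e \<in> S \<longleftrightarrow> v \<in> e" if "e \<in> edges P" for e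
    using that f_inj by (auto simp: S_def E_def)
  have SQ: "S \<subseteq> edges Q" using f_edge by (auto simp: S_def E_def)
  have cut: "edges (f t) \<inter> S = f ` {e \<in> edges t. v \<in> e}" if t: "t \<in> polygons P" for t
  proof -
    have sub: "edges t \<subseteq> edges P" using t edges_face by (auto simp: polygons_def)
    show ?thesis unfolding f_edges_polygon[OF t] using fS sub by blast
  qed
  have "even (card (edges t' \<inter> S))" if t': "t' face_of Q" "aff_dim t' = 2" for t'
  proof -
    obtain t where t: "t \<in> polygons P" "f t = t'" using f_onto_polygon t' by (auto simp: polygons_def)
    have tf: "t face_of P" "aff_dim t = 2" using t by (auto simp: polygons_def)
    have pt: "polytope t" using face_of_polytope_polytope[OF P(1) tf(1)] .
    have sub: "edges t \<subseteq> edges P" using tf edges_face by auto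
    have "card (f ` {e \<in> edges t. v \<in> e}) = card {e \<in> edges t. v \<in> e}"
      using f_inj sub by (intro card_image inj_onI) blast
    moreover have "even (card {e \<in> edges t. v \<in> e})"
    proof (cases "v \<in> t")
      case True
      then have "v extreme_point_of t" using v extreme_point_of_face[OF tf(1)] by blast
      then show ?thesis using polygon_edges_at_vertex[OF pt tf(2)] by simp
    next
      case False
      then have "{e \<in> edges t. v \<in> e} = {}" using edges_face[OF tf(1)] by blast
      then show ?thesis by (metis card.empty even_zero)
    qed
    ultimately show ?thesis using cut[OF t(1)] t(2) by simp
  qed
  then obtain k :: "'b \<Rightarrow> bool" where
    k: "\<And>x y. adj Q x y \<Longrightarrow> closed_segment x y \<in> S \<longleftrightarrow> k x \<noteq> k y"
    using cocycle_is_coboundary[OF Q(1)] by metis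
  \<comment> \<open>the edges outside a star are connected by 2-faces without edges in \<open>S\<close>, on which \<open>k\<close> is constant\<close>
  have mono: "\<exists>c. \<forall>e \<in> edges P. v \<notin> e \<longrightarrow> (\<forall>x. x extreme_point_of Q \<longrightarrow> x \<in> f e \<longrightarrow> k x = c)"
  proof (cases "\<exists>e \<in> edges P. v \<notin> e")
    case False then show ?thesis by blast
  next
    case True
    then obtain e1 where e1: "e1 \<in> edges P" "v \<notin> e1" by blast
    obtain x1 y1 where xy1: "adj Q x1 y1" "f e1 = closed_segment x1 y1"
      using edges_obtain[OF Q(1) f_edge[OF e1(1)]] .
    have base: "\<forall>x. x extreme_point_of Q \<longrightarrow> x \<in> f e1 \<longrightarrow> k x = k x1"
    proof (intro allI impI)
      fix x assume "x extreme_point_of Q" "x \<in> f e1"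
      then have "x \<in> {x1, y1}" using edge_extreme_points[OF xy1(1)] xy1(2) by blast
      moreover have "k x1 = k y1" using k[OF xy1(1)] fS[OF e1(1)] e1(2) xy1(2) by simp
      ultimately show "k x = k x1" by blast
    qed
    have "\<forall>x. x extreme_point_of Q \<longrightarrow> x \<in> f e \<longrightarrow> k x = k x1" if e: "e \<in> edges P" "v \<notin> e" for e
      using antistar_connected[OF P v e1 e]
    proof (induction rule: rtranclp_induct)
      case base show ?case by fact
    next
      case (step a b)
      then obtain t where t: "t \<in> polygons P" "v \<notin> t" "a \<subseteq> t" "b \<subseteq> t"
        and ab: "a \<in> edges P" "b \<in> edges P" by (auto simp: polygons_def)
      have ft: "f t face_of Q" using f_polygon[OF t(1)] by (simp add: polygons_def)
      have pft: "polytope (f t)" using face_of_polytope_polytope[OF Q(1) ft] .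
      have sub: "edges t \<subseteq> edges P" "\<And>e. e \<in> edges t \<Longrightarrow> e \<subseteq> t"
        using t(1) edges_face by (auto simp: polygons_def)
      have noS: "edges (f t) \<inter> S = {}"
        using cut[OF t(1)] t(2) sub(2) by blast
      have const: "k x = k y" if xy: "x extreme_point_of f t" "y extreme_point_of f t" for x y
        using graph_connected[OF pft xy]
      proof (induction rule: rtranclp_induct)
        case (step p q)
        have "adj Q p q" using step.hyps(2) adj_face[OF ft] by blast
        moreover have "closed_segment p q \<notin> S" using adj_edge[OF step.hyps(2)] noS by blast
        ultimately show ?case using k[of p q] step.IH by blast
      qed simp
      obtain z w where zw: "adj Q z w" "f a = closed_segment z w"
        using edges_obtain[OF Q(1) f_edge[OF ab(1)]] .
      have fab: "f a \<subseteq> f t" "f b \<subseteq> f t" using f_sub ab t by blast+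
      have z: "z extreme_point_of Q" "z \<in> f a" using adj_extreme[OF zw(1)] zw(2) by auto
      then have "k z = k x1" using step.IH by blast
      moreover have "z extreme_point_of f t" using z fab(1) extreme_point_of_face[OF ft] by blast
      moreover have "x extreme_point_of f t" if "x extreme_point_of Q" "x \<in> f b" for x
        using that fab(2) extreme_point_of_face[OF ft] by blast
      ultimately show ?case using const by blast
    qed
    then show ?thesis by blast
  qed
  then obtain c where
    c0: "\<forall>e \<in> edges P. v \<notin> e \<longrightarrow> (\<forall>x. x extreme_point_of Q \<longrightarrow> x \<in> f e \<longrightarrow> k x = c)" ..
  have c: "k x = c" if "e \<in> edges P" "v \<notin> e" "x extreme_point_of Q" "x \<in> f e" for e x
    using c0[rule_format, OF that] .
  have "2 \<le> aff_dim P" using P(2) by linarith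
  then obtain w where w: "adj P v w" using vertex_has_edges[OF P(1) _ v] by metis
  have vw: "closed_segment v w \<in> E" using adj_edge[OF w] by (simp add: E_def)
  then have "f (closed_segment v w) \<in> S" "f (closed_segment v w) \<in> edges Q" using SQ by (auto simp: S_def)
  then obtain p q where pq: "adj Q p q" "closed_segment p q \<in> S" using edges_obtain[OF Q(1)] by metis
  then have "k p \<noteq> c \<or> k q \<noteq> c" using k[OF pq(1)] by blast
  then obtain u u' where u: "adj Q u u'" "k u \<noteq> c"
    using pq(1) adj_sym by blast
  have uQ: "u extreme_point_of Q" using adj_extreme u(1) by blast
  \<comment> \<open>an edge outside \<open>S\<close> has both ends of colour \<open>c\<close>\<close>
  have inS: "e' \<in> S" if e': "e' \<in> edges Q" "u \<in> e'" for e'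
  proof -
    obtain e where e: "e \<in> edges P" "f e = e'" using f_onto_edge[OF e'(1)] .
    then have "v \<in> e" using c[OF e(1) _ uQ] e'(2) u(2) by blast
    then show ?thesis using fS e by blast
  qed
  obtain e0 where e0: "e0 \<in> edges P" "v \<in> e0" "u \<in> f e0"
  proof -
    have "closed_segment u u' \<in> S" using inS adj_edge[OF u(1)] by simp
    then obtain e where "e \<in> E" "f e = closed_segment u u'" by (auto simp: S_def)
    then show thesis using that by (auto simp: E_def)
  qed
  have all: "u \<in> f e" if e: "e \<in> edges P" "v \<in> e" for e
  proof -
    obtain x0 where x0: "adj P v x0" "e0 = closed_segment v x0"
      using edge_at_vertex[OF P(1) _ _ v e0(2)] e0(1) by (auto simp: edges_def)
    obtain x where x: "adj P v x" "e = closed_segment v x"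
      using edge_at_vertex[OF P(1) _ _ v e(2)] e(1) by (auto simp: edges_def)
    have "u \<in> f (closed_segment v x)"
      using edges_linked[OF P(1) x0(1) x(1)]
    proof (induction rule: rtranclp_induct)
      case base show ?case using e0(3) x0(2) by simp
    next
      case (step a b)
      then obtain t where t: "t \<in> polygons P" "{v, a, b} \<subseteq> t" and ab: "adj P v a" "adj P v b"
        by (auto simp: linked_def polygons_def)
      have tf: "t face_of P" "aff_dim t = 2" using t by (auto simp: polygons_def)
      have pt: "polytope t" using face_of_polytope_polytope[OF P(1) tf(1)] .
      have ft: "f t face_of Q" "aff_dim (f t) = 2" using f_polygon[OF t(1)] by (auto simp: polygons_def)
      have pft: "polytope (f t)" using face_of_polytope_polytope[OF Q(1) ft(1)] .
      have sub: "edges t \<subseteq> edges P" using tf edges_face by auto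
      have "adj t v a" "adj t v b" using adj_face[OF tf(1)] ab t(2) by blast+
      then have et: "closed_segment v a \<in> edges t" "closed_segment v b \<in> edges t" by (auto intro: adj_edge)
      have "f (closed_segment v a) \<subseteq> f t"
        using f_sub[OF adj_edge[OF ab(1)] t(1)] et(1) edges_face[OF tf(1)] by simp
      then have "u extreme_point_of f t" using step.IH uQ extreme_point_of_face[OF ft(1)] by blast
      then obtain g1 g2 where g: "g1 \<noteq> g2" "{e \<in> edges (f t). u \<in> e} = {g1, g2}"
        using polygon_edges_obtain[OF pft ft(2)] by metis
      have vt: "v extreme_point_of t" using v t(2) extreme_point_of_face[OF tf(1)] by blast
      obtain h1 h2 where h: "h1 \<noteq> h2" "{e \<in> edges t. v \<in> e} = {h1, h2}"
        using polygon_edges_obtain[OF pt tf(2) vt] .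
      \<comment> \<open>both sides have two elements, so the inclusion is an equality\<close>
      have "{e \<in> edges (f t). u \<in> e} \<subseteq> edges (f t) \<inter> S"
        using inS edges_face[OF ft(1)] by auto
      then have "{g1, g2} \<subseteq> {f h1, f h2}" unfolding cut[OF t(1)] h(2) g(2) by simp
      then have eq: "{g1, g2} = {f h1, f h2}" using g(1) by auto
      have "closed_segment v b \<in> {e \<in> edges t. v \<in> e}" using et(2) by simp
      then have "f (closed_segment v b) \<in> {f h1, f h2}" unfolding h(2) by auto
      then have "f (closed_segment v b) \<in> {e \<in> edges (f t). u \<in> e}" unfolding g(2) eq .
      then show ?case by simp
    qed
    then show ?thesis using x(2) by simp
  qed
  have "v \<in> e \<longleftrightarrow> u \<in> f e" if e: "e \<in> edges P" for e
    using all[OF e] inS[OF f_edge[OF e]] fS[OF e] by blast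
  then show ?thesis using that uQ by blast
qed

end

lemma edge_polygon_iso_inverse:
  assumes "edge_polygon_iso P Q f"
  shows "edge_polygon_iso Q P (the_inv_into {F. F face_of P \<and> 1 \<le> aff_dim F \<and> aff_dim F \<le> 2} f)"
proof -
  interpret edge_polygon_iso P Q f by fact
  let ?A = "{F. F face_of P \<and> 1 \<le> aff_dim F \<and> aff_dim F \<le> 2}"
  let ?B = "{F. F face_of Q \<and> 1 \<le> aff_dim F \<and> aff_dim F \<le> 2}"
  let ?g = "the_inv_into ?A f"
  have g: "?g G \<in> ?A \<and> f (?g G) = G" if "G \<in> ?B" for G
    using f_the_inv_into_f_bij_betw[OF bij] that bij_betwE[OF bij_betw_the_inv_into[OF bij]] by blast
  show ?thesis
  proof unfold_locales
    show "bij_betw ?g ?B ?A" by (rule bij_betw_the_inv_into[OF bij])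
    fix F assume "F face_of Q" "1 \<le> aff_dim F" "aff_dim F \<le> 2"
    then show "aff_dim (?g F) = aff_dim F" using g[of F] dim[of "?g F"] by auto
  next
    fix F G assume "F face_of Q" "G face_of Q" "1 \<le> aff_dim F" "aff_dim F \<le> 2" "1 \<le> aff_dim G" "aff_dim G \<le> 2"
    then show "F \<subseteq> G \<longleftrightarrow> ?g F \<subseteq> ?g G" using g[of F] g[of G] ord[of "?g F" "?g G"] by auto
  qed (use P Q in auto)
qed

context edge_polygon_iso
begin

lemma vertex_bijection:
  obtains p where "bij_betw p {v. v extreme_point_of P} {u. u extreme_point_of Q}"
    "\<And>v e. v extreme_point_of P \<Longrightarrow> e \<in> edges P \<Longrightarrow> v \<in> e \<longleftrightarrow> p v \<in> f e"
proof -
  have "\<exists>u. u extreme_point_of Q \<and> (\<forall>e \<in> edges P. v \<in> e \<longleftrightarrow> u \<in> f e)" if "v extreme_point_of P" for v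
    using star_image[OF that] by metis
  then obtain p where p: "\<And>v. v extreme_point_of P \<Longrightarrow> p v extreme_point_of Q"
    "\<And>v e. v extreme_point_of P \<Longrightarrow> e \<in> edges P \<Longrightarrow> v \<in> e \<longleftrightarrow> p v \<in> f e"
    by metis
  have dims: "2 \<le> aff_dim P" "2 \<le> aff_dim Q" using P Q by auto
  have "inj_on p {v. v extreme_point_of P}"
  proof (rule inj_onI)
    fix v w assume vw: "v \<in> {v. v extreme_point_of P}" "w \<in> {v. v extreme_point_of P}" "p v = p w"
    show "v = w"
      by (rule vertex_determined_by_edges[OF P(1) dims(1)]) (use vw p(2)[of v] p(2)[of w] in auto)
  qed
  moreover have "u \<in> p ` {v. v extreme_point_of P}" if u: "u extreme_point_of Q" for u
  proof -
    let ?g = "the_inv_into {F. F face_of P \<and> 1 \<le> aff_dim F \<and> aff_dim F \<le> 2} f"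
    interpret inv: edge_polygon_iso Q P ?g
      by (rule edge_polygon_iso_inverse) unfold_locales
    obtain v where v: "v extreme_point_of P" "\<And>e'. e' \<in> edges Q \<Longrightarrow> u \<in> e' \<longleftrightarrow> v \<in> ?g e'"
      using inv.star_image[OF u] by metis
    have "p v = u"
    proof (rule vertex_determined_by_edges[OF Q(1) dims(2) p(1)[OF v(1)] u])
      fix e' assume e': "e' \<in> edges Q" "p v \<in> e'"
      obtain e where e: "e \<in> edges P" "f e = e'" using f_onto_edge[OF e'(1)] .
      have "?g e' = e"
        unfolding e(2)[symmetric] by (rule the_inv_into_f_f[OF bij_betw_imp_inj_on[OF bij]])
          (use e(1) in \<open>simp add: edges_def\<close>)
      then show "u \<in> e'" using v(2)[OF e'(1)] p(2)[OF v(1) e(1)] e e'(2) by simp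
    qed
    then show ?thesis using v(1) by blast
  qed
  ultimately have "bij_betw p {v. v extreme_point_of P} {u. u extreme_point_of Q}"
    using p(1) by (auto simp: bij_betw_def)
  then show ?thesis using that p(2) by blast
qed

end

lemma vertex_face_iff: "F face_of P \<and> aff_dim F = 0 \<longleftrightarrow> (\<exists>v. v extreme_point_of P \<and> F = {v})"
  by (auto simp: aff_dim_eq_0 face_of_singleton)

lemma (in edge_polygon_iso) vertex_face_bijection:
  obtains p where "bij_betw p {F. F face_of P \<and> aff_dim F = 0} {F. F face_of Q \<and> aff_dim F = 0}"
    "\<And>F e. F face_of P \<Longrightarrow> aff_dim F = 0 \<Longrightarrow> e face_of P \<Longrightarrow> aff_dim e = 1 \<Longrightarrow> F \<subseteq> e \<longleftrightarrow> p F \<subseteq> f e"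
proof -
  obtain p where p: "bij_betw p {v. v extreme_point_of P} {u. u extreme_point_of Q}"
    "\<And>v e. v extreme_point_of P \<Longrightarrow> e \<in> edges P \<Longrightarrow> v \<in> e \<longleftrightarrow> p v \<in> f e"
    using vertex_bijection by metis
  have set: "{F. F face_of R \<and> aff_dim F = 0} = (\<lambda>v. {v}) ` {v. v extreme_point_of R}" for R :: "'c::euclidean_space set"
    using vertex_face_iff[of _ R] by auto
  show ?thesis
  proof (rule that[of "(`) p"])
    show "bij_betw ((`) p) {F. F face_of P \<and> aff_dim F = 0} {F. F face_of Q \<and> aff_dim F = 0}"
    proof (rule bij_betw_imageI)
      show "inj_on ((`) p) {F. F face_of P \<and> aff_dim F = 0}"
        using bij_betw_imp_inj_on[OF p(1)] unfolding set by (auto simp: inj_on_def)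
      show "(`) p ` {F. F face_of P \<and> aff_dim F = 0} = {F. F face_of Q \<and> aff_dim F = 0}"
      proof -
        have "(`) p ` (\<lambda>v. {v}) ` A = (\<lambda>v. {v}) ` p ` A" for A by (simp add: image_image)
        then show ?thesis unfolding set bij_betw_imp_surj_on[OF p(1), symmetric] .
      qed
    qed
    fix F e assume "F face_of P" "aff_dim F = 0" "e face_of P" "aff_dim e = 1"
    moreover then obtain v where "v extreme_point_of P" "F = {v}" using vertex_face_iff by blast
    ultimately show "F \<subseteq> e \<longleftrightarrow> p ` F \<subseteq> f e" using p(2)[of v e] by (simp add: edges_def)
  qed
qed

section \<open>Polar duality\<close>

definition polar :: "'a::euclidean_space set \<Rightarrow> 'a set" where
  "polar P = {y. \<forall>x\<in>P. x \<bullet> y \<le> 1}"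

text \<open>A point \<open>y\<close> of the polar stands for the hyperplane
  \<open>x \<bullet> y = 1\<close>, which does not cut \<open>P\<close>; the conjugate face
  consists of the hyperplanes among these that contain \<open>F\<close>.\<close>

definition conjugate_face :: "'a::euclidean_space set \<Rightarrow> 'a set \<Rightarrow> 'a set" where
  "conjugate_face P F = {y \<in> polar P. \<forall>x\<in>F. x \<bullet> y = 1}"

lemma polar_convex_hull: "polar (convex hull V) = {y. \<forall>v\<in>V. v \<bullet> y \<le> 1}"
proof (intro equalityI subsetI)
  fix y assume "y \<in> polar (convex hull V)"
  then show "y \<in> {y. \<forall>v\<in>V. v \<bullet> y \<le> 1}" using hull_inc[of _ V convex] by (auto simp: polar_def)
next
  fix y assume y: "y \<in> {y. \<forall>v\<in>V. v \<bullet> y \<le> 1}"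
  have "convex hull V \<subseteq> {x. y \<bullet> x \<le> 1}"
    by (intro hull_minimal convex_halfspace_le) (use y in \<open>auto simp: inner_commute\<close>)
  then show "y \<in> polar (convex hull V)" by (auto simp: polar_def inner_commute)
qed

text \<open>A point outside \<open>C\<close> is separated from \<open>C\<close> by a hyperplane,
  which misses the origin and hence can be normalised to a point of the polar.\<close>

lemma bipolar:
  fixes C :: "'a::euclidean_space set"
  assumes "convex C" "closed C" "0 \<in> C"
  shows "polar (polar C) = C"
proof (intro equalityI subsetI)
  fix z assume z: "z \<in> polar (polar C)"
  show "z \<in> C"
  proof (rule ccontr)
    assume "z \<notin> C"
    then obtain a b where ab: "a \<bullet> z < b" "\<And>x. x \<in> C \<Longrightarrow> a \<bullet> x > b"
      using separating_hyperplane_closed_point[OF assms(1,2)] by blast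
    have b: "b < 0" using ab(2)[OF assms(3)] by simp
    have "x \<bullet> (a /\<^sub>R b) \<le> 1" if "x \<in> C" for x
      using ab(2)[OF that] b by (simp add: inner_commute field_simps)
    then have "a /\<^sub>R b \<in> polar C" by (simp add: polar_def)
    then have "(a /\<^sub>R b) \<bullet> z \<le> 1" using z unfolding polar_def by blast
    then show False using ab(1) b by (simp add: field_simps)
  qed
next
  fix z assume "z \<in> C"
  then show "z \<in> polar (polar C)" by (auto simp: polar_def inner_commute)
qed

lemma zero_interior_polar:
  fixes P :: "'a::euclidean_space set"
  assumes "bounded P"
  shows "0 \<in> interior (polar P)"
proof -
  obtain B where B: "B > 0" "\<And>x. x \<in> P \<Longrightarrow> norm x \<le> B" using assms bounded_pos by metis
  have "ball (0::'a) (1 / B) \<subseteq> polar P"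
  proof
    fix y :: 'a assume "y \<in> ball 0 (1 / B)"
    then have y: "norm y \<le> 1 / B" by simp
    have "x \<bullet> y \<le> 1" if "x \<in> P" for x
    proof -
      have "x \<bullet> y \<le> norm x * norm y" by (rule norm_cauchy_schwarz)
      also have "\<dots> \<le> B * (1 / B)" using B(2)[OF that] y B(1) by (intro mult_mono) auto
      finally show ?thesis using B(1) by simp
    qed
    then show "y \<in> polar P" by (simp add: polar_def)
  qed
  moreover have "0 \<in> ball (0::'a) (1 / B)" using B(1) by simp
  ultimately show ?thesis using interior_maximal open_ball by blast
qed

lemma bounded_polar:
  fixes P :: "'a::euclidean_space set"
  assumes "0 \<in> interior P"
  shows "bounded (polar P)"
proof -
  obtain r where r: "r > 0" "cball 0 r \<subseteq> P" using assms mem_interior_cball by blast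
  have "norm y \<le> 1 / r" if y: "y \<in> polar P" for y
  proof (cases "y = 0")
    case False
    have "(r / norm y) *\<^sub>R y \<in> P" using r False by (intro subsetD[OF r(2)]) simp
    then have "((r / norm y) *\<^sub>R y) \<bullet> y \<le> 1" using y by (auto simp: polar_def)
    then have "r * norm y \<le> 1" using False by (simp add: dot_square_norm power2_eq_square)
    then show ?thesis using r(1) by (simp add: field_simps)
  qed (use r in simp)
  then show ?thesis unfolding bounded_iff by blast
qed

lemma polytope_polar:
  fixes P :: "'a::euclidean_space set"
  assumes "polytope P" "0 \<in> interior P"
  shows "polytope (polar P)"
proof -
  obtain V where V: "finite V" "P = convex hull V" using assms(1) by (auto simp: polytope_def)
  have "polar P = \<Inter> ((\<lambda>v. {y. v \<bullet> y \<le> 1}) ` V)" using polar_convex_hull[of V] V(2) by auto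
  then have "polyhedron (polar P)" 
    using V(1) by (auto intro!: polyhedron_Inter polyhedron_halfspace_le)
  then show ?thesis using bounded_polar[OF assms(2)] polytope_eq_bounded_polyhedron by blast
qed

lemma polar_polar_polytope:
  fixes P :: "'a::euclidean_space set"
  assumes "polytope P" "0 \<in> interior P"
  shows "polar (polar P) = P"
  using bipolar assms polytope_imp_convex polytope_imp_closed interior_subset by blast

lemma conjugate_face_face:
  fixes P :: "'a::euclidean_space set"
  assumes P: "polytope P" "0 \<in> interior P" and F: "F face_of P"
  shows "conjugate_face P F face_of polar P"
proof (cases "F = {}")
  case True
  then show ?thesis
    using face_of_refl[OF polytope_imp_convex[OF polytope_polar[OF P]]] by (simp add: conjugate_face_def)
next
  case False
  have "\<Inter> ((\<lambda>x. polar P \<inter> {y. x \<bullet> y = 1}) ` F) face_of polar P"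
  proof (rule face_of_Inter)
    fix T assume "T \<in> (\<lambda>x. polar P \<inter> {y. x \<bullet> y = 1}) ` F"
    then obtain x where x: "x \<in> P" "T = polar P \<inter> {y. x \<bullet> y = 1}"
      using face_of_imp_subset[OF F] by blast
    show "T face_of polar P" unfolding x(2)
      by (rule face_of_Int_supporting_hyperplane_le[OF polytope_imp_convex[OF polytope_polar[OF P]]])
        (use x(1) in \<open>auto simp: polar_def\<close>)
  qed (use False in simp)
  moreover have "conjugate_face P F = \<Inter> ((\<lambda>x. polar P \<inter> {y. x \<bullet> y = 1}) ` F)"
    using False by (auto simp: conjugate_face_def)
  ultimately show ?thesis by simp
qed

text \<open>A proper face is exposed by some hyperplane; as the origin is interior, the hyperplane
  does not pass through it and is itself a point of the conjugate face.\<close>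

lemma conjugate_conjugate:
  fixes P :: "'a::euclidean_space set"
  assumes P: "polytope P" "0 \<in> interior P" and F: "F face_of P"
  shows "conjugate_face (polar P) (conjugate_face P F) = F"
proof -
  have FP: "F \<subseteq> P" using face_of_imp_subset[OF F] .
  have 0: "0 \<in> P" using P(2) interior_subset by blast
  have sup: "F \<subseteq> conjugate_face (polar P) (conjugate_face P F)"
    using FP by (auto simp: conjugate_face_def polar_polar_polytope[OF P] inner_commute)
  have "x \<in> F" if x: "x \<in> conjugate_face (polar P) (conjugate_face P F)" for x
  proof -
    have xP: "x \<in> P" and x1: "\<And>y. y \<in> conjugate_face P F \<Longrightarrow> y \<bullet> x = 1"
      using x by (auto simp: conjugate_face_def polar_polar_polytope[OF P])
    have "F exposed_face_of P"
      using F exposed_face_of_polyhedron[OF polytope_imp_polyhedron[OF P(1)]] by simp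
    then consider "F = {}" | "F = P" | a b where "F \<noteq> P" "P \<subseteq> {x. a \<bullet> x \<le> b}" "F = P \<inter> {x. a \<bullet> x = b}"
      by (auto simp: exposed_face_of)
    then show "x \<in> F"
    proof cases
      case 1
      then have "0 \<in> conjugate_face P F" by (simp add: conjugate_face_def polar_def)
      then show ?thesis using x1 by fastforce
    next
      case 2 then show ?thesis using xP by simp
    next
      case 3
      have "0 \<notin> F" using face_of_disjoint_interior[OF F 3(1)] P(2) by blast
      moreover have "a \<bullet> 0 \<le> b" using 0 3(2) by blast
      ultimately have b: "b > 0" using 0 3(3) by force
      have "a /\<^sub>R b \<in> polar P"
        using 3(2) b by (auto simp: polar_def inner_commute field_simps)
      moreover have "\<forall>x\<in>F. x \<bullet> (a /\<^sub>R b) = 1"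
        using 3(3) b by (simp add: inner_commute)
      ultimately have "a /\<^sub>R b \<in> conjugate_face P F" unfolding conjugate_face_def by blast
      then have "(a /\<^sub>R b) \<bullet> x = 1" by (rule x1)
      then have "a \<bullet> x = b" using b by (simp add: field_simps)
      then show ?thesis using 3(3) xP by blast
    qed
  qed
  then show ?thesis using sup by blast
qed

lemma conjugate_antimono: "F \<subseteq> G \<Longrightarrow> conjugate_face P G \<subseteq> conjugate_face P F"
  by (auto simp: conjugate_face_def)

lemma conjugate_subset_iff:
  fixes P :: "'a::euclidean_space set"
  assumes "polytope P" "0 \<in> interior P" "F face_of P" "G face_of P"
  shows "conjugate_face P G \<subseteq> conjugate_face P F \<longleftrightarrow> F \<subseteq> G"
  using conjugate_antimono[of F G P] conjugate_antimono[of "conjugate_face P G" "conjugate_face P F" "polar P"]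
    conjugate_conjugate[OF assms(1,2)] assms(3,4) by metis

lemma zero_interior_polar_polytope:
  fixes P :: "'a::euclidean_space set"
  assumes "polytope P"
  shows "0 \<in> interior (polar P)"
  using zero_interior_polar polytope_imp_bounded[OF assms] by blast

text \<open>A chain of faces from \<open>F\<close> down to the empty face bounds the dimension of
  the image from above, a chain up to \<open>P\<close> bounds it from below.\<close>

lemma antitone_dim:
  fixes P :: "'a::euclidean_space set" and Q :: "'b::euclidean_space set"
  assumes P: "polytope P" and Q: "polytope Q" and dim: "aff_dim P = aff_dim Q"
    and D: "\<And>F. F face_of P \<Longrightarrow> D F face_of Q"
    and anti: "\<And>F G. F face_of P \<Longrightarrow> G face_of P \<Longrightarrow> F \<subset> G \<Longrightarrow> D G \<subset> D F"
    and F: "F face_of P"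
  shows "aff_dim (D F) = aff_dim P - 1 - aff_dim F"
proof (rule antisym)
  have step: "aff_dim (D G) < aff_dim (D F)" if "F face_of P" "G face_of P" "F \<subset> G" for F G
    using face_dim_strict_mono[OF Q D D anti] that by blast
  show "aff_dim (D F) \<le> aff_dim P - 1 - aff_dim F"
    using F
  proof (induction "nat (aff_dim F + 1)" arbitrary: F)
    case 0
    then have "aff_dim F \<le> -1" by simp
    moreover have "aff_dim (D F) \<le> aff_dim Q" using face_of_imp_subset[OF D[OF 0(2)]] aff_dim_subset by blast
    ultimately show ?case using dim by linarith
  next
    case (Suc n)
    have "F \<noteq> {}" using Suc.hyps(2) by auto
    then obtain H where H: "H face_of F" "aff_dim H = aff_dim F - 1"
      using exists_facet_above[of F "{}"] face_of_polytope_polytope[OF P Suc.prems] by auto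
    have HP: "H face_of P" using H(1) Suc.prems face_of_trans by blast
    have "H \<subset> F" using H face_of_imp_subset by force
    then have "aff_dim (D F) < aff_dim (D H)" using step HP Suc.prems by blast
    moreover have "aff_dim (D H) \<le> aff_dim P - 1 - aff_dim H"
      by (rule Suc.hyps(1)) (use Suc.hyps(2) H HP in auto)
    ultimately show ?case using H(2) by linarith
  qed
  show "aff_dim P - 1 - aff_dim F \<le> aff_dim (D F)"
    using F
  proof (induction "nat (aff_dim P - aff_dim F)" arbitrary: F)
    case 0
    then show ?case using aff_dim_geq[of "D F"] by simp
  next
    case (Suc n)
    have "aff_dim F + 1 \<le> aff_dim P" using Suc.hyps(2) by linarith
    then obtain G where G: "G face_of P" "F \<subseteq> G" "aff_dim G = aff_dim F + 1"
      using face_interpolation[OF P Suc.prems face_of_refl[OF polytope_imp_convex[OF P]], of "aff_dim F + 1"]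
        face_of_imp_subset[OF Suc.prems] by auto
    have "F \<noteq> G" using G(3) by auto
    then have "F \<subset> G" using G(2) by blast
    then have "aff_dim (D G) < aff_dim (D F)" using step G(1) Suc.prems by blast
    moreover have "aff_dim P - 1 - aff_dim G \<le> aff_dim (D G)"
      by (rule Suc.hyps(1)) (use Suc.hyps(2) G in auto)
    ultimately show ?case using G(3) by linarith
  qed
qed

lemma aff_dim_conjugate_face:
  fixes P :: "'a::euclidean_space set"
  assumes P: "polytope P" "0 \<in> interior P" and F: "F face_of P"
  shows "aff_dim (conjugate_face P F) = int DIM('a) - 1 - aff_dim F"
proof -
  have full: "aff_dim P = int DIM('a)" using P(2) aff_dim_nonempty_interior by blast
  have "aff_dim (conjugate_face P F) = aff_dim P - 1 - aff_dim F"
  proof (rule antitone_dim[OF P(1) polytope_polar[OF P] _ conjugate_face_face[OF P] _ F])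
    have "interior (polar P) \<noteq> {}" using zero_interior_polar_polytope[OF P(1)] by blast
    then show "aff_dim P = aff_dim (polar P)" using full aff_dim_nonempty_interior by metis
    fix F G assume "F face_of P" "G face_of P" "F \<subset> G"
    then show "conjugate_face P G \<subset> conjugate_face P F"
      using conjugate_subset_iff[OF P] by blast
  qed
  then show ?thesis using full by simp
qed

lemma bij_conjugate_face:
  fixes P :: "'a::euclidean_space set"
  assumes P: "polytope P" "0 \<in> interior P"
  shows "bij_betw (conjugate_face P) {F. F face_of P} {G. G face_of polar P}"
proof (rule bij_betw_byWitness[where f' = "conjugate_face (polar P)"])
  note P' = polytope_polar[OF P] zero_interior_polar_polytope[OF P(1)]
  show "\<forall>F\<in>{F. F face_of P}. conjugate_face (polar P) (conjugate_face P F) = F"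
    using conjugate_conjugate[OF P] by blast
  show "\<forall>G\<in>{G. G face_of polar P}. conjugate_face P (conjugate_face (polar P) G) = G"
    using conjugate_conjugate[OF P'] polar_polar_polytope[OF P] by simp
  show "conjugate_face P ` {F. F face_of P} \<subseteq> {G. G face_of polar P}"
    using conjugate_face_face[OF P] by blast
  show "conjugate_face (polar P) ` {G. G face_of polar P} \<subseteq> {F. F face_of P}"
    using conjugate_face_face[OF P'] polar_polar_polytope[OF P] by auto
qed

text \<open>The polar of a translate having the origin in its interior.\<close>

lemma polytope_dual_exists:
  fixes P :: "'a::euclidean_space set"
  assumes "full_dim_polytope P"
  obtains P' :: "'a set" and D where "polytope P'" "aff_dim P' = int DIM('a)"
    "bij_betw D {F. F face_of P} {F. F face_of P'}"
    "\<And>F G. F face_of P \<Longrightarrow> G face_of P \<Longrightarrow> F \<subseteq> G \<longleftrightarrow> D G \<subseteq> D F"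
    "\<And>F. F face_of P \<Longrightarrow> aff_dim (D F) = int DIM('a) - 1 - aff_dim F"
proof -
  have P: "polytope P" "aff_dim P = int DIM('a)" using assms aff_dim_eq_full by (auto simp: full_dim_polytope_def)
  have "affine hull P = UNIV" using assms by (simp add: full_dim_polytope_def)
  moreover have "rel_interior P \<noteq> {}"
    using calculation rel_interior_eq_empty[OF polytope_imp_convex[OF P(1)]] by auto
  ultimately have "interior P \<noteq> {}" using rel_interior_interior[of P] by simp
  then obtain c where c: "c \<in> interior P" by blast
  let ?T = "(+) (- c) ` P"
  have T: "polytope ?T" using P(1) polytope_translation_eq[of "- c" P] by blast
  have 0: "0 \<in> interior ?T" unfolding interior_translation using c by (intro image_eqI[of _ _ c]) auto
  have Tf: "(+) (- c) ` F face_of ?T" if "F face_of P" for F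
    using that face_of_translation_eq[of "- c" F P] by blast
  have bT: "bij_betw ((`) ((+) (- c))) {F. F face_of P} {F. F face_of ?T}"
    unfolding faces_of_translation by (rule bij_betw_imageI) (auto intro!: inj_onI simp: inj_image_eq_iff)
  show ?thesis
  proof (rule that[of "polar ?T" "conjugate_face ?T \<circ> (`) ((+) (- c))"])
    show "polytope (polar ?T)" by (rule polytope_polar[OF T 0])
    show "aff_dim (polar ?T) = int DIM('a)"
      using zero_interior_polar_polytope[OF T] by (intro aff_dim_nonempty_interior) blast
    show "bij_betw (conjugate_face ?T \<circ> (`) ((+) (- c))) {F. F face_of P} {F. F face_of polar ?T}"
      by (rule bij_betw_trans[OF bT bij_conjugate_face[OF T 0]])
    fix F assume F: "F face_of P"
    show "aff_dim ((conjugate_face ?T \<circ> (`) ((+) (- c))) F) = int DIM('a) - 1 - aff_dim F"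
      using aff_dim_conjugate_face[OF T 0 Tf[OF F]] by (simp only: comp_def aff_dim_translation_eq)
    fix G assume G: "G face_of P"
    show "F \<subseteq> G \<longleftrightarrow> (conjugate_face ?T \<circ> (`) ((+) (- c))) G \<subseteq> (conjugate_face ?T \<circ> (`) ((+) (- c))) F"
      unfolding comp_def conjugate_subset_iff[OF T 0 Tf[OF F] Tf[OF G]]
      by (rule inj_image_subset_iff[symmetric]) (rule injI, simp only: add_left_cancel)
  qed
qed

lemma dual_levels:
  assumes D: "bij_betw D {F. F face_of P} {G. G face_of P'}"
    and dim: "\<And>F. F face_of P \<Longrightarrow> aff_dim (D F) = n - 1 - aff_dim F"
  shows "bij_betw D {F. F face_of P \<and> S (aff_dim F)} {G. G face_of P' \<and> S (n - 1 - aff_dim G)}"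
proof -
  have "D ` {F. F face_of P \<and> S (aff_dim F)} = {G. G face_of P' \<and> S (n - 1 - aff_dim G)}"
  proof (intro equalityI subsetI)
    fix G assume "G \<in> D ` {F. F face_of P \<and> S (aff_dim F)}"
    then show "G \<in> {G. G face_of P' \<and> S (n - 1 - aff_dim G)}" using dim bij_betwE[OF D] by auto
  next
    fix G assume G: "G \<in> {G. G face_of P' \<and> S (n - 1 - aff_dim G)}"
    then have "G \<in> D ` {F. F face_of P}" using bij_betw_imp_surj_on[OF D] by simp
    then obtain F where F: "F face_of P" "G = D F" by blast
    then have "S (aff_dim F)" using dim[OF F(1)] G by simp
    then show "G \<in> D ` {F. F face_of P \<and> S (aff_dim F)}" using F by blast
  qed
  then show ?thesis using bij_betw_imp_inj_on[OF D] by (auto simp: bij_betw_def inj_on_def)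
qed

lemma polar_truncation:
  fixes R :: "'a::euclidean_space set"
  shows "polar (convex hull (insert w R)) = polar (convex hull R) \<inter> {y. w \<bullet> y \<le> 1}"
  unfolding polar_convex_hull by auto

text \<open>Conjugation turns the faces of the polar of dimension at least \<open>k\<close> into
  the faces of dimension at most \<open>d - 1 - k\<close>, and the order is reversed
  twice.\<close>

lemma polar_dim_iso:
  fixes P Q :: "'a::euclidean_space set"
  assumes P: "polytope P" "0 \<in> interior P" and Q: "polytope Q" "0 \<in> interior Q"
    and iso: "dim_iso {G. G face_of polar P \<and> k \<le> aff_dim G} {G. G face_of polar Q \<and> k \<le> aff_dim G}"
  shows "dim_iso {F. F face_of P \<and> aff_dim F \<le> int DIM('a) - 1 - k} {F. F face_of Q \<and> aff_dim F \<le> int DIM('a) - 1 - k}"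
proof -
  have bij: "bij_betw (conjugate_face (polar S)) {G. G face_of polar S \<and> k \<le> aff_dim G}
      {F. F face_of S \<and> aff_dim F \<le> int DIM('a) - 1 - k}"
    if S: "polytope S" "0 \<in> interior S" for S :: "'a set"
  proof -
    note S' = polytope_polar[OF S] zero_interior_polar_polytope[OF S(1)]
    have b: "bij_betw (conjugate_face (polar S)) {G. G face_of polar S} {F. F face_of S}"
      using bij_conjugate_face[OF S'] polar_polar_polytope[OF S] by simp
    have "conjugate_face (polar S) ` {G. G face_of polar S \<and> k \<le> aff_dim G} =
      {F. F face_of S \<and> aff_dim F \<le> int DIM('a) - 1 - k}" (is "?l = ?r")
    proof (intro equalityI subsetI)
      fix F assume "F \<in> ?l"
      then show "F \<in> ?r" using aff_dim_conjugate_face[OF S'] bij_betwE[OF b] by auto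
    next
      fix F assume F: "F \<in> ?r"
      then have "F \<in> conjugate_face (polar S) ` {G. G face_of polar S}" using bij_betw_imp_surj_on[OF b] by simp
      then obtain G where "G face_of polar S" "F = conjugate_face (polar S) G" by blast
      then show "F \<in> ?l" using aff_dim_conjugate_face[OF S', of G] F by auto
    qed
    then show ?thesis using bij_betw_imp_inj_on[OF b] by (auto simp: bij_betw_def inj_on_def)
  qed
  obtain f where f: "bij_betw f {G. G face_of polar P \<and> k \<le> aff_dim G} {G. G face_of polar Q \<and> k \<le> aff_dim G}"
    "\<forall>F\<in>{G. G face_of polar P \<and> k \<le> aff_dim G}. \<forall>G\<in>{G. G face_of polar P \<and> k \<le> aff_dim G}. F \<subseteq> G \<longleftrightarrow> f F \<subseteq> f G"
    "\<forall>F\<in>{G. G face_of polar P \<and> k \<le> aff_dim G}. aff_dim (f F) = aff_dim F"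
    using dim_isoE[OF iso] .
  note P' = polytope_polar[OF P] zero_interior_polar_polytope[OF P(1)]
  note Q' = polytope_polar[OF Q] zero_interior_polar_polytope[OF Q(1)]
  show ?thesis
  proof (rule dim_isoI[OF bij[OF P] bij_betw_trans[OF f(1) bij[OF Q]]])
    fix F G assume FG: "F \<in> {G. G face_of polar P \<and> k \<le> aff_dim G}" "G \<in> {G. G face_of polar P \<and> k \<le> aff_dim G}"
    then have fFG: "f F face_of polar Q" "f G face_of polar Q" using bij_betwE[OF f(1)] by auto
    show "conjugate_face (polar P) F \<subseteq> conjugate_face (polar P) G \<longleftrightarrow>
      (conjugate_face (polar Q) \<circ> f) F \<subseteq> (conjugate_face (polar Q) \<circ> f) G"
      using conjugate_subset_iff[OF P', of G F] conjugate_subset_iff[OF Q' fFG(2,1)] f(2)[rule_format, OF FG(2,1)] FG by simp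
    show "aff_dim (conjugate_face (polar P) F) = aff_dim ((conjugate_face (polar Q) \<circ> f) F)"
      using aff_dim_conjugate_face[OF P', of F] aff_dim_conjugate_face[OF Q' fFG(1)] f(3)[rule_format, OF FG(1)] FG by simp
  qed
qed

section \<open>Reconstruction from the middle dimensions\<close>

text \<open>Any inclusion of faces, in either polytope, refines to a chain of inclusions between
  faces of consecutive dimensions.\<close>

lemma iso_from_covers:
  fixes P :: "'a::euclidean_space set" and Q :: "'b::euclidean_space set"
  assumes P: "polytope P" and Q: "polytope Q"
    and lev: "\<And>k. bij_betw h {F. F face_of P \<and> aff_dim F = k} {F. F face_of Q \<and> aff_dim F = k}"
    and cov: "\<And>F G. F face_of P \<Longrightarrow> G face_of P \<Longrightarrow> aff_dim G = aff_dim F + 1 \<Longrightarrow> F \<subseteq> G \<longleftrightarrow> h F \<subseteq> h G"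
  shows "dim_iso {F. F face_of P} {F. F face_of Q}"
proof -
  have h: "h F face_of Q" "aff_dim (h F) = aff_dim F" if "F face_of P" for F
    using bij_betwE[OF lev[of "aff_dim F"]] that by auto
  have inj: "inj_on h {F. F face_of P}"
  proof (rule inj_onI)
    fix F G assume FG: "F \<in> {F. F face_of P}" "G \<in> {F. F face_of P}" "h F = h G"
    then have "aff_dim F = aff_dim G" using h(2)[of F] h(2)[of G] by simp
    then show "F = G" using bij_betw_imp_inj_on[OF lev[of "aff_dim G"]] FG by (auto dest: inj_onD)
  qed
  have onto: "\<exists>F. F face_of P \<and> h F = G" if "G face_of Q" for G
  proof -
    have "G \<in> h ` {F. F face_of P \<and> aff_dim F = aff_dim G}"
      unfolding bij_betw_imp_surj_on[OF lev[of "aff_dim G"]] using that by simp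
    then show ?thesis by blast
  qed
  then have bij: "bij_betw h {F. F face_of P} {F. F face_of Q}" using inj h(1) by (auto simp: bij_betw_def)
  have up: "h F \<subseteq> h G" if asm: "F face_of P" "G face_of P" "F \<subseteq> G" for F G
    using asm(2,3)
  proof (induction "nat (aff_dim G - aff_dim F)" arbitrary: G)
    case 0
    then have "F = G" using face_dim_strict_mono[OF P asm(1) 0(2)] by force
    then show ?case by simp
  next
    case (Suc n)
    have lt: "aff_dim F \<le> aff_dim G - 1" using Suc.hyps(2) by linarith
    then obtain H where H: "H face_of P" "F \<subseteq> H" "H \<subseteq> G" "aff_dim H = aff_dim G - 1"
      using face_interpolation[OF P asm(1) Suc.prems, of "aff_dim G - 1"] by auto
    have "h F \<subseteq> h H" using Suc.hyps(1)[of H] Suc.hyps(2) H by simp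
    moreover have "h H \<subseteq> h G" using cov[OF H(1) Suc.prems(1)] H(3,4) by simp
    ultimately show ?case by blast
  qed
  have down: "F \<subseteq> G" if asm: "F face_of P" "G face_of P" "h F \<subseteq> h G" for F G
    using asm(2,3)
  proof (induction "nat (aff_dim G - aff_dim F)" arbitrary: G)
    case 0
    then have "h F = h G"
      using face_dim_strict_mono[OF Q h(1)[OF asm(1)] h(1)[OF 0(2)]] h(2)[OF asm(1)] h(2)[OF 0(2)] by force
    then show ?case using inj asm(1) 0(2) by (auto dest: inj_onD)
  next
    case (Suc n)
    have lt: "aff_dim (h F) \<le> aff_dim (h G) - 1"
      using Suc.hyps(2) h(2)[OF asm(1)] h(2)[OF Suc.prems(1)] by linarith
    then obtain H' where H': "H' face_of Q" "h F \<subseteq> H'" "H' \<subseteq> h G" "aff_dim H' = aff_dim (h G) - 1"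
      using face_interpolation[OF Q h(1)[OF asm(1)] h(1)[OF Suc.prems(1)] Suc.prems(2), of "aff_dim (h G) - 1"] by auto
    obtain H where H: "H face_of P" "h H = H'" using onto[OF H'(1)] by blast
    have dimH: "aff_dim H = aff_dim G - 1" using h(2)[OF H(1)] h(2)[OF Suc.prems(1)] H(2) H'(4) by simp
    have "F \<subseteq> H" using Suc.hyps(1)[of H] Suc.hyps(2) H H'(2) dimH by simp
    moreover have "H \<subseteq> G" using cov[OF H(1) Suc.prems(1)] H(2) H'(3) dimH by simp
    ultimately show ?case by blast
  qed
  show ?thesis unfolding dim_iso_def
    by (rule exI[of _ h]) (use bij up down h(2) in blast)
qed

text \<open>Facets, ridges and the faces below them are the vertices, edges and 2-faces of the
  dual, so the reconstruction of vertices applies there.\<close>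

lemma facet_bijection:
  fixes P Q :: "'a::euclidean_space set"
  defines "B \<equiv> \<lambda>R::'a set. {F. F face_of R \<and> int DIM('a) - 3 \<le> aff_dim F \<and> aff_dim F \<le> int DIM('a) - 2}"
  assumes P: "full_dim_polytope P" and Q: "full_dim_polytope Q" and n: "DIM('a) \<ge> 3"
    and f: "bij_betw f (B P) (B Q)" "\<And>F G. F \<in> B P \<Longrightarrow> G \<in> B P \<Longrightarrow> F \<subseteq> G \<longleftrightarrow> f F \<subseteq> f G"
      "\<And>F. F \<in> B P \<Longrightarrow> aff_dim (f F) = aff_dim F"
  shows "\<exists>c. bij_betw c {F. F face_of P \<and> aff_dim F = int DIM('a) - 1} {F. F face_of Q \<and> aff_dim F = int DIM('a) - 1} \<and>
    (\<forall>F G. F face_of P \<longrightarrow> aff_dim F = int DIM('a) - 2 \<longrightarrow> G face_of P \<longrightarrow> aff_dim G = int DIM('a) - 1 \<longrightarrow>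
      (F \<subseteq> G \<longleftrightarrow> f F \<subseteq> c G))"
proof -
  let ?n = "int DIM('a)"
  let ?L = "\<lambda>(R::'a set) k. {F. F face_of R \<and> aff_dim F = k}"
  let ?C = "\<lambda>R::'a set. {F. F face_of R \<and> 1 \<le> aff_dim F \<and> aff_dim F \<le> 2}"
  obtain P' :: "'a set" and D where D: "polytope P'" "aff_dim P' = ?n" "bij_betw D {F. F face_of P} {F. F face_of P'}"
    "\<And>F G. F face_of P \<Longrightarrow> G face_of P \<Longrightarrow> F \<subseteq> G \<longleftrightarrow> D G \<subseteq> D F"
    "\<And>F. F face_of P \<Longrightarrow> aff_dim (D F) = ?n - 1 - aff_dim F"
    using polytope_dual_exists[OF P] by metis
  obtain Q' :: "'a set" and D' where D': "polytope Q'" "aff_dim Q' = ?n" "bij_betw D' {F. F face_of Q} {F. F face_of Q'}"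
    "\<And>F G. F face_of Q \<Longrightarrow> G face_of Q \<Longrightarrow> F \<subseteq> G \<longleftrightarrow> D' G \<subseteq> D' F"
    "\<And>F. F face_of Q \<Longrightarrow> aff_dim (D' F) = ?n - 1 - aff_dim F"
    using polytope_dual_exists[OF Q] by metis
  have lev: "{G. G face_of R \<and> ?n - 1 - aff_dim G = ?n - 1} = ?L R 0"
    "{G. G face_of R \<and> ?n - 3 \<le> ?n - 1 - aff_dim G \<and> ?n - 1 - aff_dim G \<le> ?n - 2} = ?C R" for R :: "'a set"
    by auto
  have Dlev: "bij_betw D (?L P (?n - 1)) (?L P' 0)" and D'lev: "bij_betw D' (?L Q (?n - 1)) (?L Q' 0)"
    using dual_levels[OF D(3,5), of "\<lambda>k. k = ?n - 1"] dual_levels[OF D'(3,5), of "\<lambda>k. k = ?n - 1"]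
    unfolding lev by simp_all
  have DB: "bij_betw D (B P) (?C P')" and D'B: "bij_betw D' (B Q) (?C Q')"
    using dual_levels[OF D(3,5), of "\<lambda>k. ?n - 3 \<le> k \<and> k \<le> ?n - 2"]
      dual_levels[OF D'(3,5), of "\<lambda>k. ?n - 3 \<le> k \<and> k \<le> ?n - 2"]
    unfolding lev B_def by simp_all
  let ?E = "the_inv_into (B P) D"
  have EB: "bij_betw ?E (?C P') (B P)" by (rule bij_betw_the_inv_into[OF DB])
  have ED: "?E (D F) = F" if "F \<in> B P" for F
    using the_inv_into_f_f[OF bij_betw_imp_inj_on[OF DB] that] .
  have E: "?E G \<in> B P" "D (?E G) = G" if "G \<in> ?C P'" for G
    using bij_betwE[OF EB] f_the_inv_into_f_bij_betw[OF DB] that by blast+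
  have Bface: "F face_of R" if "F \<in> B R" for F R using that by (simp add: B_def)
  define f' where "f' = D' \<circ> f \<circ> ?E"
  have "edge_polygon_iso P' Q' f'"
  proof
    show "bij_betw f' (?C P') (?C Q')"
      unfolding f'_def using bij_betw_trans[OF EB bij_betw_trans[OF f(1) D'B]] by (simp add: comp_assoc)
    show "polytope P'" "3 \<le> aff_dim P'" "polytope Q'" "3 \<le> aff_dim Q'" using D(1,2) D'(1,2) n by auto
    fix F assume F: "F face_of P'" "1 \<le> aff_dim F" "aff_dim F \<le> 2"
    then have FC: "F \<in> ?C P'" by simp
    have fF: "f (?E F) \<in> B Q" using bij_betwE[OF f(1)] E(1)[OF FC] by blast
    have "aff_dim (f' F) = ?n - 1 - aff_dim (f (?E F))" using D'(5)[OF Bface[OF fF]] by (simp add: f'_def)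
    also have "\<dots> = ?n - 1 - aff_dim (?E F)" using f(3)[OF E(1)[OF FC]] by simp
    also have "\<dots> = aff_dim F" using D(5)[OF Bface[OF E(1)[OF FC]]] E(2)[OF FC] by simp
    finally show "aff_dim (f' F) = aff_dim F" .
    fix G assume G: "G face_of P'" "1 \<le> aff_dim G" "aff_dim G \<le> 2"
    then have GC: "G \<in> ?C P'" by simp
    have fG: "f (?E G) \<in> B Q" using bij_betwE[OF f(1)] E(1)[OF GC] by blast
    have "F \<subseteq> G \<longleftrightarrow> ?E G \<subseteq> ?E F"
      using D(4)[OF Bface[OF E(1)[OF GC]] Bface[OF E(1)[OF FC]]] E(2)[OF FC] E(2)[OF GC] by simp
    also have "\<dots> \<longleftrightarrow> f (?E G) \<subseteq> f (?E F)" by (rule f(2)[OF E(1)[OF GC] E(1)[OF FC]])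
    also have "\<dots> \<longleftrightarrow> f' F \<subseteq> f' G" using D'(4)[OF Bface[OF fG] Bface[OF fF]] by (simp add: f'_def)
    finally show "F \<subseteq> G \<longleftrightarrow> f' F \<subseteq> f' G" .
  qed
  then obtain p where p: "bij_betw p (?L P' 0) (?L Q' 0)"
    "\<And>F e. F face_of P' \<Longrightarrow> aff_dim F = 0 \<Longrightarrow> e face_of P' \<Longrightarrow> aff_dim e = 1 \<Longrightarrow> F \<subseteq> e \<longleftrightarrow> p F \<subseteq> f' e"
    using edge_polygon_iso.vertex_face_bijection by blast
  let ?E' = "the_inv_into (?L Q (?n - 1)) D'"
  define c where "c = ?E' \<circ> (p \<circ> D)"
  have bij: "bij_betw c (?L P (?n - 1)) (?L Q (?n - 1))"
    unfolding c_def by (rule bij_betw_trans[OF bij_betw_trans[OF Dlev p(1)] bij_betw_the_inv_into[OF D'lev]])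
  show ?thesis
  proof (intro exI[of _ c] conjI allI impI bij)
    fix F G assume F: "F face_of P" "aff_dim F = ?n - 2" and G: "G face_of P" "aff_dim G = ?n - 1"
    have FB: "F \<in> B P" using F by (simp add: B_def)
    have DF: "D F face_of P'" "aff_dim (D F) = 1" using D(5)[OF F(1)] F bij_betwE[OF D(3)] by auto
    have DG: "D G \<in> ?L P' 0" using bij_betwE[OF Dlev] G by blast
    have cG: "D' (c G) = p (D G)" "c G face_of Q"
      using f_the_inv_into_f_bij_betw[OF D'lev, of "p (D G)"] bij_betwE[OF p(1)] DG bij_betwE[OF bij] G
      by (auto simp: c_def)
    have fF: "f F face_of Q" using bij_betwE[OF f(1)] FB Bface by blast
    have "F \<subseteq> G \<longleftrightarrow> D G \<subseteq> D F" by (rule D(4)[OF F(1) G(1)])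
    also have "\<dots> \<longleftrightarrow> p (D G) \<subseteq> f' (D F)" using p(2)[OF _ _ DF, of "D G"] DG by simp
    also have "\<dots> \<longleftrightarrow> D' (c G) \<subseteq> D' (f F)" using ED[OF FB] cG(1) by (simp add: f'_def)
    also have "\<dots> \<longleftrightarrow> f F \<subseteq> c G" using D'(4)[OF fF cG(2)] by simp
    finally show "F \<subseteq> G \<longleftrightarrow> f F \<subseteq> c G" .
  qed
qed

text \<open>The given isomorphism is extended by the vertices it determines and, dually, by the
  facets. Only covering pairs have to be compared, so incidences between vertices and faces that are
  not edges, or between facets and faces that are not ridges, take care of themselves. The
  assumption on the dimension is used here: both the pair of dimensions \<open>1, 2\<close> and the
  pair \<open>d - 3, d - 2\<close> must lie in the range \<open>1..d - 2\<close>.\<close>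

lemma reconstruction:
  fixes P Q :: "'a::euclidean_space set"
  assumes P: "full_dim_polytope P" and Q: "full_dim_polytope Q" and d: "DIM('a) \<ge> 4"
    and iso: "dim_iso {F. F face_of P \<and> 1 \<le> aff_dim F \<and> aff_dim F \<le> int DIM('a) - 2}
      {F. F face_of Q \<and> 1 \<le> aff_dim F \<and> aff_dim F \<le> int DIM('a) - 2}"
  shows "dim_iso {F. F face_of P} {F. F face_of Q}"
proof -
  let ?n = "int DIM('a)"
  let ?A = "\<lambda>R::'a set. {F. F face_of R \<and> 1 \<le> aff_dim F \<and> aff_dim F \<le> ?n - 2}"
  let ?L = "\<lambda>(R::'a set) k. {F. F face_of R \<and> aff_dim F = k}"
  have n: "?n \<ge> 4" using d by simp
  have pP: "polytope P" "aff_dim P = ?n" and pQ: "polytope Q" "aff_dim Q = ?n"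
    using P Q aff_dim_eq_full by (auto simp: full_dim_polytope_def)
  obtain f where f: "bij_betw f (?A P) (?A Q)"
    "\<forall>F\<in>?A P. \<forall>G\<in>?A P. F \<subseteq> G \<longleftrightarrow> f F \<subseteq> f G" "\<forall>F\<in>?A P. aff_dim (f F) = aff_dim F"
    using dim_isoE[OF iso] .
  have flev: "bij_betw f (?L P k) (?L Q k)" if k: "1 \<le> k" "k \<le> ?n - 2" for k
  proof -
    have "{F \<in> ?A R. aff_dim F = k} = ?L R k" for R using k by auto
    then show ?thesis using bij_betw_dim_restrict[OF f(1,3), of "\<lambda>j. j = k"] by simp
  qed
  have ep: "edge_polygon_iso P Q f"
  proof
    have "{F \<in> ?A R. aff_dim F \<le> 2} = {F. F face_of R \<and> 1 \<le> aff_dim F \<and> aff_dim F \<le> 2}" for R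
      using n by auto
    then show "bij_betw f {F. F face_of P \<and> 1 \<le> aff_dim F \<and> aff_dim F \<le> 2}
      {F. F face_of Q \<and> 1 \<le> aff_dim F \<and> aff_dim F \<le> 2}"
      using bij_betw_dim_restrict[OF f(1,3), of "\<lambda>j. j \<le> 2"] by simp
    show "polytope P" "3 \<le> aff_dim P" "polytope Q" "3 \<le> aff_dim Q" using pP pQ n by auto
    fix F assume F: "F face_of P" "1 \<le> aff_dim F" "aff_dim F \<le> 2"
    then have FA: "F \<in> ?A P" using n by auto
    then show "aff_dim (f F) = aff_dim F" using f(3) by blast
    fix G assume G: "G face_of P" "1 \<le> aff_dim G" "aff_dim G \<le> 2"
    then have "G \<in> ?A P" using n by auto
    then show "F \<subseteq> G \<longleftrightarrow> f F \<subseteq> f G" using f(2) FA by blast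
  qed
  then obtain p where p: "bij_betw p (?L P 0) (?L Q 0)"
    "\<And>F e. F face_of P \<Longrightarrow> aff_dim F = 0 \<Longrightarrow> e face_of P \<Longrightarrow> aff_dim e = 1 \<Longrightarrow> F \<subseteq> e \<longleftrightarrow> p F \<subseteq> f e"
    using edge_polygon_iso.vertex_face_bijection by blast
  have fB: "bij_betw f {F. F face_of P \<and> ?n - 3 \<le> aff_dim F \<and> aff_dim F \<le> ?n - 2}
      {F. F face_of Q \<and> ?n - 3 \<le> aff_dim F \<and> aff_dim F \<le> ?n - 2}"
  proof -
    have "{F \<in> ?A R. ?n - 3 \<le> aff_dim F} = {F. F face_of R \<and> ?n - 3 \<le> aff_dim F \<and> aff_dim F \<le> ?n - 2}" for R
      using n by auto
    then show ?thesis using bij_betw_dim_restrict[OF f(1,3), of "\<lambda>j. ?n - 3 \<le> j"] by simp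
  qed
  have "\<exists>c. bij_betw c (?L P (?n - 1)) (?L Q (?n - 1)) \<and>
    (\<forall>F G. F face_of P \<longrightarrow> aff_dim F = ?n - 2 \<longrightarrow> G face_of P \<longrightarrow> aff_dim G = ?n - 1 \<longrightarrow> (F \<subseteq> G \<longleftrightarrow> f F \<subseteq> c G))"
  proof (rule facet_bijection[OF P Q _ fB])
    show "DIM('a) \<ge> 3" using d by simp
    fix F assume F: "F \<in> {F. F face_of P \<and> ?n - 3 \<le> aff_dim F \<and> aff_dim F \<le> ?n - 2}"
    then have FA: "F \<in> ?A P" using n by auto
    then show "aff_dim (f F) = aff_dim F" using f(3) by blast
    fix G assume "G \<in> {F. F face_of P \<and> ?n - 3 \<le> aff_dim F \<and> aff_dim F \<le> ?n - 2}"
    then have "G \<in> ?A P" using n by auto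
    then show "F \<subseteq> G \<longleftrightarrow> f F \<subseteq> f G" using f(2) FA by blast
  qed
  then obtain c where c: "bij_betw c (?L P (?n - 1)) (?L Q (?n - 1))"
    "\<forall>F G. F face_of P \<longrightarrow> aff_dim F = ?n - 2 \<longrightarrow> G face_of P \<longrightarrow> aff_dim G = ?n - 1 \<longrightarrow> (F \<subseteq> G \<longleftrightarrow> f F \<subseteq> c G)"
    by (elim exE conjE)
  note clev = c(1) and cinc = c(2)[rule_format]
  define h where "h F = (if aff_dim F = -1 then {} else if aff_dim F = 0 then p F
    else if aff_dim F \<le> ?n - 2 then f F else if aff_dim F = ?n - 1 then c F else Q)" for F
  show ?thesis
  proof (rule iso_from_covers[OF pP(1) pQ(1)])
    fix k
    have bot: "?L R (-1) = {{}}" for R using aff_dim_empty by auto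
    have top: "?L R ?n = {R}" if R: "polytope R" "aff_dim R = ?n" for R
      using face_of_aff_dim_lt[OF polytope_imp_convex[OF R(1)]] R face_of_refl[OF polytope_imp_convex[OF R(1)]] by force
    have none: "?L R k = {}" if "k < -1 \<or> k > ?n" for R
      using that aff_dim_geq aff_dim_le_DIM by (auto simp: not_le[symmetric])
    consider "k < -1 \<or> k > ?n" | "k = -1" | "k = 0" | "1 \<le> k" "k \<le> ?n - 2" | "k = ?n - 1" | "k = ?n" by linarith
    then show "bij_betw h (?L P k) (?L Q k)"
    proof cases
      case 1 then show ?thesis unfolding none[OF 1] by (simp add: bij_betw_def)
    next
      case 2 then show ?thesis unfolding 2 bot by (simp add: h_def bij_betw_def)
    next
      case 3
      have "bij_betw h (?L P 0) (?L Q 0) = bij_betw p (?L P 0) (?L Q 0)"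
        by (rule bij_betw_cong) (simp add: h_def)
      then show ?thesis unfolding 3 using p(1) by blast
    next
      case 4
      have "bij_betw h (?L P k) (?L Q k) = bij_betw f (?L P k) (?L Q k)"
        by (rule bij_betw_cong) (use 4 in \<open>simp add: h_def\<close>)
      then show ?thesis using flev[OF 4] by blast
    next
      case 5
      have "bij_betw h (?L P k) (?L Q k) = bij_betw c (?L P k) (?L Q k)"
        by (rule bij_betw_cong) (use 5 n in \<open>simp add: h_def\<close>)
      then show ?thesis using clev unfolding 5 by blast
    next
      case 6
      have "h P = Q" using pP(2) n by (simp add: h_def)
      then show ?thesis unfolding 6 top[OF pP] top[OF pQ] by (simp add: bij_betw_def)
    qed
  next
    fix F G assume F: "F face_of P" and G: "G face_of P" and dim: "aff_dim G = aff_dim F + 1"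
    have GP: "aff_dim G \<le> ?n" by (rule aff_dim_le_DIM)
    have F1: "-1 \<le> aff_dim F" by (rule aff_dim_geq)
    consider "aff_dim F = -1" | "aff_dim F = 0" | "1 \<le> aff_dim F" "aff_dim F \<le> ?n - 3" | "aff_dim F = ?n - 2" | "aff_dim F = ?n - 1"
      using F1 GP dim by linarith
    then show "F \<subseteq> G \<longleftrightarrow> h F \<subseteq> h G"
    proof cases
      case 1
      then have "F = {}" using aff_dim_empty by blast
      then show ?thesis using 1 by (simp add: h_def)
    next
      case 2
      then have "h F = p F" "h G = f G" using dim n by (auto simp: h_def)
      then show ?thesis using p(2)[OF F 2 G] dim 2 by simp
    next
      case 3
      then have "h F = f F" "h G = f G" "F \<in> ?A P" "G \<in> ?A P" using dim n F G by (auto simp: h_def)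
      then show ?thesis using f(2) by simp
    next
      case 4
      then have "h F = f F" "h G = c G" using dim n by (auto simp: h_def)
      then show ?thesis using cinc[OF F 4 G] dim 4 by simp
    next
      case 5
      then have "aff_dim G = ?n" using dim by simp
      then have "G = P" using face_of_aff_dim_lt[OF polytope_imp_convex[OF pP(1)] G] pP(2) by auto
      moreover have "h F = c F" "h G = Q" using 5 dim n by (auto simp: h_def)
      ultimately show ?thesis 
        using face_of_imp_subset[OF F] face_of_imp_subset[of "c F" Q] bij_betwE[OF clev] F 5 by auto
    qed
  qed
qed

section \<open>Truncating a vertex and stacking on a facet\<close>

lemma rel_interior_meets_hyperplane:
  fixes F :: "'a::euclidean_space set"
  assumes F: "convex F" and x: "x \<in> F" "l \<bullet> x < c" and z: "z \<in> F" "l \<bullet> z > c"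
  shows "rel_interior F \<inter> {x. l \<bullet> x = c} \<noteq> {}"
proof -
  obtain y where y: "y \<in> rel_interior F" using F x(1) rel_interior_eq_empty by blast
  have seg: "open_segment y w \<subseteq> rel_interior F" if "w \<in> F" for w
    using rel_interior_closure_convex_segment[OF F y] that closure_subset by blast
  consider "l \<bullet> y = c" | "l \<bullet> y > c" | "l \<bullet> y < c" by linarith
  then show ?thesis
  proof cases
    case 1 then show ?thesis using y by blast
  next
    case 2
    then show ?thesis using segment_crosses[of c l y x] seg[OF x(1)] x(2) by blast
  next
    case 3
    then obtain p where "p \<in> open_segment z y" "l \<bullet> p = c" using segment_crosses[of c l z y] z(2) by blast
    then show ?thesis using seg[OF z(1)] by (auto simp: open_segment_commute)
  qed
qed

lemma rel_interior_meets_halfspace: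
  fixes F :: "'a::euclidean_space set"
  assumes F: "convex F" and x: "x \<in> F" "l \<bullet> x < c"
  shows "rel_interior F \<inter> {x. l \<bullet> x < c} \<noteq> {}"
proof -
  have "x \<in> closure (rel_interior F)"
    using convex_closure_rel_interior[OF F] x(1) closure_subset by blast
  moreover have "open {x. l \<bullet> x < c}" by (rule open_halfspace_lt)
  ultimately show ?thesis using x(2) open_Int_closure_eq_empty[of "{x. l \<bullet> x < c}" "rel_interior F"] by blast
qed

text \<open>The halfspace cuts off the single vertex \<open>z\<close>. The bounding hyperplane may
  pass through one of the remaining points.\<close>

locale vertex_truncation =
  fixes V :: "'a::euclidean_space set" and z l :: 'a and c :: real
  assumes fin: "finite V" and zV: "z \<in> V" and cut: "l \<bullet> z > c"
    and keep: "\<And>v. v \<in> V \<Longrightarrow> v \<noteq> z \<Longrightarrow> l \<bullet> v \<le> c"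
    and one: "\<And>v w. v \<in> V \<Longrightarrow> w \<in> V \<Longrightarrow> l \<bullet> v = c \<Longrightarrow> l \<bullet> w = c \<Longrightarrow> v = w"
begin

definition "R = convex hull V"

definition "T = R \<inter> {x. l \<bullet> x \<le> c}"

text \<open>A label \<open>(False, F)\<close> stands for the part of \<open>F\<close> that is
  kept, a label \<open>(True, F)\<close> for the section of \<open>F\<close> by the cutting
  hyperplane. Sections lose one dimension, which is why the bounds differ. The set of labels does
  not depend on the halfspace.\<close>

definition "index = {(b, F). F face_of R \<and> (if b then z \<in> F \<and> 3 \<le> aff_dim F else 2 \<le> aff_dim F)}"

definition "trunc_face = (\<lambda>(b, F). if b then F \<inter> {x. l \<bullet> x = c} else F \<inter> {x. l \<bullet> x \<le> c})"

lemma polyR: "polytope R" by (simp add: R_def fin polytope_convex_hull)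

lemma face_hull:
  assumes F: "F face_of R"
  shows "F = convex hull (V \<inter> F)"
proof
  obtain S where S: "S \<subseteq> V" "F = convex hull S"
    using face_of_convex_hull_subset[OF finite_imp_compact[OF fin]] F unfolding R_def by blast
  then have "S \<subseteq> V \<inter> F" using hull_subset[of S convex] by blast
  then show "F \<subseteq> convex hull (V \<inter> F)" using hull_mono S(2) by blast
  show "convex hull (V \<inter> F) \<subseteq> F" by (rule hull_minimal) (use face_of_imp_convex[OF F] in auto)
qed

text \<open>A face of dimension at least 2 has three vertices; besides \<open>z\<close> and the
  one point allowed on the hyperplane, one of them remains.\<close>

lemma below_point:
  assumes F: "F face_of R" "2 \<le> aff_dim F"
  shows "\<exists>x\<in>F. l \<bullet> x < c"
proof (rule ccontr)
  assume no: "\<not> ?thesis"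
  have ge: "l \<bullet> v = c" if "v \<in> V" "v \<in> F" "v \<noteq> z" for v
    using keep[OF that(1,3)] no that(2) by force
  have "\<exists>w. V \<inter> F \<subseteq> {z, w}"
  proof (cases "\<exists>w \<in> V \<inter> F. w \<noteq> z")
    case True
    then obtain w where w: "w \<in> V \<inter> F" "w \<noteq> z" by blast
    have "V \<inter> F \<subseteq> {z, w}" using ge one w by blast
    then show ?thesis by blast
  qed blast
  then obtain w where w: "V \<inter> F \<subseteq> {z, w}" by blast
  have "aff_dim F = aff_dim (convex hull (V \<inter> F))" by (rule arg_cong[OF face_hull[OF F(1)]])
  also have "\<dots> = aff_dim (V \<inter> F)" by (rule aff_dim_convex_hull)
  also have "\<dots> \<le> aff_dim {z, w}" by (rule aff_dim_subset[OF w])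
  also have "\<dots> \<le> 1" by simp
  finally show False using F(2) by simp
qed

lemma slice_dim:
  assumes F: "F face_of R" "2 \<le> aff_dim F" "z \<in> F"
  shows "rel_interior F \<inter> {x. l \<bullet> x = c} \<noteq> {}" "aff_dim (F \<inter> {x. l \<bullet> x = c}) = aff_dim F - 1"
proof -
  obtain x where "x \<in> F" "l \<bullet> x < c" using below_point[OF F(1,2)] by blast
  then show ne: "rel_interior F \<inter> {x. l \<bullet> x = c} \<noteq> {}"
    using rel_interior_meets_hyperplane[OF face_of_imp_convex[OF F(1)] _ _ F(3) cut] by blast
  have "\<not> F \<subseteq> {x. l \<bullet> x = c}" using F(3) cut by auto
  then show "aff_dim (F \<inter> {x. l \<bullet> x = c}) = aff_dim F - 1" by (rule aff_dim_slice[OF ne])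
qed

lemma below_dim:
  assumes F: "F face_of R" "2 \<le> aff_dim F"
  shows "aff_dim (F \<inter> {x. l \<bullet> x \<le> c}) = aff_dim F"
proof -
  have "F \<inter> {x. l \<bullet> x < c} \<noteq> {}" using below_point[OF F] by blast
  then have "aff_dim (F \<inter> {x. l \<bullet> x < c}) = aff_dim F"
    using aff_dim_convex_Int_open[OF face_of_imp_convex[OF F(1)] open_halfspace_lt] by blast
  moreover have "aff_dim (F \<inter> {x. l \<bullet> x < c}) \<le> aff_dim (F \<inter> {x. l \<bullet> x \<le> c})"
    by (rule aff_dim_subset) auto
  moreover have "aff_dim (F \<inter> {x. l \<bullet> x \<le> c}) \<le> aff_dim F"
    by (rule aff_dim_subset) auto
  ultimately show ?thesis by linarith
qed

lemma trunc_face_face: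
  assumes "i \<in> index"
  shows "trunc_face i face_of T"
proof (cases i)
  case (Pair b F)
  then have F: "F face_of R" using assms by (auto simp: index_def)
  show ?thesis
    unfolding T_def Pair trunc_face_def
    using face_of_Int_Int[OF F hyperplane_face_of_halfspace_le[of l c]]
      face_of_Int_Int[OF F face_of_refl[OF convex_halfspace_le[of l c]]] by auto
qed

lemma trunc_face_dim:
  assumes "i \<in> index"
  shows "aff_dim (trunc_face i) = aff_dim (snd i) - of_bool (fst i)"
  using assms slice_dim below_dim by (cases i) (auto simp: index_def trunc_face_def)

text \<open>Consider the face \<open>F\<close> of the original polytope containing a relative
  interior point \<open>y\<close> of \<open>G\<close> in its relative interior. According to the
  side of \<open>y\<close>, \<open>G\<close> is the kept part or the section of \<open>F\<close>. In
  the second case \<open>F\<close> contains \<open>z\<close>, as otherwise the hyperplane would meet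
  \<open>F\<close> in a face lying entirely on it, which is too small.\<close>

lemma trunc_face_onto:
  assumes G: "G face_of T" "2 \<le> aff_dim G"
  shows "G \<in> trunc_face ` index"
proof -
  have "G \<noteq> {}" using G(2) by auto
  then obtain y where y: "y \<in> rel_interior G"
    using face_of_imp_convex[OF G(1)] rel_interior_eq_empty by blast
  have yT: "y \<in> R" "l \<bullet> y \<le> c"
    using y rel_interior_subset face_of_imp_subset[OF G(1)] by (auto simp: T_def)
  obtain F where F: "F face_of R" "y \<in> rel_interior F" using face_through_point[OF polyR yT(1)] .
  have convF: "convex F" using face_of_imp_convex[OF F(1)] .
  show ?thesis
  proof (cases "l \<bullet> y < c")
    case True
    have l0: "l \<noteq> 0" using cut True by auto
    have int: "rel_interior {x. l \<bullet> x \<le> c} = {x. l \<bullet> x < c}"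
    proof -
      have "interior {x. l \<bullet> x \<le> c} = {x. l \<bullet> x < c}" by (rule interior_halfspace_le[OF l0])
      moreover from this have "interior {x. l \<bullet> x \<le> c} \<noteq> {}" using True by blast
      ultimately show ?thesis using rel_interior_nonempty_interior by metis
    qed
    have "rel_interior (F \<inter> {x. l \<bullet> x \<le> c}) = rel_interior F \<inter> {x. l \<bullet> x < c}"
      using convex_rel_interior_inter_two[OF convF convex_halfspace_le[of l c]] int F(2) True by auto
    then have "rel_interior G \<inter> rel_interior (F \<inter> {x. l \<bullet> x \<le> c}) \<noteq> {}" using y F(2) True by blast
    moreover have "(F \<inter> {x. l \<bullet> x \<le> c}) face_of T" unfolding T_def
      using face_of_Int_Int[OF F(1) face_of_refl[OF convex_halfspace_le[of l c]]] .
    ultimately have GF: "G = F \<inter> {x. l \<bullet> x \<le> c}" using face_of_eq[OF G(1)] by blast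
    then have "aff_dim G \<le> aff_dim F" by (auto intro: aff_dim_subset)
    then have "(False, F) \<in> index" using F(1) G(2) by (auto simp: index_def)
    then show ?thesis using GF by (auto simp: trunc_face_def intro!: image_eqI[of _ _ "(False, F)"])
  next
    case False
    then have yc: "l \<bullet> y = c" using yT(2) by simp
    have "rel_interior (F \<inter> {x. l \<bullet> x = c}) = rel_interior F \<inter> {x. l \<bullet> x = c}"
      using convex_affine_rel_interior_Int[OF convF affine_hyperplane[of l c]] yc F(2) by blast
    then have "rel_interior G \<inter> rel_interior (F \<inter> {x. l \<bullet> x = c}) \<noteq> {}" using y F(2) yc by blast
    moreover have "(F \<inter> {x. l \<bullet> x = c}) face_of T" unfolding T_def
      using face_of_Int_Int[OF F(1) hyperplane_face_of_halfspace_le[of l c]] .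
    ultimately have GF: "G = F \<inter> {x. l \<bullet> x = c}" using face_of_eq[OF G(1)] by blast
    have F2: "2 \<le> aff_dim F" using GF G(2) aff_dim_subset[of G F] by auto
    have zF: "z \<in> F"
    proof (rule ccontr)
      assume "z \<notin> F"
      then have "V \<inter> F \<subseteq> {x. l \<bullet> x \<le> c}" using keep by blast
      then have "convex hull (V \<inter> F) \<subseteq> {x. l \<bullet> x \<le> c}" by (rule hull_minimal) (rule convex_halfspace_le)
      then have "F \<subseteq> {x. l \<bullet> x \<le> c}" unfolding face_hull[OF F(1), symmetric] .
      then have H: "(F \<inter> {x. l \<bullet> x = c}) face_of F"
        using face_of_Int_supporting_hyperplane_le[OF convF, of l c] by blast
      have GR: "G face_of R" using H F(1) GF face_of_trans by blast
      show False using below_point[OF GR G(2)] GF by auto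
    qed
    have "(True, F) \<in> index" using F(1) zF slice_dim(2)[OF F(1) F2 zF] G(2) GF by (auto simp: index_def)
    then show ?thesis using GF by (auto simp: trunc_face_def intro!: image_eqI[of _ _ "(True, F)"])
  qed
qed

text \<open>A kept part or a section of \<open>F\<close> contains relative interior points of
  \<open>F\<close>, so it cannot lie in another face without \<open>F\<close> doing so; and a kept
  part has points off the hyperplane, so it never lies in a section.\<close>

lemma trunc_face_subset:
  assumes i: "(b, F) \<in> index" and j: "(b', F') \<in> index"
  shows "trunc_face (b, F) \<subseteq> trunc_face (b', F') \<longleftrightarrow> F \<subseteq> F' \<and> (b' \<longrightarrow> b)"
proof
  have F: "F face_of R" "F' face_of R" "2 \<le> aff_dim F" using i j by (auto simp: index_def split: if_splits)
  assume sub: "trunc_face (b, F) \<subseteq> trunc_face (b', F')"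
  then have sub': "trunc_face (b, F) \<subseteq> F'" by (auto simp: trunc_face_def split: if_splits)
  have "F' \<inter> rel_interior F \<noteq> {}"
  proof (cases b)
    case True
    then have "rel_interior F \<inter> {x. l \<bullet> x = c} \<noteq> {}"
      using slice_dim(1)[OF F(1,3)] i by (auto simp: index_def)
    moreover have "rel_interior F \<inter> {x. l \<bullet> x = c} \<subseteq> F'"
      using sub' True rel_interior_subset by (auto simp: trunc_face_def)
    ultimately show ?thesis by blast
  next
    case False
    obtain x where "x \<in> F" "l \<bullet> x < c" using below_point[OF F(1,3)] by blast
    then have "rel_interior F \<inter> {x. l \<bullet> x < c} \<noteq> {}"
      by (rule rel_interior_meets_halfspace[OF face_of_imp_convex[OF F(1)]])
    moreover have "rel_interior F \<inter> {x. l \<bullet> x < c} \<subseteq> F'"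
      using sub' False rel_interior_subset[of F] by (force simp: trunc_face_def)
    ultimately show ?thesis by blast
  qed
  then have "F \<subseteq> F'" using subset_of_face_of[OF F(2) face_of_imp_subset[OF F(1)]] by blast
  moreover have "b' \<longrightarrow> b"
    using sub below_point[OF F(1,3)] by (force simp: trunc_face_def split: if_splits)
  ultimately show "F \<subseteq> F' \<and> (b' \<longrightarrow> b)" by blast
next
  assume "F \<subseteq> F' \<and> (b' \<longrightarrow> b)"
  then show "trunc_face (b, F) \<subseteq> trunc_face (b', F')"
    by (auto simp: trunc_face_def)
qed

lemma bij_trunc_face: "bij_betw trunc_face index {G. G face_of T \<and> 2 \<le> aff_dim G}"
proof -
  have "inj_on trunc_face index"
  proof (rule inj_onI, clarify)
    fix b F b' F' assume a: "(b, F) \<in> index" "(b', F') \<in> index" "trunc_face (b, F) = trunc_face (b', F')"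
    show "b = b' \<and> F = F'"
      using trunc_face_subset[OF a(1,2)] trunc_face_subset[OF a(2,1)] a(3) by blast
  qed
  moreover have "2 \<le> aff_dim (trunc_face i)" if "i \<in> index" for i
    using trunc_face_dim[OF that] that by (auto simp: index_def split: if_splits)
  ultimately show ?thesis
    using trunc_face_face trunc_face_onto by (auto simp: bij_betw_def)
qed

end

text \<open>Labels, their order and the dimensions they stand for involve \<open>V\<close> and
  \<open>z\<close> only.\<close>

lemma truncations_high_iso:
  assumes 1: "vertex_truncation V z l1 c1" and 2: "vertex_truncation V z l2 c2"
  shows "dim_iso {G. G face_of convex hull V \<inter> {x. l1 \<bullet> x \<le> c1} \<and> 2 \<le> aff_dim G}
    {G. G face_of convex hull V \<inter> {x. l2 \<bullet> x \<le> c2} \<and> 2 \<le> aff_dim G}"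
proof -
  interpret t1: vertex_truncation V z l1 c1 by fact
  interpret t2: vertex_truncation V z l2 c2 by fact
  have T: "t1.T = convex hull V \<inter> {x. l1 \<bullet> x \<le> c1}" "t2.T = convex hull V \<inter> {x. l2 \<bullet> x \<le> c2}"
    by (simp_all add: t1.T_def t2.T_def t1.R_def t2.R_def)
  show ?thesis
  proof (rule dim_isoI)
    show "bij_betw t1.trunc_face t1.index {G. G face_of convex hull V \<inter> {x. l1 \<bullet> x \<le> c1} \<and> 2 \<le> aff_dim G}"
      using t1.bij_trunc_face unfolding T(1) .
    show "bij_betw t2.trunc_face t1.index {G. G face_of convex hull V \<inter> {x. l2 \<bullet> x \<le> c2} \<and> 2 \<le> aff_dim G}"
      using t2.bij_trunc_face unfolding T(2) .
    fix i j assume i: "i \<in> t1.index" and j: "j \<in> t1.index"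
    obtain b F b' F' where bF: "i = (b, F)" "j = (b', F')" by (cases i, cases j)
    show "t1.trunc_face i \<subseteq> t1.trunc_face j \<longleftrightarrow> t2.trunc_face i \<subseteq> t2.trunc_face j"
      unfolding bF
      by (simp only: t1.trunc_face_subset[OF i[unfolded bF] j[unfolded bF]]
          t2.trunc_face_subset[OF i[unfolded bF] j[unfolded bF]])
    show "aff_dim (t1.trunc_face i) = aff_dim (t2.trunc_face i)"
      unfolding t1.trunc_face_dim[OF i] t2.trunc_face_dim[OF i] ..
  qed
qed

text \<open>The polar of stacking \<open>w\<close> on \<open>R\<close> is truncating the polar of
  \<open>R\<close> by \<open>w \<bullet> y \<le> 1\<close>. That \<open>w\<close> violates
  exactly one constraint \<open>n0\<close> of \<open>R\<close> and is tight for at most one means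
  that the truncation cuts off \<open>n0\<close> and touches at most one other normal.\<close>

lemma centred_stackings_low_iso:
  fixes R :: "'a::euclidean_space set"
  assumes N: "finite N" "n0 \<in> N" and R: "R = {x. \<forall>n\<in>N. n \<bullet> x \<le> 1}" "bounded R"
    and w: "\<And>w. w \<in> {w1, w2} \<Longrightarrow> n0 \<bullet> w > 1"
      "\<And>w n. w \<in> {w1, w2} \<Longrightarrow> n \<in> N \<Longrightarrow> n \<noteq> n0 \<Longrightarrow> n \<bullet> w \<le> 1"
      "\<And>w n n'. w \<in> {w1, w2} \<Longrightarrow> n \<in> N \<Longrightarrow> n' \<in> N \<Longrightarrow> n \<bullet> w = 1 \<Longrightarrow> n' \<bullet> w = 1 \<Longrightarrow> n = n'"
  shows "dim_iso {F. F face_of convex hull (insert w1 R) \<and> aff_dim F \<le> int DIM('a) - 3}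
    {F. F face_of convex hull (insert w2 R) \<and> aff_dim F \<le> int DIM('a) - 3}"
proof -
  have Req: "R = \<Inter> ((\<lambda>n. {x. n \<bullet> x \<le> 1}) ` N)" using R(1) by auto
  have "polyhedron R" unfolding Req using N(1) by (auto intro!: polyhedron_Inter polyhedron_halfspace_le)
  then have polyR: "polytope R" using R(2) polytope_eq_bounded_polyhedron by blast
  have "open (\<Inter> ((\<lambda>n. {x. n \<bullet> x < 1}) ` N))" using N(1) by (auto intro!: open_INT open_halfspace_lt)
  moreover have "\<Inter> ((\<lambda>n. {x. n \<bullet> x < 1}) ` N) \<subseteq> R" unfolding R(1) by (auto intro: less_imp_le)
  moreover have "0 \<in> \<Inter> ((\<lambda>n. {x. n \<bullet> x < 1}) ` N)" by simp
  ultimately have 0: "0 \<in> interior R" using interior_maximal by blast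
  have hullR: "convex hull R = R" using polytope_imp_convex[OF polyR] by (rule hull_same)
  have polyP: "polytope (convex hull (insert w R))" for w
  proof -
    obtain W where "finite W" "R = convex hull W" using polyR by (auto simp: polytope_def)
    then show ?thesis using hull_insert[of convex w W] polytope_convex_hull[of "insert w W"] by simp
  qed
  have 0: "0 \<in> interior (convex hull (insert w R))" for w
  proof -
    have "R \<subseteq> convex hull (insert w R)" using hull_subset[of "insert w R" convex] by blast
    then show ?thesis using 0 interior_mono by blast
  qed
  have fin0: "finite (insert 0 N)" using N(1) by simp
  have "polar (convex hull (insert 0 N)) = R" unfolding polar_convex_hull R(1) by auto
  then have polR: "polar R = convex hull (insert 0 N)"
    using bipolar[of "convex hull (insert 0 N)"] fin0 hull_inc[of 0 "insert 0 N" convex]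
      polytope_imp_closed[OF polytope_convex_hull[OF fin0]] by simp
  have polP: "polar (convex hull (insert w R)) = convex hull (insert 0 N) \<inter> {y. w \<bullet> y \<le> 1}" for w
    unfolding polar_truncation hullR polR ..
  have vt: "vertex_truncation (insert 0 N) n0 w 1" if "w \<in> {w1, w2}" for w
  proof
    show "finite (insert 0 N)" "n0 \<in> insert 0 N" using N by auto
    show "1 < w \<bullet> n0" using w(1)[OF that] by (simp add: inner_commute)
    fix v assume v: "v \<in> insert 0 N"
    { assume "v \<noteq> n0"
      then show "w \<bullet> v \<le> 1" using v w(2)[OF that] by (auto simp: inner_commute) }
    fix v' assume "v' \<in> insert 0 N" "w \<bullet> v = 1" "w \<bullet> v' = 1"
    then show "v = v'" using v w(3)[OF that] by (auto simp: inner_commute)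
  qed
  have "dim_iso {F. F face_of convex hull (insert w1 R) \<and> aff_dim F \<le> int DIM('a) - 1 - 2}
    {F. F face_of convex hull (insert w2 R) \<and> aff_dim F \<le> int DIM('a) - 1 - 2}"
    by (rule polar_dim_iso[OF polyP 0 polyP 0])
      (unfold polP, rule truncations_high_iso; rule vt; blast)
  then show ?thesis by simp
qed

text \<open>Translate the strictly feasible point \<open>p\<close> to the origin and normalise all
  right hand sides to 1.\<close>

lemma stackings_low_iso:
  fixes R :: "'a::euclidean_space set"
  assumes A: "finite A" "(a0, b0) \<in> A" and R: "R = {x. \<forall>(a, b)\<in>A. a \<bullet> x \<le> b}" "bounded R"
    and p: "\<And>a b. (a, b) \<in> A \<Longrightarrow> a \<bullet> p < b"
    and w: "\<And>w. w \<in> {w1, w2} \<Longrightarrow> a0 \<bullet> w > b0"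
      "\<And>w a b. w \<in> {w1, w2} \<Longrightarrow> (a, b) \<in> A \<Longrightarrow> (a, b) \<noteq> (a0, b0) \<Longrightarrow> a \<bullet> w \<le> b"
      "\<And>w a b a' b'. w \<in> {w1, w2} \<Longrightarrow> (a, b) \<in> A \<Longrightarrow> (a', b') \<in> A \<Longrightarrow> a \<bullet> w = b \<Longrightarrow> a' \<bullet> w = b' \<Longrightarrow> (a, b) = (a', b')"
  shows "dim_iso {F. F face_of convex hull (insert w1 R) \<and> aff_dim F \<le> int DIM('a) - 3}
    {F. F face_of convex hull (insert w2 R) \<and> aff_dim F \<le> int DIM('a) - 3}"
proof -
  define nrm where "nrm = (\<lambda>(a, b). a /\<^sub>R (b - a \<bullet> p))"
  let ?N = "nrm ` A"
  let ?R = "(+) (- p) ` R"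
  have pos: "b - a \<bullet> p > 0" if "(a, b) \<in> A" for a b using p[OF that] by simp
  have key: "nrm (a, b) \<bullet> (x - p) \<le> 1 \<longleftrightarrow> a \<bullet> x \<le> b" "nrm (a, b) \<bullet> (x - p) = 1 \<longleftrightarrow> a \<bullet> x = b"
    "nrm (a, b) \<bullet> (x - p) > 1 \<longleftrightarrow> a \<bullet> x > b"
    if ab: "(a, b) \<in> A" for a b x
  proof -
    have eq: "nrm (a, b) \<bullet> (x - p) = (a \<bullet> x - a \<bullet> p) / (b - a \<bullet> p)"
      by (simp add: nrm_def inner_diff_right divide_inverse algebra_simps)
    show "nrm (a, b) \<bullet> (x - p) \<le> 1 \<longleftrightarrow> a \<bullet> x \<le> b" "nrm (a, b) \<bullet> (x - p) = 1 \<longleftrightarrow> a \<bullet> x = b"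
      "nrm (a, b) \<bullet> (x - p) > 1 \<longleftrightarrow> a \<bullet> x > b"
      unfolding eq pos_divide_le_eq[OF pos[OF ab]] pos_less_divide_eq[OF pos[OF ab]]
        nonzero_divide_eq_eq[OF less_imp_neq[OF pos[OF ab], symmetric]] by auto
  qed
  have inR: "x \<in> ?R \<longleftrightarrow> x + p \<in> R" for x by (auto simp: image_iff algebra_simps)
  have R': "?R = {x. \<forall>n\<in>?N. n \<bullet> x \<le> 1}"
  proof (intro set_eqI)
    fix x
    have "x + p \<in> R \<longleftrightarrow> (\<forall>(a, b)\<in>A. a \<bullet> (x + p) \<le> b)" by (subst R(1)) simp
    then have "x \<in> ?R \<longleftrightarrow> (\<forall>(a, b)\<in>A. a \<bullet> (x + p) \<le> b)" using inR[of x] by blast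
    also have "\<dots> \<longleftrightarrow> (\<forall>i\<in>A. nrm i \<bullet> x \<le> 1)" using key(1)[of _ _ "x + p"] by fastforce
    finally show "x \<in> ?R \<longleftrightarrow> x \<in> {x. \<forall>n\<in>?N. n \<bullet> x \<le> 1}" by simp
  qed
  have hull: "convex hull (insert (w - p) ?R) = (+) (- p) ` (convex hull (insert w R))" for w
    using convex_hull_translation[of "- p" "insert w R"] by simp
  have "dim_iso {F. F face_of convex hull (insert (w1 - p) ?R) \<and> aff_dim F \<le> int DIM('a) - 3}
    {F. F face_of convex hull (insert (w2 - p) ?R) \<and> aff_dim F \<le> int DIM('a) - 3}"
  proof (rule centred_stackings_low_iso[OF _ _ R', of "nrm (a0, b0)"])
    show "finite ?N" "nrm (a0, b0) \<in> ?N" using A by auto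
    show "bounded ?R" using R(2) bounded_translation by blast
    fix w assume "w \<in> {w1 - p, w2 - p}"
    then obtain w' where w': "w' \<in> {w1, w2}" "w = w' - p" by blast
    show "nrm (a0, b0) \<bullet> w > 1" using w(1)[OF w'(1)] key(3)[OF A(2)] w'(2) by simp
    { fix n assume n: "n \<in> ?N" "n \<noteq> nrm (a0, b0)"
      then obtain a b where ab: "(a, b) \<in> A" "n = nrm (a, b)" by auto
      then have "(a, b) \<noteq> (a0, b0)" using n(2) by auto
      then show "n \<bullet> w \<le> 1" using w(2)[OF w'(1) ab(1)] key(1)[OF ab(1)] ab(2) w'(2) by simp }
    fix n n' assume n: "n \<in> ?N" "n' \<in> ?N" "n \<bullet> w = 1" "n' \<bullet> w = 1"
    obtain a b where ab: "(a, b) \<in> A" "n = nrm (a, b)" using n(1) by auto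
    obtain a' b' where ab': "(a', b') \<in> A" "n' = nrm (a', b')" using n(2) by auto
    have "a \<bullet> w' = b" "a' \<bullet> w' = b'" using n(3,4) key(2)[OF ab(1)] key(2)[OF ab'(1)] ab(2) ab'(2) w'(2) by auto
    then have "(a, b) = (a', b')" using w(3)[OF w'(1) ab(1) ab'(1)] by blast
    then show "n = n'" using ab ab' by simp
  qed
  then have mid: "dim_iso {F. F face_of (+) (- p) ` (convex hull (insert w1 R)) \<and> aff_dim F \<le> int DIM('a) - 3}
    {F. F face_of (+) (- p) ` (convex hull (insert w2 R)) \<and> aff_dim F \<le> int DIM('a) - 3}"
    unfolding hull .
  show ?thesis
    by (rule dim_iso_trans[OF dim_iso_translation[where p = "\<lambda>k. k \<le> int DIM('a) - 3"]
        dim_iso_trans[OF mid dim_iso_sym[OF dim_iso_translation[where p = "\<lambda>k. k \<le> int DIM('a) - 3"]]]])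
qed

section \<open>A simplex, stacked and cut\<close>

lemma inner_One: "One \<bullet> x = (\<Sum>b\<in>Basis. x \<bullet> b)"
  unfolding inner_sum_left by (intro sum.cong) (auto simp: inner_commute)

text \<open>In dimension at least 3, seen from the simplex spanned by \<open>0\<close> and the
  basis vectors, this point lies beyond the facet opposite to \<open>0\<close> only, and in the
  hyperplane of the facet opposite to \<open>q\<close>.\<close>

definition stack_point :: "'a::euclidean_space \<Rightarrow> 'a" where
  "stack_point q = One - q"

text \<open>The hyperplane with this normal at height 1 has \<open>0\<close> on one side, passes
  through \<open>r\<close>, has the other basis vectors on the other side and bisects the edges from
  \<open>0\<close> to the other basis vectors.\<close>

definition cut_normal :: "'a::euclidean_space \<Rightarrow> 'a" where
  "cut_normal r = 2 *\<^sub>R One - r"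

text \<open>The simplex stacked beyond the facet opposite to the vertex \<open>0\<close> and cut
  at that vertex. As the two operations take place at opposite ends of the simplex, they may be
  performed in either order: the definition stacks first and exhibits a truncation, while
  \<open>stacked_cut_eq_stacking\<close> cuts first and exhibits a stacking.\<close>

definition stacked_cut :: "'a::euclidean_space \<Rightarrow> 'a \<Rightarrow> 'a set" where
  "stacked_cut q r = convex hull (insert (stack_point q) (insert 0 Basis)) \<inter> {x. cut_normal r \<bullet> x \<ge> 1}"

definition cut_simplex :: "'a::euclidean_space \<Rightarrow> 'a set" where
  "cut_simplex r = {x. (\<forall>b\<in>Basis. 0 \<le> x \<bullet> b) \<and> One \<bullet> x \<le> 1 \<and> cut_normal r \<bullet> x \<ge> 1}"

lemma inner_stack_point: "b \<in> Basis \<Longrightarrow> q \<in> Basis \<Longrightarrow> stack_point q \<bullet> b = (if b = q then 0 else 1)"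
  by (simp add: stack_point_def inner_diff_left inner_sum_left_Basis inner_Basis)

lemma One_inner_Basis: "b \<in> Basis \<Longrightarrow> One \<bullet> b = (1::real)"
  by (simp add: inner_sum_left_Basis)

lemma One_One: "One \<bullet> (One :: 'a::euclidean_space) = real DIM('a)"
  unfolding inner_One[of One] using One_inner_Basis by simp

lemma One_stack_point: "q \<in> Basis \<Longrightarrow> One \<bullet> stack_point q = real DIM('a) - 1" for q :: "'a::euclidean_space"
  by (simp add: stack_point_def inner_diff_right One_inner_Basis One_One)

lemma cut_normal_Basis: "b \<in> Basis \<Longrightarrow> r \<in> Basis \<Longrightarrow> cut_normal r \<bullet> b = (if b = r then 1 else 2)"
  by (simp add: cut_normal_def inner_diff_left One_inner_Basis inner_Basis)

lemma cut_normal_inner: "cut_normal r \<bullet> x = 2 * (One \<bullet> x) - x \<bullet> r"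
  by (simp add: cut_normal_def inner_diff_left inner_commute[of r x])

lemma cut_normal_stack_point: "q \<in> Basis \<Longrightarrow> r \<in> Basis \<Longrightarrow> DIM('a) \<ge> 3 \<Longrightarrow> cut_normal r \<bullet> stack_point q > 1"
  for q :: "'a::euclidean_space"
  by (simp add: cut_normal_inner One_stack_point inner_stack_point)

lemma coordinate_le_One: 
  fixes x :: "'a::euclidean_space"
  assumes "\<And>b. b \<in> Basis \<Longrightarrow> 0 \<le> x \<bullet> b" "r \<in> Basis"
  shows "x \<bullet> r \<le> One \<bullet> x"
  unfolding inner_One using assms by (intro member_le_sum) auto

lemma std_simplex_One: "convex hull (insert 0 Basis) = {x::'a::euclidean_space. (\<forall>b\<in>Basis. 0 \<le> x \<bullet> b) \<and> One \<bullet> x \<le> 1}"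
  unfolding std_simplex inner_One by (simp add: inner_commute)

lemma stacked_cut_truncation:
  fixes q r :: "'a::euclidean_space"
  assumes q: "q \<in> Basis" and r: "r \<in> Basis" and d: "DIM('a) \<ge> 3"
  shows "vertex_truncation (insert (stack_point q) (insert 0 Basis)) 0 (- cut_normal r) (- 1)"
proof
  let ?V = "insert (stack_point q) (insert 0 (Basis::'a set))"
  show "finite ?V" "0 \<in> ?V" by auto
  show "- 1 < - cut_normal r \<bullet> 0" by simp
  fix v assume v: "v \<in> ?V"
  then show "- cut_normal r \<bullet> v \<le> - 1" if "v \<noteq> 0"
    using cut_normal_Basis[OF _ r, of v] cut_normal_stack_point[OF q r d] that by (auto split: if_splits)
  have eq: "v = r" if "v \<in> ?V" "- cut_normal r \<bullet> v = - 1" for v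
    using cut_normal_Basis[OF _ r, of v] cut_normal_stack_point[OF q r d] that by (auto split: if_splits)
  fix w assume "w \<in> ?V" "- cut_normal r \<bullet> v = - 1" "- cut_normal r \<bullet> w = - 1"
  then show "v = w" using eq v by metis
qed

lemma stacked_cut_eq_le: "stacked_cut q r = convex hull (insert (stack_point q) (insert 0 Basis)) \<inter> {x. (- cut_normal r) \<bullet> x \<le> - 1}"
  by (auto simp: stacked_cut_def)

lemma stacked_cut_high_iso:
  fixes q r r' :: "'a::euclidean_space"
  assumes "q \<in> Basis" "r \<in> Basis" "r' \<in> Basis" "DIM('a) \<ge> 3"
  shows "dim_iso {F. F face_of stacked_cut q r \<and> 2 \<le> aff_dim F} {F. F face_of stacked_cut q r' \<and> 2 \<le> aff_dim F}"
  unfolding stacked_cut_eq_le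
  by (rule truncations_high_iso[OF stacked_cut_truncation stacked_cut_truncation]) (use assms in auto)

text \<open>Points of the stacked simplex beyond the facet opposite to \<open>0\<close> lie on
  segments from the new point to this facet, and the facet is not affected by the cut.\<close>

lemma stacked_cut_eq_stacking:
  fixes q r :: "'a::euclidean_space"
  assumes q: "q \<in> Basis" and r: "r \<in> Basis" and d: "DIM('a) \<ge> 3"
  shows "stacked_cut q r = convex hull (insert (stack_point q) (cut_simplex r))"
proof
  let ?D = "convex hull (insert 0 (Basis :: 'a set))"
  have hull: "convex hull (insert (stack_point q) (insert 0 Basis)) = convex hull (insert (stack_point q) ?D)"
    by (simp add: hull_insert[of convex "stack_point q" "insert 0 Basis", symmetric])
  have cs: "cut_simplex r = ?D \<inter> {x. cut_normal r \<bullet> x \<ge> 1}"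
    unfolding std_simplex_One cut_simplex_def by auto
  show "convex hull (insert (stack_point q) (cut_simplex r)) \<subseteq> stacked_cut q r"
  proof (rule hull_minimal)
    show "convex (stacked_cut q r)" unfolding stacked_cut_def
      by (intro convex_Int convex_convex_hull convex_halfspace_ge)
    show "insert (stack_point q) (cut_simplex r) \<subseteq> stacked_cut q r"
      unfolding stacked_cut_def cs hull
      using cut_normal_stack_point[OF q r d] hull_subset[of "insert (stack_point q) ?D" convex] by auto
  qed
  show "stacked_cut q r \<subseteq> convex hull (insert (stack_point q) (cut_simplex r))"
  proof
    fix x assume x: "x \<in> stacked_cut q r"
    then have xb: "cut_normal r \<bullet> x \<ge> 1" and "x \<in> convex hull (insert (stack_point q) ?D)"
      unfolding stacked_cut_def hull by auto
    then obtain u v y where uv: "0 \<le> u" "0 \<le> v" "u + v = 1" "y \<in> ?D" "x = u *\<^sub>R stack_point q + v *\<^sub>R y"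
      using convex_hull_insert[of ?D "stack_point q"] by auto
    have y: "\<And>b. b \<in> Basis \<Longrightarrow> 0 \<le> y \<bullet> b" "One \<bullet> y \<le> 1" using uv(4) unfolding std_simplex_One by auto
    have xc: "x \<bullet> b = u * (if b = q then 0 else 1) + v * (y \<bullet> b)" if "b \<in> Basis" for b
      unfolding uv(5) by (simp add: inner_add_left inner_stack_point[OF that q])
    have xO: "One \<bullet> x = u * (real DIM('a) - 1) + v * (One \<bullet> y)"
      unfolding uv(5) by (simp add: inner_add_right One_stack_point[OF q])
    have x0: "0 \<le> x \<bullet> b" if "b \<in> Basis" for b using xc[OF that] uv(1,2) y(1)[OF that] by simp
    show "x \<in> convex hull (insert (stack_point q) (cut_simplex r))"
    proof (cases "One \<bullet> x \<le> 1")
      case True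
      then have "x \<in> cut_simplex r" using x0 xb by (simp add: cut_simplex_def)
      then show ?thesis by (simp add: hull_inc)
    next
      case False
      \<comment> \<open>\<open>s\<close> is the weight of the stacked point when \<open>x\<close> is written as a combination of it and a point
        of the facet opposite to \<open>0\<close>\<close>
      define s where "s = (One \<bullet> x - 1) / (real DIM('a) - 2)"
      have d2: "real DIM('a) - 2 > 0" using d by simp
      have s0: "0 \<le> s" using False d2 by (simp add: s_def)
      have "One \<bullet> x - 1 \<le> u * (real DIM('a) - 2)"
      proof -
        have "v * (One \<bullet> y) \<le> v" using y(2) uv(2) by (simp add: mult_left_le)
        then show ?thesis unfolding xO using uv(3) by (simp add: algebra_simps)
      qed
      then have su: "s \<le> u" using d2 by (simp add: s_def pos_divide_le_eq)
      define y' where "y' = x - s *\<^sub>R stack_point q"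
      have y'0: "0 \<le> y' \<bullet> b" if "b \<in> Basis" for b
        using su mult_nonneg_nonneg[OF uv(2) y(1)[OF that]] inner_stack_point[OF that q] xc[OF that]
        by (cases "b = q") (simp_all add: y'_def inner_diff_left)
      have y'O: "One \<bullet> y' = 1 - s"
        using d2 by (simp add: y'_def inner_diff_right One_stack_point[OF q] s_def field_simps)
      show ?thesis
      proof (cases "s = 1")
        case True
        then have "u = 1" "v = 0" using su uv by auto
        then show ?thesis using uv(5) by (simp add: hull_inc)
      next
        case False
        then have s1: "s < 1" using su uv by auto
        define y'' where "y'' = y' /\<^sub>R (1 - s)"
        have y''0: "0 \<le> y'' \<bullet> b" if "b \<in> Basis" for b
          using y'0[OF that] s1 by (simp add: y''_def)
        have y''O: "One \<bullet> y'' = 1" using y'O s1 by (simp add: y''_def)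
        have "y'' \<bullet> r \<le> 1" using coordinate_le_One[OF y''0 r] y''O by simp
        then have "y'' \<in> cut_simplex r" using y''0 y''O by (simp add: cut_simplex_def cut_normal_inner)
        then have mem: "stack_point q \<in> convex hull (insert (stack_point q) (cut_simplex r))"
          "y'' \<in> convex hull (insert (stack_point q) (cut_simplex r))" by (auto simp: hull_inc)
        have "x = s *\<^sub>R stack_point q + (1 - s) *\<^sub>R y''" using s1 by (simp add: y''_def y'_def)
        then show ?thesis
          using convexD[OF convex_convex_hull mem s0, of "1 - s"] s1 by simp
      qed
    qed
  qed
qed

definition simplex_constraints :: "'a::euclidean_space \<Rightarrow> ('a \<times> real) set" where
  "simplex_constraints r = insert (One, 1) (insert (- cut_normal r, - 1) ((\<lambda>b. (- b, 0)) ` Basis))"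

lemma cut_simplex_eq: "cut_simplex r = {x. \<forall>(a, b)\<in>simplex_constraints r. a \<bullet> x \<le> b}"
  by (auto simp: cut_simplex_def simplex_constraints_def inner_commute)

lemma bounded_cut_simplex: "bounded (cut_simplex (r::'a::euclidean_space))"
proof (rule bounded_subset)
  show "bounded (convex hull (insert 0 (Basis::'a set)))"
    by (intro bounded_convex_hull finite_imp_bounded) simp
  show "cut_simplex r \<subseteq> convex hull (insert 0 Basis)" unfolding std_simplex_One by (auto simp: cut_simplex_def)
qed

text \<open>For \<open>d \<ge> 3\<close> the factor places this point strictly between the
  hyperplanes \<open>One \<bullet> x = 1\<close> and
  \<open>cut_normal r \<bullet> x = 1\<close>: its coordinates are all equal with sum
  \<open>d / (2 * d - 2)\<close>.\<close>

definition centre :: "'a::euclidean_space" where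
  "centre = (1 / (2 * real DIM('a) - 2)) *\<^sub>R One"

lemma centre_strict:
  fixes r :: "'a::euclidean_space"
  assumes r: "r \<in> Basis" and d: "DIM('a) \<ge> 3" and ab: "(a, b) \<in> simplex_constraints r"
  shows "a \<bullet> centre < b"
proof -
  have d': "real DIM('a) \<ge> 3" using d by simp
  have O: "One \<bullet> (centre :: 'a) = real DIM('a) / (2 * real DIM('a) - 2)"
    by (simp add: centre_def One_One)
  have b: "b \<bullet> (centre :: 'a) = 1 / (2 * real DIM('a) - 2)" if "b \<in> Basis" for b
    using One_inner_Basis[OF that] by (simp add: centre_def inner_commute)
  have "centre \<bullet> r = 1 / (2 * real DIM('a) - 2)" using b[OF r] by (simp only: inner_commute)
  then have "cut_normal r \<bullet> centre > 1"
    unfolding cut_normal_inner O using d' by (simp add: field_simps)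
  moreover have "One \<bullet> (centre :: 'a) < 1" using d' unfolding O by (simp add: field_simps)
  moreover have "b \<bullet> (centre :: 'a) > 0" if "b \<in> Basis" for b using b[OF that] d' by simp
  ultimately show ?thesis using ab by (auto simp: simplex_constraints_def)
qed

lemma stacked_cut_low_iso_stack_point:
  fixes q q' r :: "'a::euclidean_space"
  assumes q: "q \<in> Basis" "q' \<in> Basis" and r: "r \<in> Basis" and d: "DIM('a) \<ge> 3"
  shows "dim_iso {F. F face_of stacked_cut q r \<and> aff_dim F \<le> int DIM('a) - 3}
    {F. F face_of stacked_cut q' r \<and> aff_dim F \<le> int DIM('a) - 3}"
  unfolding stacked_cut_eq_stacking[OF q(1) r d] stacked_cut_eq_stacking[OF q(2) r d]
proof (rule stackings_low_iso[OF _ _ cut_simplex_eq bounded_cut_simplex centre_strict[OF r d], where ?a0.0 = One and ?b0.0 = 1])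
  show "finite (simplex_constraints r)" "(One, 1) \<in> simplex_constraints r" by (auto simp: simplex_constraints_def)
  have key: "One \<bullet> stack_point p > 1" "- cut_normal r \<bullet> stack_point p < - 1"
    "\<And>b. b \<in> Basis \<Longrightarrow> - b \<bullet> stack_point p = (if b = p then 0 else - 1)" if "p \<in> Basis" for p :: 'a
    using d One_stack_point[OF that] cut_normal_stack_point[OF that r d] inner_stack_point[OF _ that] by (auto simp: inner_commute)
  fix w assume "w \<in> {stack_point q, stack_point q'}"
  then obtain p where p: "p \<in> Basis" "w = stack_point p" using q by blast
  show "1 < One \<bullet> w" using key(1)[OF p(1)] p(2) by simp
  fix a b assume ab: "(a, b) \<in> simplex_constraints r"
  { assume "(a, b) \<noteq> (One, 1)"
    then show "a \<bullet> w \<le> b" using ab key[OF p(1)] p(2) by (auto simp: simplex_constraints_def split: if_splits) }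
  have tight: "(a, b) = (- p, 0)" if "(a, b) \<in> simplex_constraints r" "a \<bullet> w = b" for a b
    using that key[OF p(1)] p(2) by (auto simp: simplex_constraints_def split: if_splits)
  fix a' b' assume "(a', b') \<in> simplex_constraints r" "a \<bullet> w = b" "a' \<bullet> w = b'"
  then show "(a, b) = (a', b')" using tight ab by metis
qed

text \<open>The map \<open>f\<close> is the reflection that exchanges \<open>q\<close> and
  \<open>r\<close> and fixes all other basis vectors.\<close>

lemma swap_reflection:
  fixes q r :: "'a::euclidean_space"
  assumes q: "q \<in> Basis" and r: "r \<in> Basis" and ne: "q \<noteq> r"
  defines "f \<equiv> \<lambda>x. x - (x \<bullet> (q - r)) *\<^sub>R (q - r)"
  shows "linear f" "inj f" "f ` stacked_cut r q = stacked_cut q r"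
proof -
  have f_Basis: "f b = (if b = q then r else if b = r then q else b)" if b: "b \<in> Basis" for b
    using q r b ne by (simp add: f_def inner_diff_right inner_Basis)
  show lin: "linear f" unfolding f_def
    by (rule linearI) (simp_all add: inner_add_left algebra_simps)
  have qr: "(q - r) \<bullet> (q - r) = 2" using q r ne by (simp add: inner_diff_left inner_diff_right inner_Basis)
  have ff: "f (f x) = x" for x
  proof -
    define e where "e = q - r"
    have "(x - (x \<bullet> e) *\<^sub>R e) \<bullet> e = - (x \<bullet> e)"
      using qr by (simp add: e_def[symmetric] inner_diff_left)
    then show ?thesis unfolding f_def e_def[symmetric] by simp
  qed
  show inj: "inj f" using ff by (metis injI)
  have fB: "f ` Basis = Basis"
    using f_Basis q r ne by (auto simp: image_iff)
  have "f One = One"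
    unfolding f_def using One_inner_Basis[OF q] One_inner_Basis[OF r] by (simp add: inner_diff_right)
  then have fa: "f (stack_point r) = stack_point q"
    unfolding stack_point_def linear_diff[OF lin] using f_Basis[OF r] ne by simp
  have f0: "f 0 = 0" by (simp add: f_def)
  have hull: "f ` (convex hull (insert (stack_point r) (insert 0 Basis))) = convex hull (insert (stack_point q) (insert 0 Basis))"
    unfolding convex_hull_linear_image[OF lin] by (simp add: fa f0 fB)
  have cn: "cut_normal r \<bullet> f x = cut_normal q \<bullet> x" for x
  proof -
    have "One \<bullet> f x = One \<bullet> x"
      using One_inner_Basis[OF q] One_inner_Basis[OF r] by (simp add: f_def inner_diff_right)
    moreover have "f x \<bullet> r = x \<bullet> q"
      using q r ne by (simp add: f_def inner_diff_left inner_diff_right inner_Basis)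
    ultimately show ?thesis by (simp add: cut_normal_inner)
  qed
  show "f ` stacked_cut r q = stacked_cut q r"
  proof (intro equalityI subsetI)
    fix y assume "y \<in> f ` stacked_cut r q"
    then obtain x where x: "x \<in> convex hull (insert (stack_point r) (insert 0 Basis))" "cut_normal q \<bullet> x \<ge> 1" "y = f x"
      by (auto simp: stacked_cut_def)
    then show "y \<in> stacked_cut q r" using hull cn[of x] by (auto simp: stacked_cut_def)
  next
    fix y assume "y \<in> stacked_cut q r"
    then have y: "y \<in> convex hull (insert (stack_point q) (insert 0 Basis))" "cut_normal r \<bullet> y \<ge> 1" by (auto simp: stacked_cut_def)
    then obtain x where x: "x \<in> convex hull (insert (stack_point r) (insert 0 Basis))" "y = f x" using hull by blast
    then show "y \<in> f ` stacked_cut r q" using y(2) cn[of x] by (auto simp: stacked_cut_def)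
  qed
qed

text \<open>Moving the stacked point relates \<open>(q, q)\<close> to \<open>(r, q)\<close>, and
  exchanging the two coordinates leads to \<open>(q, r)\<close>.\<close>

lemma stacked_cut_low_iso:
  fixes q r :: "'a::euclidean_space"
  assumes q: "q \<in> Basis" and r: "r \<in> Basis" and ne: "q \<noteq> r" and d: "DIM('a) \<ge> 3"
  shows "dim_iso {F. F face_of stacked_cut q q \<and> aff_dim F \<le> int DIM('a) - 3}
    {F. F face_of stacked_cut q r \<and> aff_dim F \<le> int DIM('a) - 3}"
proof -
  let ?f = "\<lambda>x. x - (x \<bullet> (q - r)) *\<^sub>R (q - r)"
  note f = swap_reflection[OF q r ne]
  have "dim_iso {F. F face_of stacked_cut r q \<and> aff_dim F \<le> int DIM('a) - 3}
    {F. F face_of ?f ` stacked_cut r q \<and> aff_dim F \<le> int DIM('a) - 3}"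
    by (rule dim_iso_linear_image[OF f(1,2), where p = "\<lambda>k. k \<le> int DIM('a) - 3"])
  then show ?thesis
    unfolding f(3) by (rule dim_iso_trans[OF stacked_cut_low_iso_stack_point[OF q r q d]])
qed

lemma polytope_stacked_cut: "polytope (stacked_cut q (r::'a::euclidean_space))"
  unfolding stacked_cut_def
  by (intro polytope_Int_polyhedron polytope_convex_hull polyhedron_halfspace_ge) simp

lemma full_dim_stacked_cut:
  fixes q r :: "'a::euclidean_space"
  assumes q: "q \<in> Basis" and r: "r \<in> Basis" and d: "DIM('a) \<ge> 3"
  shows "full_dim_polytope (stacked_cut q r)"
proof -
  have "polytope (stacked_cut q r)" by (rule polytope_stacked_cut)
  moreover have "affine hull (stacked_cut q r) = UNIV"
  proof -
    let ?U = "\<Inter>i\<in>simplex_constraints r. {x. fst i \<bullet> x < snd i}"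
    have "finite (simplex_constraints r)" by (simp add: simplex_constraints_def)
    then have "open ?U" by (rule open_INT) (simp add: open_halfspace_lt)
    moreover have "?U \<subseteq> cut_simplex r"
    proof
      fix x assume x: "x \<in> ?U"
      have "\<forall>i\<in>simplex_constraints r. fst i \<bullet> x \<le> snd i"
      proof
        fix i assume "i \<in> simplex_constraints r"
        then have "fst i \<bullet> x < snd i" using x by blast
        then show "fst i \<bullet> x \<le> snd i" by simp
      qed
      then show "x \<in> cut_simplex r" unfolding cut_simplex_eq case_prod_beta by blast
    qed
    moreover have "centre \<in> ?U"
    proof
      fix i assume "i \<in> simplex_constraints r"
      then show "centre \<in> {x. fst i \<bullet> x < snd i}" using centre_strict[OF r d, of "fst i" "snd i"] by simp
    qed
    ultimately have "interior (cut_simplex r) \<noteq> {}" using interior_maximal by blast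
    moreover have "cut_simplex r \<subseteq> stacked_cut q r"
      unfolding stacked_cut_eq_stacking[OF assms] using hull_subset[of "insert (stack_point q) (cut_simplex r)" convex] by blast
    ultimately have "interior (stacked_cut q r) \<noteq> {}" using interior_mono by blast
    then show ?thesis using aff_dim_nonempty_interior[of "stacked_cut q r"] aff_dim_eq_full by blast
  qed
  ultimately show ?thesis by (simp add: full_dim_polytope_def)
qed

text \<open>For \<open>q = r\<close> the stacked simplex is a pyramid with apex
  \<open>q\<close> over its section by the hyperplane \<open>q \<bullet> x = 0\<close>, and the
  cut passes through the apex, so it preserves the pyramid.\<close>

lemma stacked_cut_pyramid:
  fixes q :: "'a::euclidean_space"
  assumes q: "q \<in> Basis" and d: "DIM('a) \<ge> 3"
  shows "(stacked_cut q q \<inter> {x. q \<bullet> x = 0}) face_of stacked_cut q q" "stacked_cut q q \<inter> {x. q \<bullet> x = 0} \<noteq> stacked_cut q q"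
    "\<And>v. v extreme_point_of stacked_cut q q \<Longrightarrow> v \<noteq> q \<Longrightarrow> q \<bullet> v = 0"
proof -
  let ?B = "insert (stack_point q) (insert 0 (Basis - {q}))"
  have ins: "insert (stack_point q) (insert 0 Basis) = insert q ?B" using q by auto
  have B0: "q \<bullet> x = 0" if "x \<in> convex hull ?B" for x
  proof -
    have "convex hull ?B \<subseteq> {x. q \<bullet> x = 0}"
      by (intro hull_minimal convex_hyperplane)
        (use q inner_stack_point[OF q q] in \<open>auto simp: inner_Basis inner_commute\<close>)
    then show ?thesis using that by blast
  qed
  have decomp: "\<exists>u v y. 0 \<le> u \<and> 0 \<le> v \<and> u + v = 1 \<and> y \<in> convex hull ?B \<and> x = u *\<^sub>R q + v *\<^sub>R y"
    if "x \<in> stacked_cut q q" for x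
    using that convex_hull_insert[of ?B q] unfolding stacked_cut_def ins by auto
  have qP: "q \<in> stacked_cut q q"
    using q cut_normal_Basis[OF q q] by (simp add: stacked_cut_def hull_inc)
  have qq: "q \<bullet> q = 1" using q by simp
  show "(stacked_cut q q \<inter> {x. q \<bullet> x = 0}) face_of stacked_cut q q"
  proof (rule face_of_Int_supporting_hyperplane_ge[OF polytope_imp_convex[OF polytope_stacked_cut]])
    fix x assume "x \<in> stacked_cut q q"
    then obtain u v y where "0 \<le> u" "y \<in> convex hull ?B" "x = u *\<^sub>R q + v *\<^sub>R y" using decomp by blast
    then show "q \<bullet> x \<ge> 0" using B0[of y] qq by (simp add: inner_add_right)
  qed
  show "stacked_cut q q \<inter> {x. q \<bullet> x = 0} \<noteq> stacked_cut q q" using qP qq by force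
  fix x assume x: "x extreme_point_of stacked_cut q q" "x \<noteq> q"
  then have xP: "x \<in> stacked_cut q q" by (simp add: extreme_point_of_def)
  then obtain u v y where uv: "0 \<le> u" "0 \<le> v" "u + v = 1" "y \<in> convex hull ?B" "x = u *\<^sub>R q + v *\<^sub>R y"
    using decomp by blast
  have "v \<noteq> 0" using uv x(2) by auto
  have "u = 0"
  proof (rule ccontr)
    assume "u \<noteq> 0"
    \<comment> \<open>otherwise \<open>x\<close> is inside the segment from \<open>q\<close> to \<open>y\<close>; as \<open>q\<close> is on the cutting hyperplane
      and \<open>x\<close> is kept, \<open>y\<close> is kept as well\<close>
    have "cut_normal q \<bullet> x = u + v * (cut_normal q \<bullet> y)"
      using cut_normal_Basis[OF q q] by (simp add: uv(5) inner_add_right)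
    moreover have "cut_normal q \<bullet> x \<ge> 1" using xP by (simp add: stacked_cut_def)
    ultimately have "v * (cut_normal q \<bullet> y) \<ge> v * 1" using uv(3) by simp
    then have "cut_normal q \<bullet> y \<ge> 1" using uv(2) \<open>v \<noteq> 0\<close> by simp
    moreover have "y \<in> convex hull (insert q ?B)" using uv(4) hull_mono[of ?B "insert q ?B" convex] by blast
    ultimately have yP: "y \<in> stacked_cut q q" by (simp add: stacked_cut_def ins)
    have "q \<noteq> y" using B0[OF uv(4)] qq by auto
    moreover have "u = 1 - v" using uv(3) by simp
    then have "x = (1 - v) *\<^sub>R q + v *\<^sub>R y" "0 < v" "v < 1"
      using uv \<open>u \<noteq> 0\<close> \<open>v \<noteq> 0\<close> by auto
    ultimately have "x \<in> open_segment q y" unfolding in_segment by blast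
    then show False using x(1) qP yP by (auto simp: extreme_point_of_def)
  qed
  then show "q \<bullet> x = 0" using uv B0[OF uv(4)] by simp
qed

text \<open>In a segment from \<open>v\<close> to a point of the hull of the other points, the
  functional reaches its maximum at \<open>v\<close> only.\<close>

lemma extreme_point_of_hull_unique_max:
  fixes V :: "'a::euclidean_space set"
  assumes "v \<in> V" and max: "\<And>u. u \<in> V \<Longrightarrow> u \<noteq> v \<Longrightarrow> g \<bullet> u < g \<bullet> v"
  shows "v extreme_point_of convex hull V"
proof -
  have le: "convex hull V \<subseteq> {x. g \<bullet> x \<le> g \<bullet> v}"
    by (intro hull_minimal convex_halfspace_le) (use max in force)
  have ins: "V = insert v (V - {v})" using assms(1) by auto
  have "x = v" if x: "x \<in> convex hull V" "g \<bullet> x = g \<bullet> v" for x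
  proof (cases "V - {v} = {}")
    case True
    then have "V = {v}" using assms(1) by auto
    then show ?thesis using x by simp
  next
    case False
    then obtain a b y where ab: "0 \<le> a" "0 \<le> b" "a + b = 1" "y \<in> convex hull (V - {v})" "x = a *\<^sub>R v + b *\<^sub>R y"
      using x(1) convex_hull_insert[OF False, of v] ins by auto
    have "convex hull (V - {v}) \<subseteq> {x. g \<bullet> x < g \<bullet> v}"
      by (intro hull_minimal convex_halfspace_lt) (use max in auto)
    then have "g \<bullet> y < g \<bullet> v" using ab(4) by blast
    moreover have "b * (g \<bullet> y) = b * (g \<bullet> v)"
    proof -
      have "a = 1 - b" using ab(3) by simp
      then have "(1 - b) * (g \<bullet> v) + b * (g \<bullet> y) = g \<bullet> v"
        using x(2) unfolding ab(5) inner_add_right by simp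
      then show ?thesis unfolding left_diff_distrib by linarith
    qed
    ultimately have "b = 0" by simp
    then show ?thesis using ab by simp
  qed
  then have "convex hull V \<inter> {x. g \<bullet> x = g \<bullet> v} = {v}" using assms(1) hull_inc[of v V convex] by blast
  then show ?thesis using extreme_point_of_Int_supporting_hyperplane_le[of "convex hull V" g "g \<bullet> v" v] le by blast
qed

lemma extreme_point_of_subset: "v extreme_point_of S \<Longrightarrow> T \<subseteq> S \<Longrightarrow> v \<in> T \<Longrightarrow> v extreme_point_of T"
  by (auto simp: extreme_point_of_def)

text \<open>The stacked point, the basis vectors, and the midpoints at which the cut meets the
  edges from \<open>0\<close>.\<close>

definition stacked_cut_vertices :: "'a::euclidean_space \<Rightarrow> 'a \<Rightarrow> 'a set" where
  "stacked_cut_vertices q r = insert (stack_point q) (Basis \<union> (\<lambda>b. (1/2) *\<^sub>R b) ` (Basis - {r}))"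

text \<open>The stacked point and the basis vectors are vertices even before cutting. The midpoint
  of the edge to \<open>b\<close> is the only point of the polytope that lies on the cutting
  hyperplane and has no nonzero coordinates other than \<open>b\<close>.\<close>

lemma stacked_cut_vertices_extreme:
  fixes q r :: "'a::euclidean_space"
  assumes q: "q \<in> Basis" and r: "r \<in> Basis" and d: "DIM('a) \<ge> 3" and v: "v \<in> stacked_cut_vertices q r"
  shows "v extreme_point_of stacked_cut q r"
proof -
  let ?V = "insert (stack_point q) (insert 0 (Basis::'a set))"
  have sub: "stacked_cut q r \<subseteq> convex hull ?V" by (simp add: stacked_cut_def)
  have d': "real DIM('a) \<ge> 3" using d by simp
  consider "v = stack_point q" | "v \<in> Basis" | b where "b \<in> Basis" "b \<noteq> r" "v = (1/2) *\<^sub>R b"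
    using v by (auto simp: stacked_cut_vertices_def)
  then show ?thesis
  proof cases
    case 1
    have "stack_point q extreme_point_of convex hull ?V"
      by (rule extreme_point_of_hull_unique_max[of _ _ One])
        (use d' One_stack_point[OF q] One_inner_Basis in auto)
    moreover have "stack_point q \<in> stacked_cut q r"
      using cut_normal_stack_point[OF q r d] by (simp add: stacked_cut_def hull_inc)
    ultimately show ?thesis using extreme_point_of_subset sub 1 by blast
  next
    case 2
    have "v extreme_point_of convex hull ?V"
    proof (rule extreme_point_of_hull_unique_max[of _ _ "real DIM('a) *\<^sub>R v - One"])
      \<comment> \<open>the factor outweighs the coordinate 1 that the stacked point may have in direction \<open>v\<close>\<close>
      show "v \<in> ?V" using 2 by simp
      fix u assume u: "u \<in> ?V" "u \<noteq> v"
      have "(real DIM('a) *\<^sub>R v - One) \<bullet> v = real DIM('a) - 1"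
        using 2 One_inner_Basis[OF 2] by (simp add: inner_diff_left)
      moreover have "(real DIM('a) *\<^sub>R v - One) \<bullet> u \<le> 1"
        using u 2 d' One_inner_Basis[of u] One_stack_point[OF q] inner_stack_point[OF 2 q]
        by (auto simp: inner_diff_left inner_Basis inner_commute[of v "stack_point q"])
      ultimately show "(real DIM('a) *\<^sub>R v - One) \<bullet> u < (real DIM('a) *\<^sub>R v - One) \<bullet> v" using d' by linarith
    qed
    moreover have "v \<in> stacked_cut q r"
      using cut_normal_Basis[OF 2 r] 2 by (simp add: stacked_cut_def hull_inc)
    ultimately show ?thesis using extreme_point_of_subset sub by blast
  next
    case 3
    \<comment> \<open>at least 1 on the polytope, with equality only at the midpoint\<close>
    let ?g = "cut_normal r + (One - b)"
    have nonneg: "0 \<le> x \<bullet> c" if "x \<in> stacked_cut q r" "c \<in> Basis" for x c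
    proof -
      have "convex hull ?V \<subseteq> {x. c \<bullet> x \<ge> 0}"
        by (intro hull_minimal convex_halfspace_ge)
          (use that(2) inner_stack_point[OF that(2) q] in \<open>auto simp: inner_Basis inner_commute\<close>)
      then show ?thesis using that(1) sub by (auto simp: inner_commute)
    qed
    have rest: "(One - b) \<bullet> x = (\<Sum>c\<in>Basis - {b}. x \<bullet> c)" for x
      using sum.remove[OF finite_Basis 3(1), of "\<lambda>c. x \<bullet> c"]
      by (simp add: inner_diff_left inner_One inner_commute[of b x])
    have ge: "?g \<bullet> x \<ge> 1" if "x \<in> stacked_cut q r" for x
    proof -
      have "(One - b) \<bullet> x \<ge> 0" unfolding rest using nonneg[OF that] by (intro sum_nonneg) auto
      moreover have "cut_normal r \<bullet> x \<ge> 1" using that by (simp add: stacked_cut_def)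
      ultimately show ?thesis by (simp add: inner_add_left)
    qed
    have "v \<in> convex hull ?V"
      using convexD[OF convex_convex_hull, of b ?V 0 "1/2" "1/2"] 3 by (simp add: hull_inc)
    then have vE: "v \<in> stacked_cut q r"
      using cut_normal_Basis[OF 3(1) r] 3 by (simp add: stacked_cut_def)
    have "?g \<bullet> v = 1"
      using cut_normal_Basis[OF 3(1) r] 3 One_inner_Basis[OF 3(1)] by (simp add: inner_add_left inner_diff_left)
    moreover have "x = v" if x: "x \<in> stacked_cut q r" "?g \<bullet> x = 1" for x
    proof -
      have "(One - b) \<bullet> x \<ge> 0" unfolding rest using nonneg[OF x(1)] by (intro sum_nonneg) auto
      moreover have "cut_normal r \<bullet> x \<ge> 1" using x(1) by (simp add: stacked_cut_def)
      ultimately have eq: "(One - b) \<bullet> x = 0" "cut_normal r \<bullet> x = 1"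
        using x(2) unfolding inner_add_left by linarith+
      then have 0: "x \<bullet> c = 0" if "c \<in> Basis" "c \<noteq> b" for c
        using sum_nonneg_eq_0_iff[of "Basis - {b}" "\<lambda>c. x \<bullet> c"] nonneg[OF x(1)] that unfolding rest by auto
      have "One \<bullet> x = x \<bullet> b" using eq(1) by (simp add: inner_diff_left inner_commute[of b x])
      then have "x \<bullet> b = 1/2" using eq(2) 0[OF r] 3(2) by (simp add: cut_normal_inner)
      show "x = v"
      proof (rule euclidean_eqI)
        fix c :: 'a assume c: "c \<in> Basis"
        show "x \<bullet> c = v \<bullet> c"
          using 0[OF c] \<open>x \<bullet> b = 1/2\<close> c 3(1) by (cases "c = b") (simp_all add: 3(3) inner_Basis)
      qed
    qed
    ultimately have "stacked_cut q r \<inter> {x. ?g \<bullet> x = 1} = {v}" using vE by blast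
    then show ?thesis using extreme_point_of_Int_supporting_hyperplane_ge[of "stacked_cut q r" ?g 1 v] ge by blast
  qed
qed

lemma affine_containing_Basis:
  fixes A :: "'a::euclidean_space set"
  assumes "affine A" "0 \<in> A" "Basis \<subseteq> A"
  shows "A = UNIV"
proof -
  have "subspace A" using assms(1,2) subspace_affine by blast
  then have "span Basis \<subseteq> A" using assms(3) span_minimal by blast
  then show ?thesis using span_Basis by blast
qed

lemma other_Basis_element:
  assumes "DIM('a) \<ge> 3"
  obtains b :: "'a::euclidean_space" where "b \<in> Basis" "b \<noteq> r" "b \<noteq> c"
proof -
  have "card (Basis - {r, c} :: 'a set) \<ge> DIM('a) - card {r, c}" by (rule diff_card_le_card_Diff) simp
  moreover have "card {r, c} \<le> 2" by (simp add: card_insert_if)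
  ultimately have "card (Basis - {r, c} :: 'a set) \<noteq> 0" using assms by linarith
  then have "Basis - {r, c} \<noteq> ({} :: 'a set)" by (metis card.empty)
  then show ?thesis using that by blast
qed

text \<open>On the line through \<open>b\<close> and its half lies the origin: the vertex that was
  cut off is still visible in the affine dependencies.\<close>

lemma zero_in_affine:
  assumes "affine A" "b \<in> A" "(1/2) *\<^sub>R b \<in> A"
  shows "0 \<in> A"
  using mem_affine[OF assms(1,3,2), of 2 "-1"] by simp

text \<open>The tip of a pyramid lies outside the affine hull of the other vertices; here no
  vertex does. The cut edges \<open>b, b / 2\<close> with \<open>b \<noteq> r\<close> all point
  to \<open>0\<close>, and there are two of them, so each of these points depends on the others. The
  relation that expresses the stacked point by the basis vectors other than \<open>q\<close>
  involves \<open>r\<close>, which settles the stacked point and \<open>r\<close>.\<close>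

lemma stacked_cut_vertices_dependent:
  fixes q r :: "'a::euclidean_space"
  assumes q: "q \<in> Basis" and r: "r \<in> Basis" and ne: "q \<noteq> r" and d: "DIM('a) \<ge> 3"
    and v: "v \<in> stacked_cut_vertices q r"
  shows "v \<in> affine hull (stacked_cut_vertices q r - {v})"
proof -
  let ?A = "affine hull (stacked_cut_vertices q r - {v})"
  have aff: "affine ?A" by (rule affine_affine_hull)
  have inA: "x \<in> ?A" if "x \<in> stacked_cut_vertices q r" "x \<noteq> v" for x using that by (simp add: hull_inc)
  have O: "One \<bullet> b = (1::real)" "One \<bullet> ((1/2) *\<^sub>R b) = (1/2::real)" if "b \<in> Basis" for b :: 'a
    using One_inner_Basis[OF that] by simp_all
  have Oa: "One \<bullet> stack_point q \<ge> 2" using One_stack_point[OF q] d by simp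
  have E: "b \<in> stacked_cut_vertices q r" if "b \<in> Basis" for b using that by (simp add: stacked_cut_vertices_def)
  have E2: "(1/2) *\<^sub>R b \<in> stacked_cut_vertices q r" if "b \<in> Basis" "b \<noteq> r" for b
    using that by (simp add: stacked_cut_vertices_def)
  have Ea: "stack_point q \<in> stacked_cut_vertices q r" by (simp add: stacked_cut_vertices_def)
  have ne1: "b \<noteq> (1/2) *\<^sub>R c" if "b \<in> Basis" "c \<in> Basis" for b c :: 'a
  proof
    assume "b = (1/2) *\<^sub>R c"
    then have "One \<bullet> b = One \<bullet> ((1/2) *\<^sub>R c)" by (rule arg_cong)
    then show False using O(1)[OF that(1)] O(2)[OF that(2)] by linarith
  qed
  have ne2: "b \<noteq> stack_point q" "(1/2) *\<^sub>R b \<noteq> stack_point q" if b: "b \<in> Basis" for b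
  proof -
    have "One \<bullet> b < One \<bullet> stack_point q" "One \<bullet> ((1/2) *\<^sub>R b) < One \<bullet> stack_point q"
      using O[OF b] Oa by linarith+
    then show "b \<noteq> stack_point q" "(1/2) *\<^sub>R b \<noteq> stack_point q" using less_irrefl by metis+
  qed
  consider "v = stack_point q" | "v = r" | b where "b \<in> Basis" "b \<noteq> r" "v = b" | b where "b \<in> Basis" "b \<noteq> r" "v = (1/2) *\<^sub>R b"
    using v by (auto simp: stacked_cut_vertices_def)
  then show ?thesis
  proof cases
    case 1
    obtain b :: 'a where b: "b \<in> Basis" "b \<noteq> r" using other_Basis_element[OF d] by metis
    have "0 \<in> ?A"
      by (rule zero_in_affine[OF aff, of b]) (use inA E E2 b ne2 1 in auto)
    moreover have "Basis \<subseteq> ?A" using inA E ne2 1 by auto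
    ultimately show ?thesis using affine_containing_Basis[OF aff] by blast
  next
    case 2
    obtain b :: 'a where b: "b \<in> Basis" "b \<noteq> r" using other_Basis_element[OF d] by metis
    have "0 \<in> ?A"
      by (rule zero_in_affine[OF aff, of b]) (use inA[OF E[OF b(1)]] inA[OF E2[OF b]] ne1[OF r b(1)] b 2 in auto)
    then have sub: "subspace ?A" using aff subspace_affine by blast
    have "(\<Sum>c\<in>Basis - {q} - {r}. c) \<in> ?A"
      by (rule subspace_sum[OF sub]) (use inA E 2 in auto)
    moreover have "stack_point q \<in> ?A" using inA[OF Ea] ne2[OF r] 2 by auto
    ultimately have "stack_point q - (\<Sum>c\<in>Basis - {q} - {r}. c) \<in> ?A" by (rule subspace_diff[OF sub, rotated])
    moreover have "stack_point q = (\<Sum>c\<in>Basis - {q}. c)"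
      unfolding stack_point_def using sum.remove[OF finite_Basis q, of "\<lambda>c. c"] by simp
    moreover have "\<dots> = r + (\<Sum>c\<in>Basis - {q} - {r}. c)"
      using sum.remove[of "Basis - {q}" r "\<lambda>c. c"] r ne by simp
    ultimately show ?thesis using 2 by simp
  next
    case 3
    obtain c :: 'a where c: "c \<in> Basis" "c \<noteq> r" "c \<noteq> b" using other_Basis_element[OF d] by metis
    have "0 \<in> ?A"
      by (rule zero_in_affine[OF aff, of c]) (use inA[OF E[OF c(1)]] inA[OF E2[OF c(1,2)]] ne1[OF 3(1) c(1)] c 3 in auto)
    then have "subspace ?A" using aff subspace_affine by blast
    moreover have "(1/2) *\<^sub>R b \<in> ?A" using inA[OF E2[OF 3(1,2)]] ne1[OF 3(1) 3(1)] 3(3) by auto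
    ultimately have "2 *\<^sub>R ((1/2) *\<^sub>R b) \<in> ?A" by (rule subspace_scale)
    then show ?thesis using 3(3) by simp
  next
    case 4
    obtain c :: 'a where c: "c \<in> Basis" "c \<noteq> r" "c \<noteq> b" using other_Basis_element[OF d] by metis
    have "0 \<in> ?A"
      by (rule zero_in_affine[OF aff, of c]) (use inA[OF E[OF c(1)]] inA[OF E2[OF c(1,2)]] ne1[OF c(1) 4(1)] c 4 in auto)
    then have "subspace ?A" using aff subspace_affine by blast
    moreover have "b \<in> ?A" using inA[OF E[OF 4(1)]] ne1[OF 4(1) 4(1)] 4(3) by auto
    ultimately have "(1/2) *\<^sub>R b \<in> ?A" by (rule subspace_scale)
    then show ?thesis using 4(3) by simp
  qed
qed

lemma affine_hull_stacked_cut_vertices: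
  fixes q r :: "'a::euclidean_space"
  assumes "DIM('a) \<ge> 3"
  shows "affine hull stacked_cut_vertices q r = UNIV"
proof -
  obtain b :: 'a where b: "b \<in> Basis" "b \<noteq> r" using other_Basis_element[OF assms] by metis
  have "0 \<in> affine hull stacked_cut_vertices q r"
    by (rule zero_in_affine[of _ b]) (use b in \<open>auto simp: stacked_cut_vertices_def hull_inc\<close>)
  moreover have "Basis \<subseteq> affine hull stacked_cut_vertices q r"
    by (auto simp: stacked_cut_vertices_def hull_inc)
  ultimately show ?thesis by (intro affine_containing_Basis) auto
qed

text \<open>An isomorphism would carry the base of the pyramid to a proper face of the other
  polytope containing all vertices but at most one. As each vertex lies in the affine hull of the
  others, that face would contain all of them.\<close>

lemma stacked_cut_not_iso:
  fixes q r :: "'a::euclidean_space"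
  assumes q: "q \<in> Basis" and r: "r \<in> Basis" and ne: "q \<noteq> r" and d: "DIM('a) \<ge> 3"
  shows "\<not> dim_iso {F. F face_of stacked_cut q q} {F. F face_of stacked_cut q r}"
proof
  let ?P = "stacked_cut q q" and ?Q = "stacked_cut q r"
  assume "dim_iso {F. F face_of ?P} {F. F face_of ?Q}"
  then obtain f where f: "bij_betw f {F. F face_of ?P} {F. F face_of ?Q}"
    "\<forall>F\<in>{F. F face_of ?P}. \<forall>G\<in>{F. F face_of ?P}. F \<subseteq> G \<longleftrightarrow> f F \<subseteq> f G"
    "\<forall>F\<in>{F. F face_of ?P}. aff_dim (f F) = aff_dim F"
    by (rule dim_isoE)
  note pyr = stacked_cut_pyramid[OF q d]
  define g where "g = ?P \<inter> {x. q \<bullet> x = 0}"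
  have g: "g face_of ?P" "g \<noteq> ?P" using pyr(1,2) by (auto simp: g_def)
  have fg: "f g face_of ?Q" using bij_betwE[OF f(1)] g(1) by blast
  have "aff_dim g < aff_dim ?P"
    using face_of_aff_dim_lt[OF polytope_imp_convex[OF polytope_stacked_cut] g] .
  also have "\<dots> \<le> int DIM('a)" by (rule aff_dim_le_DIM)
  finally have dim: "aff_dim (f g) < int DIM('a)" using f(3) g(1) by simp
  have inG: "u \<in> f g" if u: "u extreme_point_of ?Q" "{u} \<noteq> f {q}" for u
  proof -
    have uf: "{u} \<in> {F. F face_of ?Q}" using u(1) by (simp add: face_of_singleton)
    then have "{u} \<in> f ` {F. F face_of ?P}" using bij_betw_imp_surj_on[OF f(1)] by simp
    then obtain F where F: "F face_of ?P" "f F = {u}" by auto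
    then have "aff_dim F = 0" using f(3)[rule_format, of F] by simp
    then obtain v where v: "v extreme_point_of ?P" "F = {v}" using vertex_face_iff F(1) by blast
    then have "v \<noteq> q" using u(2) F(2) by auto
    then have "F \<subseteq> g" using pyr(3)[OF v(1)] v by (auto simp: g_def extreme_point_of_def)
    then have "f F \<subseteq> f g" using f(2) F(1) g(1) by blast
    then show ?thesis using F(2) by blast
  qed
  have "stacked_cut_vertices q r \<subseteq> f g"
  proof
    fix a assume a: "a \<in> stacked_cut_vertices q r"
    note ext = stacked_cut_vertices_extreme[OF q r d]
    show "a \<in> f g"
    proof (cases "{a} = f {q}")
      case False then show ?thesis using inG ext a by blast
    next
      case True
      have "stacked_cut_vertices q r - {a} \<subseteq> f g"
      proof
        fix u assume u: "u \<in> stacked_cut_vertices q r - {a}"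
        then have "{u} \<noteq> f {q}" using True by auto
        then show "u \<in> f g" using inG ext u by blast
      qed
      then have "affine hull (stacked_cut_vertices q r - {a}) \<subseteq> affine hull f g" by (rule hull_mono)
      then have "a \<in> affine hull f g" using stacked_cut_vertices_dependent[OF q r ne d a] by blast
      moreover have "a \<in> ?Q" using ext[OF a] by (simp add: extreme_point_of_def)
      moreover have "f g = affine hull f g \<inter> ?Q"
        by (rule face_of_imp_eq_affine_Int[OF polytope_imp_convex[OF polytope_stacked_cut] fg])
      ultimately show ?thesis by blast
    qed
  qed
  then have "affine hull (f g) = UNIV" using affine_hull_stacked_cut_vertices[OF d, of q r] hull_mono by (metis top.extremum_uniqueI)
  then show False using dim aff_dim_eq_full[of "f g"] by simp
qed

section \<open>The characterisation\<close>

theorem theorem5p1: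
  fixes n :: nat and a b :: "nat \<Rightarrow> int"
  assumes "CARD('d::finite) \<ge> 4"
    and "\<And>i. i \<in> {1..n} \<Longrightarrow> 0 \<le> a i \<and> a i \<le> b i \<and> b i < int CARD('d)"
  shows "(\<forall>(P :: (real ^ 'd) set) (Q :: (real ^ 'd) set). full_dim_polytope P \<longrightarrow> full_dim_polytope Q \<longrightarrow>
             (\<forall>i\<in>{1..n}. skeleton (a i) (b i) P \<cong>\<^sub>p skeleton (a i) (b i) Q) \<longrightarrow>
             faces P \<cong>\<^sub>p faces Q)
         \<longleftrightarrow> (\<exists>i\<in>{1..n}. {1..int CARD('d) - 2} \<subseteq> {a i..b i})"
    (is "?det \<longleftrightarrow> ?cover")
proof
  have D: "DIM(real ^ 'd) = CARD('d)" by simp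
  {
    assume ?cover
    then obtain i where i: "i \<in> {1..n}" "{1..int CARD('d) - 2} \<subseteq> {a i..b i}" by blast
    have "1 \<in> {1..int CARD('d) - 2}" "int CARD('d) - 2 \<in> {1..int CARD('d) - 2}" using assms(1) by auto
    then have ab: "a i \<le> 1" "int CARD('d) - 2 \<le> b i" using i(2) by auto
    show ?det
    proof (intro allI impI)
      fix P Q :: "(real ^ 'd) set"
      assume P: "full_dim_polytope P" and Q: "full_dim_polytope Q"
        and sk: "\<forall>i\<in>{1..n}. skeleton (a i) (b i) P \<cong>\<^sub>p skeleton (a i) (b i) Q"
      let ?S = "\<lambda>R::(real ^ 'd) set. {F. F face_of R \<and> a i \<le> aff_dim F \<and> aff_dim F \<le> b i}"
      have pol: "polytope P" "polytope Q" using P Q by (auto simp: full_dim_polytope_def)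
      have "?S P \<cong>\<^sub>p ?S Q" using sk i(1) by (simp add: skeleton_eq_face_of P Q)
      then have "dim_iso (?S P) (?S Q)" by (rule skeleton_iso_preserves_dim[OF pol])
      then have "dim_iso {F \<in> ?S P. 1 \<le> aff_dim F \<and> aff_dim F \<le> int DIM(real ^ 'd) - 2}
          {F \<in> ?S Q. 1 \<le> aff_dim F \<and> aff_dim F \<le> int DIM(real ^ 'd) - 2}"
        by (rule dim_iso_restrict)
      moreover have "{F \<in> ?S R. 1 \<le> aff_dim F \<and> aff_dim F \<le> int DIM(real ^ 'd) - 2} =
        {F. F face_of R \<and> 1 \<le> aff_dim F \<and> aff_dim F \<le> int DIM(real ^ 'd) - 2}" for R
        using ab by auto
      ultimately have "dim_iso {F. F face_of P} {F. F face_of Q}"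
        using reconstruction[OF P Q] assms(1) by simp
      then show "faces P \<cong>\<^sub>p faces Q"
        unfolding faces_eq_face_of[OF P] faces_eq_face_of[OF Q] by (rule dim_iso_imp_poset_isomorphic)
    qed
  }
  {
    assume det: ?det
    show ?cover
    proof (rule ccontr)
      assume "\<not> ?cover"
      have miss: "a i \<ge> 2 \<or> b i \<le> int CARD('d) - 3" if i: "i \<in> {1..n}" for i
      proof (rule ccontr)
        assume "\<not> ?thesis"
        then have "a i \<le> 1" "int CARD('d) - 2 \<le> b i" by auto
        then have "{1..int CARD('d) - 2} \<subseteq> {a i..b i}" by auto
        then show False using \<open>\<not> ?cover\<close> i by blast
      qed
      have d3: "DIM(real ^ 'd) \<ge> 3" using assms(1) by simp
      obtain q :: "real ^ 'd" where q: "q \<in> Basis" using other_Basis_element[OF d3] by metis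
      obtain r :: "real ^ 'd" where r: "r \<in> Basis" "r \<noteq> q" using other_Basis_element[OF d3] by metis
      let ?P = "stacked_cut q q" and ?Q = "stacked_cut q r"
      have P: "full_dim_polytope ?P" and Q: "full_dim_polytope ?Q"
        using full_dim_stacked_cut[OF q _ d3] q r by auto
      have high: "dim_iso {F. F face_of ?P \<and> 2 \<le> aff_dim F} {F. F face_of ?Q \<and> 2 \<le> aff_dim F}"
        by (rule stacked_cut_high_iso[OF q q r(1) d3])
      have low: "dim_iso {F. F face_of ?P \<and> aff_dim F \<le> int CARD('d) - 3} {F. F face_of ?Q \<and> aff_dim F \<le> int CARD('d) - 3}"
        using stacked_cut_low_iso[OF q r(1) _ d3] r(2) by simp
      have "skeleton (a i) (b i) ?P \<cong>\<^sub>p skeleton (a i) (b i) ?Q" if i: "i \<in> {1..n}" for i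
      proof -
        let ?p = "\<lambda>k. a i \<le> k \<and> k \<le> b i"
        let ?S = "\<lambda>R::(real ^ 'd) set. {F. F face_of R \<and> ?p (aff_dim F)}"
        have "dim_iso (?S ?P) (?S ?Q)"
        proof (cases "a i \<ge> 2")
          case True
          then have "{F \<in> {F. F face_of R \<and> 2 \<le> aff_dim F}. ?p (aff_dim F)} = ?S R" for R by auto
          then show ?thesis using dim_iso_restrict[OF high, of ?p] by simp
        next
          case False
          then have "b i \<le> int CARD('d) - 3" using miss[OF i] by blast
          then have "{F \<in> {F. F face_of R \<and> aff_dim F \<le> int CARD('d) - 3}. ?p (aff_dim F)} = ?S R" for R by auto
          then show ?thesis using dim_iso_restrict[OF low, of ?p] by simp
        qed
        then show ?thesis
          unfolding skeleton_eq_face_of[OF P] skeleton_eq_face_of[OF Q] by (rule dim_iso_imp_poset_isomorphic)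
      qed
      then have "faces ?P \<cong>\<^sub>p faces ?Q" using det P Q by blast
      then have "dim_iso {F. F face_of ?P} {F. F face_of ?Q}"
        unfolding faces_eq_face_of[OF P] faces_eq_face_of[OF Q]
        by (rule face_lattice_iso_preserves_dim[OF polytope_stacked_cut polytope_stacked_cut])
      then show False using stacked_cut_not_iso[OF q r(1) r(2)[symmetric] d3] by blast
    qed
  }
qed

end
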